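(* Let $M^3$ be a closed, oriented, $C^\infty$ $3$-manifold with a transversely oriented Riemannian flow $\mathbf F$. Let $g$ be a Dominguez metric for $\mathbf F$ and let $V$ be a unit length vector field tangent to the flow. (i) If $Ric^M(V,V)\equiv 0$ on $M^3$ and $\kappa\wedge\chi_{\mathbf F}$ is harmonic, then $\mathbf H$ is integrable, $\mathbf F$ is totally geodesic, $\kappa\wedge\chi_{\mathbf F}\equiv 0$, and locally $M^3$ is isometric to a (Riemannian) product of the plaques of the leaves of $\mathbf H$ and $\mathbf F$. (ii) Conversely, if $\mathbf H$ is integrable and $\mathbf F$ is totally geodesic, then $Ric^M(V,V)\equiv 0$ and $\kappa\wedge\chi_{\mathbf F}\equiv 0$ on $M^3$; in particular $\kappa\wedge\chi_{\mathbf F}$ is harmonic.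
   Context: All objects are $C^\infty$. A closed manifold is compact without boundary. A flow is a foliation with one-dimensional leaves. $\mathbf V$ is the distribution tangent to $\mathbf F$, $\mathbf H=\mathbf V^\perp$ its $g$-orthogonal complement, $\mathcal H E$ the projection of $E$ to $\mathbf H$. Sections of $\mathbf V$ (resp. $\mathbf H$) are vertical (resp. horizontal). A (local) basic vector field is a horizontal vector field which projects to a well-defined vector field under the local submersions defining $\mathbf F$. A differential form $\phi$ is basic if $i(W)\phi=0$ and $\theta(W)\phi=0$ (interior product and Lie derivative) for all vertical $W$. $\mathbf F$ is bundle-like with respect to $g$ if $W\,g(X,X)=0$ for every local basic $X$ and vertical $W$; $\mathbf F$ is a Riemannian foliation (Riemannian flow) if it is bundle-like for some metric. $D$ is the Levi-Civita connection of $g$ and $Ric^M$ its Ricci tensor. The mean curvature vector field is $\tau=\mathcal H D_VV$, the mean curvature one-form is $\kappa(E)=g(E,\tau)$, and the characteristic form is the one-form $\chi_{\mathbf F}(E)=g(E,V)$ ($V$ positively oriented). A Dominguez metric for $\mathbf F$ is a metric $g$ for which $\mathbf F$ is bundle-like and $\kappa$ is basic. $\mathbf F$ is totally geodesic if its leaves are totally geodesic submanifolds. A form is harmonic if it is closed and co-closed. *)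

theory Defs
  imports "HOL-Analysis.Analysis"
begin

section \<open>Smooth manifolds\<close>

text \<open>
  For open \<open>S\<close>, \<open>k_smooth_on k S f\<close> says that \<open>f\<close> is of class \<open>C\<^sup>k\<close> on \<open>S\<close>.
\<close>

fun k_smooth_on :: "nat \<Rightarrow> 'a::real_normed_vector set \<Rightarrow> ('a \<Rightarrow> 'b::real_normed_vector) \<Rightarrow> bool" where
  "k_smooth_on 0 S f \<longleftrightarrow> continuous_on S f"
| "k_smooth_on (Suc k) S f \<longleftrightarrow>
     (\<forall>x\<in>S. f differentiable (at x)) \<and>
     (\<forall>v. k_smooth_on k S (\<lambda>x. frechet_derivative f (at x) v))"

definition smooth_on :: "'a::real_normed_vector set \<Rightarrow> ('a \<Rightarrow> 'b::real_normed_vector) \<Rightarrow> bool" where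
  "smooth_on S f \<longleftrightarrow> (\<forall>k. k_smooth_on k S f)"

record ('a, 'n) chart =
  cdom :: "'a set"
  coord :: "'a \<Rightarrow> real^'n"

definition cinv :: "('a, 'n::finite) chart \<Rightarrow> real^'n \<Rightarrow> 'a" where
  "cinv c = inv_into (cdom c) (coord c)"

definition cimg :: "('a, 'n::finite) chart \<Rightarrow> 'a set \<Rightarrow> (real^'n) set" where
  "cimg c S = coord c ` (cdom c \<inter> S)"

definition trans_map :: "('a, 'n::finite) chart \<Rightarrow> ('a, 'n) chart \<Rightarrow> real^'n \<Rightarrow> real^'n" where
  "trans_map c c' = coord c' \<circ> cinv c"

definition is_chart :: "'a topology \<Rightarrow> ('a, 'n::finite) chart \<Rightarrow> bool" where
  "is_chart M c \<longleftrightarrow>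
     openin M (cdom c) \<and> open (coord c ` cdom c) \<and>
     homeomorphic_map (subtopology M (cdom c)) (top_of_set (coord c ` cdom c)) (coord c)"

definition smooth_atlas :: "'a topology \<Rightarrow> ('a, 'n::finite) chart set \<Rightarrow> bool" where
  "smooth_atlas M A \<longleftrightarrow>
     (\<forall>c\<in>A. is_chart M c) \<and> (\<Union>c\<in>A. cdom c) = topspace M \<and>
     (\<forall>c\<in>A. \<forall>c'\<in>A. smooth_on (cimg c (cdom c')) (trans_map c c'))"

definition closed_manifold :: "'a topology \<Rightarrow> ('a, 'n::finite) chart set \<Rightarrow> bool" where
  "closed_manifold M A \<longleftrightarrow>
     Hausdorff_space M \<and> second_countable M \<and> compact_space M \<and> smooth_atlas M A"

definition oriented_atlas :: "('a, 'n::finite) chart set \<Rightarrow> bool" where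
  "oriented_atlas A \<longleftrightarrow>
     (\<forall>c\<in>A. \<forall>c'\<in>A. \<forall>x\<in>cimg c (cdom c').
        det (matrix (frechet_derivative (trans_map c c') (at x))) > 0)"

definition smooth_map_on ::
  "('a, 'n::finite) chart set \<Rightarrow> 'a set \<Rightarrow> ('a \<Rightarrow> 'b::real_normed_vector) \<Rightarrow> bool" where
  "smooth_map_on A S f \<longleftrightarrow> (\<forall>c\<in>A. smooth_on (cimg c S) (f \<circ> cinv c))"

definition tangent_map ::
  "('a \<Rightarrow> 'b::real_normed_vector) \<Rightarrow> ('a, 'n::finite) chart \<Rightarrow> real^'n \<Rightarrow> real^'n \<Rightarrow> 'b" where
  "tangent_map f c x = frechet_derivative (f \<circ> cinv c) (at x)"


section \<open>Tensor fields and Riemannian metrics\<close>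

text \<open>
  A tensor field is the family of its component functions with respect to the charts of the
  atlas, subject to the usual transformation law. The components with respect to the chart
  \<open>c\<close> are functions on the open set \<open>coord c ` cdom c\<close>; their values elsewhere are irrelevant.
  A tangent vector at the point with coordinates \<open>x\<close> in \<open>c\<close> is thus given by its component
  vector. Differential operators are defined chart by chart.
\<close>

type_synonym ('a, 'n) vfield = "('a, 'n) chart \<Rightarrow> real^'n \<Rightarrow> real^'n"
type_synonym ('a, 'n) metric = "('a, 'n) chart \<Rightarrow> real^'n \<Rightarrow> real^'n^'n"
type_synonym ('a, 'n) form1 = "('a, 'n) chart \<Rightarrow> real^'n \<Rightarrow> real^'n \<Rightarrow> real"
type_synonym ('a, 'n) form2 = "('a, 'n) chart \<Rightarrow> real^'n \<Rightarrow> real^'n \<Rightarrow> real^'n \<Rightarrow> real"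

definition vector_field_on ::
  "('a, 'n::finite) chart set \<Rightarrow> 'a set \<Rightarrow> ('a, 'n) vfield \<Rightarrow> bool" where
  "vector_field_on A S X \<longleftrightarrow>
     (\<forall>c\<in>A. smooth_on (cimg c S) (X c)) \<and>
     (\<forall>c\<in>A. \<forall>c'\<in>A. \<forall>x\<in>cimg c (cdom c' \<inter> S).
        X c' (trans_map c c' x) = frechet_derivative (trans_map c c') (at x) (X c x))"

definition inner_at :: "real^'n::finite^'n \<Rightarrow> real^'n \<Rightarrow> real^'n \<Rightarrow> real" where
  "inner_at G u v = u \<bullet> (G *v v)"

definition riemannian_metric ::
  "('a, 'n::finite) chart set \<Rightarrow> ('a, 'n) metric \<Rightarrow> bool" where
  "riemannian_metric A g \<longleftrightarrow>
     (\<forall>c\<in>A. smooth_on (coord c ` cdom c) (g c) \<and>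
        (\<forall>x\<in>coord c ` cdom c. transpose (g c x) = g c x \<and>
           (\<forall>v. v \<noteq> 0 \<longrightarrow> inner_at (g c x) v v > 0))) \<and>
     (\<forall>c\<in>A. \<forall>c'\<in>A. \<forall>x\<in>cimg c (cdom c'). \<forall>u v.
        inner_at (g c x) u v =
        inner_at (g c' (trans_map c c' x))
          (frechet_derivative (trans_map c c') (at x) u)
          (frechet_derivative (trans_map c c') (at x) v))"

text \<open>
  The operators in this block act on the components \<open>G\<close>, \<open>X\<close>, \<open>Y\<close>, \<open>Z\<close> in one chart.
  \<open>christoffel G x u v\<close> is the vector with components
  \<open>\<Gamma>\<^sup>m\<^sub>i\<^sub>j u\<^sup>i v\<^sup>j\<close>.
\<close>

definition metric_deriv ::
  "(real^'n::finite \<Rightarrow> real^'n^'n) \<Rightarrow> real^'n \<Rightarrow> real^'n \<Rightarrow> real^'n \<Rightarrow> real^'n \<Rightarrow> real" where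
  "metric_deriv G x w u v = frechet_derivative (\<lambda>y. inner_at (G y) u v) (at x) w"

definition christoffel ::
  "(real^'n::finite \<Rightarrow> real^'n^'n) \<Rightarrow> real^'n \<Rightarrow> real^'n \<Rightarrow> real^'n \<Rightarrow> real^'n" where
  "christoffel G x u v =
     matrix_inv (G x) *v
       (\<chi> l. (metric_deriv G x u v (axis l 1) + metric_deriv G x v u (axis l 1)
               - metric_deriv G x (axis l 1) u v) / 2)"

definition levi_civita ::
  "(real^'n::finite \<Rightarrow> real^'n^'n) \<Rightarrow> (real^'n \<Rightarrow> real^'n) \<Rightarrow> (real^'n \<Rightarrow> real^'n) \<Rightarrow> real^'n \<Rightarrow> real^'n"
  where
  "levi_civita G X Y x = frechet_derivative Y (at x) (X x) + christoffel G x (X x) (Y x)"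

definition lie_bracket ::
  "(real^'n::finite \<Rightarrow> real^'n) \<Rightarrow> (real^'n \<Rightarrow> real^'n) \<Rightarrow> real^'n \<Rightarrow> real^'n" where
  "lie_bracket X Y x = frechet_derivative Y (at x) (X x) - frechet_derivative X (at x) (Y x)"

definition curvature ::
  "(real^'n::finite \<Rightarrow> real^'n^'n) \<Rightarrow> (real^'n \<Rightarrow> real^'n) \<Rightarrow> (real^'n \<Rightarrow> real^'n) \<Rightarrow>
     (real^'n \<Rightarrow> real^'n) \<Rightarrow> real^'n \<Rightarrow> real^'n" where
  "curvature G X Y Z x =
     levi_civita G X (levi_civita G Y Z) x - levi_civita G Y (levi_civita G X Z) x
       - levi_civita G (lie_bracket X Y) Z x"

text \<open>
  \<open>Ric(Y, Z)\<close> is the trace of \<open>X \<mapsto> R(X, Y) Z\<close>, computed in the coordinate frame.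
\<close>

definition ricci ::
  "(real^'n::finite \<Rightarrow> real^'n^'n) \<Rightarrow> (real^'n \<Rightarrow> real^'n) \<Rightarrow> (real^'n \<Rightarrow> real^'n) \<Rightarrow> real^'n \<Rightarrow> real"
  where
  "ricci G Y Z x = (\<Sum>i\<in>UNIV. curvature G (\<lambda>_. axis i 1) Y Z x $ i)"


section \<open>Differential forms\<close>

definition wedge :: "('a, 'n::finite) form1 \<Rightarrow> ('a, 'n) form1 \<Rightarrow> ('a, 'n) form2" where
  "wedge \<alpha> \<beta> c x u v = \<alpha> c x u * \<beta> c x v - \<alpha> c x v * \<beta> c x u"

definition ext_deriv1 :: "('a, 'n::finite) form1 \<Rightarrow> ('a, 'n) form2" where
  "ext_deriv1 \<alpha> c x u v =
     frechet_derivative (\<lambda>y. \<alpha> c y v) (at x) u - frechet_derivative (\<lambda>y. \<alpha> c y u) (at x) v"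

definition ext_deriv2 ::
  "('a, 'n::finite) form2 \<Rightarrow> ('a, 'n) chart \<Rightarrow> real^'n \<Rightarrow> real^'n \<Rightarrow> real^'n \<Rightarrow> real^'n \<Rightarrow> real" where
  "ext_deriv2 \<omega> c x u v w =
     frechet_derivative (\<lambda>y. \<omega> c y v w) (at x) u
     - frechet_derivative (\<lambda>y. \<omega> c y u w) (at x) v
     + frechet_derivative (\<lambda>y. \<omega> c y u v) (at x) w"

text \<open>
  \<open>(\<theta>(W) \<alpha>)(u) = W (\<alpha> u) - \<alpha> [W, u]\<close>, where \<open>u\<close> is extended to a field with constant
  components, so that \<open>[W, u] = - DW u\<close>.
\<close>

definition lie_deriv1 ::
  "('a, 'n::finite) vfield \<Rightarrow> ('a, 'n) form1 \<Rightarrow> ('a, 'n) form1" where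
  "lie_deriv1 W \<alpha> c x u =
     frechet_derivative (\<lambda>y. \<alpha> c y u) (at x) (W c x)
       - \<alpha> c x (lie_bracket (W c) (\<lambda>_. u) x)"

text \<open>
  The Riemannian volume form on an oriented 3-manifold in a positively oriented chart, and the
  Hodge star of a 2-form: \<open>(\<star>\<omega>)(w) = 1/2 \<Sum>\<^sub>i\<^sub>j \<omega>(\<partial>\<^sup>i, \<partial>\<^sup>j) vol(\<partial>\<^sub>i, \<partial>\<^sub>j, w)\<close>,
  where \<open>\<partial>\<^sup>i = g\<^sup>i\<^sup>a \<partial>\<^sub>a\<close>. On 2-forms in dimension 3 the sign
  \<open>(-1)\<^bsup>n(p+1)+1\<^esup>\<close> in the codifferential \<open>\<delta> = \<plusminus> \<star> d \<star>\<close> is \<open>+\<close>.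
\<close>

definition volume_form ::
  "('a, 3) metric \<Rightarrow> ('a, 3) chart \<Rightarrow> real^3 \<Rightarrow> real^3 \<Rightarrow> real^3 \<Rightarrow> real^3 \<Rightarrow> real" where
  "volume_form g c x u v w = sqrt (det (g c x)) * det (vector [u, v, w] :: real^3^3)"

definition hodge_star2 :: "('a, 3) metric \<Rightarrow> ('a, 3) form2 \<Rightarrow> ('a, 3) form1" where
  "hodge_star2 g \<omega> c x w =
     (\<Sum>i\<in>UNIV. \<Sum>j\<in>UNIV.
        \<omega> c x (matrix_inv (g c x) *v axis i 1) (matrix_inv (g c x) *v axis j 1)
        * volume_form g c x (axis i 1) (axis j 1) w) / 2"

definition codifferential2 :: "('a, 3) metric \<Rightarrow> ('a, 3) form2 \<Rightarrow> ('a, 3) form1" where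
  "codifferential2 g \<omega> = hodge_star2 g (ext_deriv1 (hodge_star2 g \<omega>))"

definition harmonic2 ::
  "('a, 3) chart set \<Rightarrow> ('a, 3) metric \<Rightarrow> ('a, 3) form2 \<Rightarrow> bool" where
  "harmonic2 A g \<omega> \<longleftrightarrow>
     (\<forall>c\<in>A. \<forall>x\<in>coord c ` cdom c.
        (\<forall>u v w. ext_deriv2 \<omega> c x u v w = 0) \<and> (\<forall>w. codifferential2 g \<omega> c x w = 0))"


section \<open>Foliations\<close>

text \<open>
  A foliation of codimension \<open>CARD('q)\<close> is given by a Haefliger cocycle: the local
  submersions defining it, on overlaps locally related by diffeomorphisms \<open>\<gamma>\<close> (with inverse
  \<open>\<gamma>'\<close>) between open sets of the local quotients.
\<close>

type_synonym ('a, 'q) cocycle = "('a set \<times> ('a \<Rightarrow> real^'q)) set"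

definition transverse_change ::
  "('a \<Rightarrow> real^'q::finite) \<Rightarrow> ('a \<Rightarrow> real^'q) \<Rightarrow> 'a set \<Rightarrow> (real^'q \<Rightarrow> real^'q) \<Rightarrow> bool" where
  "transverse_change f f' W \<gamma> \<longleftrightarrow>
     smooth_on (f ` W) \<gamma> \<and> (\<forall>q\<in>W. f' q = \<gamma> (f q)) \<and>
     (\<exists>\<gamma>'. smooth_on (f' ` W) \<gamma>' \<and> (\<forall>q\<in>W. f q = \<gamma>' (f' q)))"

definition foliation ::
  "'a topology \<Rightarrow> ('a, 'n::finite) chart set \<Rightarrow> ('a, 'q::finite) cocycle \<Rightarrow> bool" where
  "foliation M A F \<longleftrightarrow>
     (\<Union>(U, f)\<in>F. U) = topspace M \<and>
     (\<forall>(U, f)\<in>F. openin M U \<and> smooth_map_on A U f \<and>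
        (\<forall>c\<in>A. \<forall>x\<in>cimg c U. surj (tangent_map f c x))) \<and>
     (\<forall>(U, f)\<in>F. \<forall>(U', f')\<in>F. \<forall>p\<in>U \<inter> U'.
        \<exists>W \<gamma>. openin M W \<and> p \<in> W \<and> W \<subseteq> U \<inter> U' \<and> transverse_change f f' W \<gamma>)"

definition transversely_oriented ::
  "'a topology \<Rightarrow> ('a, 'q::finite) cocycle \<Rightarrow> bool" where
  "transversely_oriented M F \<longleftrightarrow>
     (\<forall>(U, f)\<in>F. \<forall>(U', f')\<in>F. \<forall>p\<in>U \<inter> U'.
        \<exists>W \<gamma>. openin M W \<and> p \<in> W \<and> W \<subseteq> U \<inter> U' \<and> transverse_change f f' W \<gamma> \<and>
          (\<forall>y\<in>f ` W. det (matrix (frechet_derivative \<gamma> (at y))) > 0))"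

definition vertical_space ::
  "('a, 'q::finite) cocycle \<Rightarrow> ('a, 'n::finite) chart \<Rightarrow> real^'n \<Rightarrow> (real^'n) set" where
  "vertical_space F c x = {v. \<forall>(U, f)\<in>F. cinv c x \<in> U \<longrightarrow> tangent_map f c x v = 0}"

definition horizontal_space ::
  "('a, 'q::finite) cocycle \<Rightarrow> ('a, 'n::finite) metric \<Rightarrow> ('a, 'n) chart \<Rightarrow> real^'n \<Rightarrow> (real^'n) set"
  where
  "horizontal_space F g c x = {u. \<forall>v\<in>vertical_space F c x. inner_at (g c x) u v = 0}"

definition vertical_field_on ::
  "('a, 'n::finite) chart set \<Rightarrow> ('a, 'q::finite) cocycle \<Rightarrow> 'a set \<Rightarrow> ('a, 'n) vfield \<Rightarrow> bool" where
  "vertical_field_on A F S W \<longleftrightarrow>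
     vector_field_on A S W \<and> (\<forall>c\<in>A. \<forall>x\<in>cimg c S. W c x \<in> vertical_space F c x)"

definition basic_field_on ::
  "'a topology \<Rightarrow> ('a, 'n::finite) chart set \<Rightarrow> ('a, 'q::finite) cocycle \<Rightarrow> ('a, 'n) metric \<Rightarrow>
     'a set \<Rightarrow> ('a, 'n) vfield \<Rightarrow> bool" where
  "basic_field_on M A F g S X \<longleftrightarrow>
     vector_field_on A S X \<and> (\<forall>c\<in>A. \<forall>x\<in>cimg c S. X c x \<in> horizontal_space F g c x) \<and>
     (\<forall>(U, f)\<in>F. \<forall>p\<in>U \<inter> S. \<exists>N Y. openin M N \<and> p \<in> N \<and> N \<subseteq> U \<inter> S \<and>
        smooth_on (f ` N) Y \<and>
        (\<forall>c\<in>A. \<forall>x\<in>cimg c N. tangent_map f c x (X c x) = Y (f (cinv c x))))"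

definition bundle_like ::
  "'a topology \<Rightarrow> ('a, 'n::finite) chart set \<Rightarrow> ('a, 'q::finite) cocycle \<Rightarrow> ('a, 'n) metric \<Rightarrow> bool"
  where
  "bundle_like M A F g \<longleftrightarrow>
     (\<forall>S X W. openin M S \<and> basic_field_on M A F g S X \<and> vertical_field_on A F S W \<longrightarrow>
        (\<forall>c\<in>A. \<forall>x\<in>cimg c S.
           frechet_derivative (\<lambda>y. inner_at (g c y) (X c y) (X c y)) (at x) (W c x) = 0))"

definition riemannian_foliation ::
  "'a topology \<Rightarrow> ('a, 'n::finite) chart set \<Rightarrow> ('a, 'q::finite) cocycle \<Rightarrow> bool" where
  "riemannian_foliation M A F \<longleftrightarrow>
     foliation M A F \<and> (\<exists>g. riemannian_metric A g \<and> bundle_like M A F g)"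

definition basic_form1 ::
  "'a topology \<Rightarrow> ('a, 'n::finite) chart set \<Rightarrow> ('a, 'q::finite) cocycle \<Rightarrow> ('a, 'n) form1 \<Rightarrow> bool"
  where
  "basic_form1 M A F \<phi> \<longleftrightarrow>
     (\<forall>W. vertical_field_on A F (topspace M) W \<longrightarrow>
        (\<forall>c\<in>A. \<forall>x\<in>coord c ` cdom c.
           \<phi> c x (W c x) = 0 \<and> (\<forall>u. lie_deriv1 W \<phi> c x u = 0)))"

text \<open>The leaves are totally geodesic iff their second fundamental form vanishes.\<close>

definition totally_geodesic ::
  "'a topology \<Rightarrow> ('a, 'n::finite) chart set \<Rightarrow> ('a, 'q::finite) cocycle \<Rightarrow> ('a, 'n) metric \<Rightarrow> bool"
  where
  "totally_geodesic M A F g \<longleftrightarrow>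
     (\<forall>S W W'. openin M S \<and> vertical_field_on A F S W \<and> vertical_field_on A F S W' \<longrightarrow>
        (\<forall>c\<in>A. \<forall>x\<in>cimg c S. levi_civita (g c) (W c) (W' c) x \<in> vertical_space F c x))"

text \<open>
  The remaining definitions are for flows; \<open>V\<close> is a unit length field tangent to the flow.
  \<open>H\<close> is integrable iff it is the tangent distribution of a foliation, which then has
  codimension one.
\<close>

definition horizontal_integrable ::
  "'a topology \<Rightarrow> ('a, 'n::finite) chart set \<Rightarrow> ('a, 'q::finite) cocycle \<Rightarrow> ('a, 'n) metric \<Rightarrow> bool"
  where
  "horizontal_integrable M A F g \<longleftrightarrow>
     (\<exists>F' :: ('a, 1) cocycle. foliation M A F' \<and>
        (\<forall>c\<in>A. \<forall>x\<in>coord c ` cdom c. vertical_space F' c x = horizontal_space F g c x))"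

definition unit_tangent_field ::
  "'a topology \<Rightarrow> ('a, 'n::finite) chart set \<Rightarrow> ('a, 'q::finite) cocycle \<Rightarrow> ('a, 'n) metric \<Rightarrow>
     ('a, 'n) vfield \<Rightarrow> bool" where
  "unit_tangent_field M A F g V \<longleftrightarrow>
     vertical_field_on A F (topspace M) V \<and>
     (\<forall>c\<in>A. \<forall>x\<in>coord c ` cdom c. inner_at (g c x) (V c x) (V c x) = 1)"

definition mean_curvature_field ::
  "('a, 'n::finite) metric \<Rightarrow> ('a, 'n) vfield \<Rightarrow> ('a, 'n) vfield" where
  "mean_curvature_field g V c x =
     (let a = levi_civita (g c) (V c) (V c) x
      in a - inner_at (g c x) a (V c x) *\<^sub>R V c x)"

definition mean_curvature_form ::
  "('a, 'n::finite) metric \<Rightarrow> ('a, 'n) vfield \<Rightarrow> ('a, 'n) form1" where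
  "mean_curvature_form g V c x u = inner_at (g c x) u (mean_curvature_field g V c x)"

definition characteristic_form ::
  "('a, 'n::finite) metric \<Rightarrow> ('a, 'n) vfield \<Rightarrow> ('a, 'n) form1" where
  "characteristic_form g V c x u = inner_at (g c x) u (V c x)"

text \<open>
  \<open>V\<close> enters only through \<open>\<tau>\<close>, which is quadratic in \<open>V\<close> and hence does not depend on
  the choice of the unit field.
\<close>

definition dominguez_metric ::
  "'a topology \<Rightarrow> ('a, 'n::finite) chart set \<Rightarrow> ('a, 'q::finite) cocycle \<Rightarrow> ('a, 'n) metric \<Rightarrow>
     ('a, 'n) vfield \<Rightarrow> bool" where
  "dominguez_metric M A F g V \<longleftrightarrow>
     riemannian_metric A g \<and> bundle_like M A F g \<and>
     basic_form1 M A F (mean_curvature_form g V)"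

text \<open>
  Every point has an open neighbourhood \<open>W\<close> with a diffeomorphism \<open>\<psi>\<close> onto a product
  \<open>B \<times> J\<close> such that the slices \<open>B \<times> {t}\<close> are plaques of the leaves of \<open>H\<close>, the slices
  \<open>{b} \<times> J\<close> are plaques of the leaves of the flow, and \<open>\<psi>\<close> is an isometry from \<open>g\<close> to
  the product metric \<open>h + k dt\<^sup>2\<close>. So \<open>h\<close> and \<open>k dt\<^sup>2\<close> are the metrics induced by \<open>g\<close> on
  the plaques; being induced, they are positive definite and smooth.
\<close>

definition locally_product_of_plaques ::
  "'a topology \<Rightarrow> ('a, 3) chart set \<Rightarrow> ('a, 2) cocycle \<Rightarrow> ('a, 3) metric \<Rightarrow> bool" where
  "locally_product_of_plaques M A F g \<longleftrightarrow>
     (\<forall>p\<in>topspace M. \<exists>W (\<psi> :: 'a \<Rightarrow> (real^2) \<times> real) B J (h :: real^2 \<Rightarrow> real^2^2) (k :: real \<Rightarrow> real).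
        openin M W \<and> p \<in> W \<and>
        open B \<and> connected B \<and> open J \<and> connected J \<and>
        homeomorphic_map (subtopology M W) (top_of_set (B \<times> J)) \<psi> \<and>
        smooth_map_on A W \<psi> \<and>
        (\<forall>c\<in>A. smooth_on (\<psi> ` (W \<inter> cdom c)) (coord c \<circ> inv_into W \<psi>)) \<and>
        (\<forall>c\<in>A. \<forall>x\<in>cimg c W.
           vertical_space F c x = {v. fst (tangent_map \<psi> c x v) = 0} \<and>
           horizontal_space F g c x = {v. snd (tangent_map \<psi> c x v) = 0} \<and>
           (\<forall>u v. inner_at (g c x) u v =
              inner_at (h (fst (\<psi> (cinv c x)))) (fst (tangent_map \<psi> c x u)) (fst (tangent_map \<psi> c x v))
              + k (snd (\<psi> (cinv c x))) * snd (tangent_map \<psi> c x u) * snd (tangent_map \<psi> c x v))))"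

end

theory Submission
  imports Defs
begin

text \<open>
  Write \<open>S u = D\<^sub>u V\<close>, an endomorphism of each tangent space, so that \<open>\<tau> = S V\<close> and \<open>\<langle>S u, V\<rangle> = 0\<close>.
  Everything is read off from \<open>S\<close>: its skew part is \<open>d\<chi>\<close> up to a factor, and its restriction to \<open>\<H>\<close> is skew
  because the flow is bundle-like (\<open>bundle_like_cov_deriv\<close>). Hence \<open>tr S = 0\<close>. Tracing the curvature gives, for any field,
  \<open>Ric (V, V) = div \<tau> - V (tr S) - tr S\<^sup>2\<close> (\<open>ricci_formula\<close>).

  For (i), let \<open>s\<close> be the volume density of a chart. Then \<open>\<star>(\<kappa> \<and> \<chi>) = det (s \<tau>, V, \<cdot>)\<close>. Co-closedness of
  \<open>\<kappa> \<and> \<chi>\<close> makes the curl of \<open>s \<tau> \<times> V\<close> vanish, and the component of this equation along \<open>V\<close> is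
  \<open>div \<tau> = - \<langle>\<tau>, \<tau>\<rangle>\<close> (\<open>divergence_if_coclosed\<close>). On a closed manifold a divergence that is nowhere
  positive vanishes (\<open>nonpositive_divergence_eq_0\<close>), so \<open>\<tau> = 0\<close>. Now \<open>S\<close> is skew on the whole tangent space and
  \<open>Ric (V, V) = - tr S\<^sup>2\<close> is its squared norm. So \<open>Ric (V, V) = 0\<close> forces \<open>S = 0\<close>: the field \<open>V\<close> is
  parallel. Then \<open>\<chi>\<close> is closed, locally \<open>\<chi> = dt\<close>, and the level sets of \<open>t\<close> are the leaves of \<open>\<H>\<close>. A local submersion
  \<open>f\<close> that defines the flow completes \<open>t\<close> to coordinates \<open>(f, t)\<close>, in which the metric splits; the part on
  \<open>\<H>\<close> is independent of \<open>t\<close>, again because the flow is bundle-like (\<open>locally_product\<close>).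

  For (ii), totally geodesic leaves mean \<open>\<tau> = 0\<close>, and integrability of \<open>\<H>\<close> means that \<open>d\<chi>\<close> vanishes on \<open>\<H>\<close>
  (\<open>characteristic_closed_on_integrable\<close>). So the restriction of \<open>S\<close> to \<open>\<H>\<close> is both skew and symmetric, whence
  \<open>S = 0\<close> and the curvature term vanishes.
\<close>

section \<open>Calculus of smooth maps\<close>

abbreviation dir_deriv :: "('a::real_normed_vector \<Rightarrow> 'b::real_normed_vector) \<Rightarrow> 'a \<Rightarrow> 'a \<Rightarrow> 'b" where
  "dir_deriv f x \<equiv> frechet_derivative f (at x)"

lemma dir_deriv_eqI: "(f has_derivative f') (at x) \<Longrightarrow> dir_deriv f x = f'"
  by (rule frechet_derivative_at[symmetric])

lemma has_dir_deriv: "f differentiable (at x) \<Longrightarrow> (f has_derivative dir_deriv f x) (at x)"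
  by (simp add: frechet_derivative_works)

lemma dir_deriv_cong:
  assumes "open S" "x \<in> S" "\<And>y. y \<in> S \<Longrightarrow> f y = g y"
  shows "dir_deriv f x = dir_deriv g x"
proof -
  have "(f has_derivative F) (at x) \<longleftrightarrow> (g has_derivative F) (at x)" for F
    using has_derivative_transform_within_open[OF _ assms(1,2), of f F UNIV g]
      has_derivative_transform_within_open[OF _ assms(1,2), of g F UNIV f] assms(3) by auto
  then show ?thesis by (simp add: frechet_derivative_def)
qed

lemma k_smooth_on_cong:
  assumes "open S" "\<And>x. x \<in> S \<Longrightarrow> f x = g x" "k_smooth_on k S f"
  shows "k_smooth_on k S g"
  using assms(2,3)
proof (induction k arbitrary: f g)
  case 0
  then show ?case by (simp cong: continuous_on_cong)
next
  case (Suc k)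
  have "g differentiable (at x)" if "x \<in> S" for x
  proof -
    have "(f has_derivative dir_deriv f x) (at x)"
      using Suc.prems that by (simp add: has_dir_deriv)
    then show ?thesis
      using has_derivative_transform_within_open[OF _ assms(1) that, of f _ UNIV g] Suc.prems
      unfolding differentiable_def by auto
  qed
  moreover have "k_smooth_on k S (\<lambda>x. dir_deriv g x v)" for v
    using Suc.IH[of "\<lambda>x. dir_deriv f x v" "\<lambda>x. dir_deriv g x v"] Suc.prems
      dir_deriv_cong[OF assms(1), of _ f g]
    by force
  ultimately show ?case by simp
qed

lemma k_smooth_on_subset: "k_smooth_on k S f \<Longrightarrow> T \<subseteq> S \<Longrightarrow> k_smooth_on k T f"
  by (induction k arbitrary: f) (auto intro: continuous_on_subset)

lemma k_smooth_on_Suc_imp: "k_smooth_on (Suc k) S f \<Longrightarrow> k_smooth_on k S f"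
proof (induction k arbitrary: f)
  case 0
  then show ?case
    by (auto intro!: continuous_at_imp_continuous_on differentiable_imp_continuous_within)
next
  case (Suc k)
  then show ?case by simp
qed

lemma k_smooth_on_imp_continuous: "k_smooth_on k S f \<Longrightarrow> continuous_on S f"
  by (cases k) (auto intro!: continuous_at_imp_continuous_on differentiable_imp_continuous_within)

lemma k_smooth_on_const: "k_smooth_on k S (\<lambda>x. c)"
  by (induction k arbitrary: c) auto

lemma k_smooth_on_bounded_linear: "bounded_linear f \<Longrightarrow> k_smooth_on k S f"
proof (cases k)
  case 0
  assume "bounded_linear f" then show ?thesis
    using 0 by (simp add: linear_continuous_on)
next
  case (Suc n)
  assume f: "bounded_linear f"
  then have "dir_deriv f x = f" for x
    by (intro dir_deriv_eqI bounded_linear_imp_has_derivative)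
  then show ?thesis
    using Suc f by (auto simp: k_smooth_on_const intro: bounded_linear_imp_differentiable)
qed

lemma k_smooth_on_id: "k_smooth_on k S (\<lambda>x. x)"
  by (intro k_smooth_on_bounded_linear bounded_linear_ident)

lemma k_smooth_on_add:
  assumes "open S"
  shows "k_smooth_on k S f \<Longrightarrow> k_smooth_on k S g \<Longrightarrow> k_smooth_on k S (\<lambda>x. f x + g x)"
proof (induction k arbitrary: f g)
  case 0
  then show ?case by (simp add: continuous_on_add)
next
  case (Suc k)
  have D: "dir_deriv (\<lambda>x. f x + g x) x = (\<lambda>v. dir_deriv f x v + dir_deriv g x v)" if "x \<in> S" for x
    using Suc.prems that by (intro dir_deriv_eqI has_derivative_add has_dir_deriv) auto
  have "k_smooth_on k S (\<lambda>x. dir_deriv (\<lambda>x. f x + g x) x v)" for v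
    by (rule k_smooth_on_cong[OF assms _ Suc.IH[of "\<lambda>x. dir_deriv f x v" "\<lambda>x. dir_deriv g x v"]])
       (use Suc.prems in \<open>simp_all add: D\<close>)
  then show ?case using Suc.prems by simp
qed

lemma (in bounded_bilinear) k_smooth_on_bilinear:
  assumes "open S"
  shows "k_smooth_on k S f \<Longrightarrow> k_smooth_on k S g \<Longrightarrow> k_smooth_on k S (\<lambda>x. prod (f x) (g x))"
proof (induction k arbitrary: f g)
  case 0
  then show ?case by (simp add: continuous_on)
next
  case (Suc k)
  have H: "((\<lambda>x. prod (f x) (g x)) has_derivative
      (\<lambda>v. prod (f x) (dir_deriv g x v) + prod (dir_deriv f x v) (g x))) (at x)" if "x \<in> S" for x
    using Suc.prems that by (intro FDERIV has_dir_deriv) auto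
  have "k_smooth_on k S (\<lambda>x. dir_deriv (\<lambda>x. prod (f x) (g x)) x v)" for v
  proof (rule k_smooth_on_cong[OF assms _ k_smooth_on_add[OF assms]])
    show "k_smooth_on k S (\<lambda>x. prod (f x) (dir_deriv g x v))"
      using Suc.prems by (intro Suc.IH k_smooth_on_Suc_imp[of k S f]) auto
    show "k_smooth_on k S (\<lambda>x. prod (dir_deriv f x v) (g x))"
      using Suc.prems by (intro Suc.IH k_smooth_on_Suc_imp[of k S g]) auto
  qed (simp add: dir_deriv_eqI[OF H])
  then show ?case using H by (auto simp: differentiable_def)
qed

lemmas k_smooth_on_mult = bounded_bilinear.k_smooth_on_bilinear[OF bounded_bilinear_mult]
lemmas k_smooth_on_scaleR = bounded_bilinear.k_smooth_on_bilinear[OF bounded_bilinear_scaleR]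
lemmas k_smooth_on_inner = bounded_bilinear.k_smooth_on_bilinear[OF bounded_bilinear_inner]

lemma k_smooth_on_sum:
  assumes "open S" "\<And>i. i \<in> I \<Longrightarrow> k_smooth_on k S (f i)"
  shows "k_smooth_on k S (\<lambda>x. \<Sum>i\<in>I. f i x)"
  using assms(2)
proof (induction I rule: infinite_finite_induct)
  case (insert i I)
  then show ?case by (simp add: k_smooth_on_add[OF assms(1)])
qed (simp_all add: k_smooth_on_const)

lemma k_smooth_on_linear_comp:
  assumes "open S" "bounded_linear L"
  shows "k_smooth_on k S f \<Longrightarrow> k_smooth_on k S (\<lambda>x. L (f x))"
proof (induction k arbitrary: f)
  case 0
  then show ?case by (simp add: bounded_linear.continuous_on[OF assms(2)])
next
  case (Suc k)
  have H: "((\<lambda>x. L (f x)) has_derivative (\<lambda>v. L (dir_deriv f x v))) (at x)" if "x \<in> S" for x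
    using Suc.prems that by (intro bounded_linear.has_derivative[OF assms(2)] has_dir_deriv) auto
  have "k_smooth_on k S (\<lambda>x. dir_deriv (\<lambda>x. L (f x)) x v)" for v
    by (rule k_smooth_on_cong[OF assms(1) _ Suc.IH[of "\<lambda>x. dir_deriv f x v"]])
       (use Suc.prems in \<open>simp_all add: dir_deriv_eqI[OF H]\<close>)
  then show ?case using H by (auto simp: differentiable_def)
qed

lemma k_smooth_on_componentwise:
  fixes f :: "'a::real_normed_vector \<Rightarrow> 'b::euclidean_space"
  assumes "open S" "\<And>i. i \<in> Basis \<Longrightarrow> k_smooth_on k S (\<lambda>x. f x \<bullet> i)"
  shows "k_smooth_on k S f"
proof (rule k_smooth_on_cong[OF assms(1)])
  show "k_smooth_on k S (\<lambda>x. \<Sum>i\<in>Basis. (f x \<bullet> i) *\<^sub>R i)"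
    by (intro k_smooth_on_sum assms(1) k_smooth_on_scaleR assms(2) k_smooth_on_const) auto
qed (simp add: euclidean_representation)

lemma linear_Basis_expansion:
  fixes f :: "'a::euclidean_space \<Rightarrow> 'b::real_vector"
  assumes "linear f"
  shows "f w = (\<Sum>e\<in>Basis. (w \<bullet> e) *\<^sub>R f e)"
proof -
  have "f (\<Sum>e\<in>Basis. (w \<bullet> e) *\<^sub>R e) = (\<Sum>e\<in>Basis. (w \<bullet> e) *\<^sub>R f e)"
    by (simp add: linear_sum[OF assms] linear_cmul[OF assms])
  then show ?thesis by (simp add: euclidean_representation)
qed

text \<open>The derivative of a composition is a sum, over a basis of the middle space, of products of
  composed functions. This is what makes the induction on the order close.\<close>

lemma k_smooth_on_compose:
  fixes f :: "'a::real_normed_vector \<Rightarrow> 'b::euclidean_space"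
  assumes "open S" "f ` S \<subseteq> T"
  shows "k_smooth_on k T g \<Longrightarrow> k_smooth_on k S f \<Longrightarrow> k_smooth_on k S (\<lambda>x. g (f x))"
proof (induction k arbitrary: g)
  case 0
  then show ?case using assms by (auto intro: continuous_on_compose2)
next
  case (Suc k)
  have H: "((\<lambda>x. g (f x)) has_derivative (\<lambda>v. dir_deriv g (f x) (dir_deriv f x v))) (at x)"
    if "x \<in> S" for x
    using Suc.prems that assms(2)
    by (intro has_derivative_compose[of f _ x UNIV g] has_dir_deriv) auto
  have exp: "dir_deriv g (f x) (dir_deriv f x v) =
      (\<Sum>i\<in>Basis. (dir_deriv f x v \<bullet> i) *\<^sub>R dir_deriv g (f x) i)" if "x \<in> S" for x v
    using Suc.prems that assms(2) by (intro linear_Basis_expansion linear_frechet_derivative) auto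
  have "k_smooth_on k S (\<lambda>x. dir_deriv (\<lambda>x. g (f x)) x v)" for v
  proof (rule k_smooth_on_cong[OF assms(1)])
    show "k_smooth_on k S (\<lambda>x. \<Sum>i\<in>Basis. (dir_deriv f x v \<bullet> i) *\<^sub>R dir_deriv g (f x) i)"
      using Suc.prems k_smooth_on_Suc_imp[OF Suc.prems(2)]
      by (intro k_smooth_on_sum assms(1) k_smooth_on_scaleR k_smooth_on_inner k_smooth_on_const
          Suc.IH[of "\<lambda>z. dir_deriv g z i" for i]) auto
  qed (simp add: dir_deriv_eqI[OF H] exp)
  then show ?case using H by (auto simp: differentiable_def)
qed

lemma k_smooth_on_inverse:
  fixes f :: "'a::real_normed_vector \<Rightarrow> real"
  assumes "open S" "\<And>x. x \<in> S \<Longrightarrow> f x \<noteq> 0"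
  shows "k_smooth_on k S f \<Longrightarrow> k_smooth_on k S (\<lambda>x. inverse (f x))"
proof (induction k)
  case 0
  then show ?case using assms(2) by (auto intro: continuous_on_inverse)
next
  case (Suc k)
  have H: "((\<lambda>x. inverse (f x)) has_derivative
      (\<lambda>v. - 1 * (dir_deriv f x v * (inverse (f x) * inverse (f x))))) (at x)" if "x \<in> S" for x
    by (rule has_derivative_eq_rhs[OF Deriv.has_derivative_inverse[where x=x and f=f,
            OF assms(2)[OF that] has_dir_deriv]])
       (use Suc.prems that in auto)
  have "k_smooth_on k S (\<lambda>x. dir_deriv (\<lambda>x. inverse (f x)) x v)" for v
  proof (rule k_smooth_on_cong[OF assms(1)])
    show "k_smooth_on k S (\<lambda>x. - 1 * (dir_deriv f x v * (inverse (f x) * inverse (f x))))"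
      using Suc.prems Suc.IH k_smooth_on_Suc_imp[OF Suc.prems]
      by (intro k_smooth_on_mult assms(1) k_smooth_on_const) auto
  qed (simp add: dir_deriv_eqI[OF H])
  then show ?case using H by (auto simp: differentiable_def)
qed

lemma k_smooth_on_sqrt:
  fixes f :: "'a::real_normed_vector \<Rightarrow> real"
  assumes "open S" "\<And>x. x \<in> S \<Longrightarrow> f x > 0"
  shows "k_smooth_on k S f \<Longrightarrow> k_smooth_on k S (\<lambda>x. sqrt (f x))"
proof (induction k)
  case 0
  then show ?case by (auto intro: continuous_on_real_sqrt)
next
  case (Suc k)
  have H: "((\<lambda>x. sqrt (f x)) has_derivative
      (\<lambda>v. dir_deriv f x v * (inverse (sqrt (f x)) / 2))) (at x)" if "x \<in> S" for x
    by (rule has_derivative_eq_rhs[OF has_derivative_compose[OF has_dir_deriv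
          has_derivative_real_sqrt[of "\<lambda>x. x", OF _ has_derivative_ident]]])
       (use Suc.prems that assms(2) in auto)
  have "k_smooth_on k S (\<lambda>x. dir_deriv (\<lambda>x. sqrt (f x)) x v)" for v
  proof (rule k_smooth_on_cong[OF assms(1)])
    have "sqrt (f x) \<noteq> 0" if "x \<in> S" for x using assms(2)[OF that] by simp
    then show "k_smooth_on k S (\<lambda>x. dir_deriv f x v * (inverse (sqrt (f x)) * (1 / 2)))"
      using Suc.prems Suc.IH k_smooth_on_Suc_imp[OF Suc.prems]
      by (intro k_smooth_on_mult k_smooth_on_inverse assms(1) k_smooth_on_const) auto
  qed (simp add: dir_deriv_eqI[OF H])
  then show ?case using H by (auto simp: differentiable_def)
qed

lemma k_smooth_on_dir_deriv_field:
  fixes f :: "'a::euclidean_space \<Rightarrow> 'b::real_normed_vector"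
  assumes "open S" "k_smooth_on (Suc k) S f" "k_smooth_on k S X"
  shows "k_smooth_on k S (\<lambda>x. dir_deriv f x (X x))"
proof (rule k_smooth_on_cong[OF assms(1)])
  show "k_smooth_on k S (\<lambda>x. \<Sum>i\<in>Basis. (X x \<bullet> i) *\<^sub>R dir_deriv f x i)"
    using assms by (intro k_smooth_on_sum k_smooth_on_scaleR k_smooth_on_inner k_smooth_on_const) auto
  show "(\<Sum>i\<in>Basis. (X x \<bullet> i) *\<^sub>R dir_deriv f x i) = dir_deriv f x (X x)" if "x \<in> S" for x
    using assms that by (intro linear_Basis_expansion[symmetric] linear_frechet_derivative) auto
qed

lemma smooth_onD: "smooth_on S f \<Longrightarrow> k_smooth_on k S f"
  by (simp add: smooth_on_def)

lemma smooth_on_differentiable: "smooth_on S f \<Longrightarrow> x \<in> S \<Longrightarrow> f differentiable (at x)"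
  using smooth_onD[of S f 1] by simp

lemma smooth_on_has_derivative: "smooth_on S f \<Longrightarrow> x \<in> S \<Longrightarrow> (f has_derivative dir_deriv f x) (at x)"
  by (simp add: has_dir_deriv smooth_on_differentiable)

lemma smooth_on_linear: "smooth_on S f \<Longrightarrow> x \<in> S \<Longrightarrow> linear (dir_deriv f x)"
  by (simp add: linear_frechet_derivative smooth_on_differentiable)

lemma smooth_on_imp_continuous: "smooth_on S f \<Longrightarrow> continuous_on S f"
  using smooth_onD[of S f 0] by simp

lemma smooth_on_dir_deriv: "smooth_on S f \<Longrightarrow> smooth_on S (\<lambda>x. dir_deriv f x v)"
  unfolding smooth_on_def
proof
  fix k assume "\<forall>k. k_smooth_on k S f"
  then have "k_smooth_on (Suc k) S f" by blast
  then show "k_smooth_on k S (\<lambda>x. dir_deriv f x v)" by simp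
qed

lemma smooth_on_subset: "smooth_on S f \<Longrightarrow> T \<subseteq> S \<Longrightarrow> smooth_on T f"
  using k_smooth_on_subset[of _ S f T] by (simp add: smooth_on_def)

lemma smooth_on_cong:
  "open S \<Longrightarrow> (\<And>x. x \<in> S \<Longrightarrow> f x = g x) \<Longrightarrow> smooth_on S f \<Longrightarrow> smooth_on S g"
  using k_smooth_on_cong[of S f g] by (simp add: smooth_on_def)

lemma smooth_on_const: "smooth_on S (\<lambda>x. c)"
  by (simp add: smooth_on_def k_smooth_on_const)

lemma smooth_on_id: "smooth_on S (\<lambda>x. x)"
  by (simp add: smooth_on_def k_smooth_on_id)

lemma smooth_on_add: "open S \<Longrightarrow> smooth_on S f \<Longrightarrow> smooth_on S g \<Longrightarrow> smooth_on S (\<lambda>x. f x + g x)"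
  using k_smooth_on_add[of S _ f g] by (simp add: smooth_on_def)

lemma smooth_on_mult:
  "open S \<Longrightarrow> smooth_on S f \<Longrightarrow> smooth_on S g \<Longrightarrow> smooth_on S (\<lambda>x. f x * (g x :: real))"
  using k_smooth_on_mult[of S _ f g] by (simp add: smooth_on_def)

lemma smooth_on_scaleR:
  "open S \<Longrightarrow> smooth_on S f \<Longrightarrow> smooth_on S g \<Longrightarrow> smooth_on S (\<lambda>x. f x *\<^sub>R g x)"
  using k_smooth_on_scaleR[of S _ f g] by (simp add: smooth_on_def)

lemma smooth_on_inner:
  "open S \<Longrightarrow> smooth_on S f \<Longrightarrow> smooth_on S g \<Longrightarrow> smooth_on S (\<lambda>x. f x \<bullet> g x)"
  using k_smooth_on_inner[of S _ f g] by (simp add: smooth_on_def)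

lemma smooth_on_linear_comp:
  "open S \<Longrightarrow> bounded_linear L \<Longrightarrow> smooth_on S f \<Longrightarrow> smooth_on S (\<lambda>x. L (f x))"
  using k_smooth_on_linear_comp[of S L _ f] by (simp add: smooth_on_def)

lemma smooth_on_diff:
  assumes "open S" "smooth_on S f" "smooth_on S g"
  shows "smooth_on S (\<lambda>x. f x - g x)"
  using smooth_on_add[OF assms(1,2) smooth_on_linear_comp[OF assms(1)
        bounded_linear_minus[OF bounded_linear_ident] assms(3)]] by simp

lemma smooth_on_sum:
  "open S \<Longrightarrow> (\<And>i. i \<in> I \<Longrightarrow> smooth_on S (f i)) \<Longrightarrow> smooth_on S (\<lambda>x. \<Sum>i\<in>I. f i x)"
  using k_smooth_on_sum[of S I _ f] by (simp add: smooth_on_def)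

lemma smooth_on_inverse:
  "open S \<Longrightarrow> (\<And>x. x \<in> S \<Longrightarrow> f x \<noteq> (0::real)) \<Longrightarrow> smooth_on S f \<Longrightarrow> smooth_on S (\<lambda>x. inverse (f x))"
  using k_smooth_on_inverse[of S f] by (simp add: smooth_on_def)

lemma smooth_on_sqrt:
  "open S \<Longrightarrow> (\<And>x. x \<in> S \<Longrightarrow> f x > 0) \<Longrightarrow> smooth_on S f \<Longrightarrow> smooth_on S (\<lambda>x. sqrt (f x))"
  using k_smooth_on_sqrt[of S f] by (simp add: smooth_on_def)

lemma smooth_on_compose:
  fixes f :: "'a::real_normed_vector \<Rightarrow> 'b::euclidean_space"
  shows "open S \<Longrightarrow> f ` S \<subseteq> T \<Longrightarrow> smooth_on T g \<Longrightarrow> smooth_on S f \<Longrightarrow> smooth_on S (\<lambda>x. g (f x))"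
  using k_smooth_on_compose[of S f T _ g] by (simp add: smooth_on_def)

lemma smooth_on_dir_deriv_field:
  fixes f :: "'a::euclidean_space \<Rightarrow> 'b::real_normed_vector"
  shows "open S \<Longrightarrow> smooth_on S f \<Longrightarrow> smooth_on S X \<Longrightarrow> smooth_on S (\<lambda>x. dir_deriv f x (X x))"
  using k_smooth_on_dir_deriv_field[of S _ f X] by (simp add: smooth_on_def del: k_smooth_on.simps)

lemma smooth_on_componentwise:
  fixes f :: "'a::real_normed_vector \<Rightarrow> 'b::euclidean_space"
  shows "open S \<Longrightarrow> (\<And>i. i \<in> Basis \<Longrightarrow> smooth_on S (\<lambda>x. f x \<bullet> i)) \<Longrightarrow> smooth_on S f"
  using k_smooth_on_componentwise[of S _ f] by (simp add: smooth_on_def)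

lemma smooth_on_vec_nth:
  fixes f :: "'a::real_normed_vector \<Rightarrow> 'b::real_normed_vector ^ 'n::finite"
  shows "open S \<Longrightarrow> smooth_on S f \<Longrightarrow> smooth_on S (\<lambda>x. f x $ i)"
  by (rule smooth_on_linear_comp[OF _ bounded_linear_vec_nth])

lemma smooth_on_vecI:
  fixes f :: "'a::real_normed_vector \<Rightarrow> real ^ 'n::finite"
  assumes "open S" "\<And>i. smooth_on S (\<lambda>x. f x $ i)"
  shows "smooth_on S f"
  by (rule smooth_on_componentwise[OF assms(1)])
     (use assms(2) in \<open>auto simp: Basis_vec_def inner_axis\<close>)

lemma smooth_on_matI:
  fixes f :: "'a::real_normed_vector \<Rightarrow> real ^ 'n::finite ^ 'm::finite"
  assumes "open S" "\<And>i j. smooth_on S (\<lambda>x. f x $ i $ j)"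
  shows "smooth_on S f"
  by (rule smooth_on_componentwise[OF assms(1)])
     (use assms(2) in \<open>auto simp: Basis_vec_def inner_axis\<close>)

lemma smooth_on_if_dir_deriv:
  assumes "\<And>x. x \<in> S \<Longrightarrow> f differentiable (at x)" "\<And>v. smooth_on S (\<lambda>x. dir_deriv f x v)"
  shows "smooth_on S f"
  unfolding smooth_on_def
proof
  fix k show "k_smooth_on k S f"
    by (rule k_smooth_on_Suc_imp) (use assms in \<open>simp add: smooth_on_def\<close>)
qed

lemma smooth_on_primitive:
  assumes "open S" "\<And>x. x \<in> S \<Longrightarrow> (f has_derivative f' x) (at x)" "\<And>v. smooth_on S (\<lambda>x. f' x v)"
  shows "smooth_on S f"
proof (rule smooth_on_if_dir_deriv)
  show "f differentiable (at x)" if "x \<in> S" for x using assms(2)[OF that] by (auto simp: differentiable_def)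
  show "smooth_on S (\<lambda>x. dir_deriv f x v)" for v
    by (rule smooth_on_cong[OF assms(1) _ assms(3)[of v]]) (simp add: dir_deriv_eqI[OF assms(2)])
qed

lemma dir_deriv_compose:
  assumes "f differentiable (at x)" "g differentiable (at (f x))"
  shows "dir_deriv (\<lambda>x. g (f x)) x v = dir_deriv g (f x) (dir_deriv f x v)"
  using dir_deriv_eqI[OF has_derivative_compose[OF has_dir_deriv[OF assms(1)] has_dir_deriv[OF assms(2)]]]
  by simp

text \<open>The second difference of \<open>f\<close> over the parallelogram with
  sides \<open>h u\<close>, \<open>h v\<close> is, by two applications of the mean value theorem in either order, \<open>h\<^sup>2\<close> times
  a value of either mixed derivative at a point of the parallelogram. As \<open>h\<close> tends to \<open>0\<close> the mixed derivatives agree.\<close>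

lemma second_difference:
  fixes f :: "'a::real_normed_vector \<Rightarrow> real"
  assumes S: "\<And>a b. 0 \<le> a \<Longrightarrow> a \<le> h \<Longrightarrow> 0 \<le> b \<Longrightarrow> b \<le> h \<Longrightarrow> x + a *\<^sub>R u + b *\<^sub>R v \<in> S"
    and f: "k_smooth_on 2 S f" and h: "h > 0"
  shows "\<exists>a b. 0 < a \<and> a < h \<and> 0 < b \<and> b < h \<and>
    f (x + h *\<^sub>R u + h *\<^sub>R v) - f (x + h *\<^sub>R u) - f (x + h *\<^sub>R v) + f x
      = h * (h * dir_deriv (\<lambda>y. dir_deriv f y u) (x + a *\<^sub>R u + b *\<^sub>R v) v)"
proof -
  have fd: "(f has_derivative dir_deriv f y) (at y)" if "y \<in> S" for y
    using f that by (intro has_dir_deriv) (auto simp: numeral_2_eq_2)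
  have ffd: "((\<lambda>y. dir_deriv f y u) has_derivative dir_deriv (\<lambda>y. dir_deriv f y u) y) (at y)"
    if "y \<in> S" for y
    using f that by (intro has_dir_deriv) (auto simp: numeral_2_eq_2)
  have lin: "linear (dir_deriv f y)" "linear (dir_deriv (\<lambda>y. dir_deriv f y u) y)" if "y \<in> S" for y
    using fd[OF that] ffd[OF that] by (auto intro: has_derivative_linear)
  let ?G = "\<lambda>a. f (x + a *\<^sub>R u + h *\<^sub>R v) - f (x + a *\<^sub>R u + 0 *\<^sub>R v)"
  have "\<exists>a>0. a < h \<and> ?G h - ?G 0 = (h - 0) *
     (dir_deriv f (x + a *\<^sub>R u + h *\<^sub>R v) u - dir_deriv f (x + a *\<^sub>R u + 0 *\<^sub>R v) u)"
  proof (rule MVT2[OF h])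
    fix a assume a: "0 \<le> a" "a \<le> h"
    have *: "((\<lambda>a. f (x + a *\<^sub>R u + b *\<^sub>R v)) has_derivative (\<lambda>t. dir_deriv f (x + a *\<^sub>R u + b *\<^sub>R v) (t *\<^sub>R u))) (at a)"
      if "0 \<le> b" "b \<le> h" for b
      by (rule has_derivative_compose[where f="\<lambda>a. x + a *\<^sub>R u + b *\<^sub>R v" and g=f,
            OF _ fd[OF S[OF a that]]]) (auto intro!: derivative_eq_intros)
    show "(?G has_real_derivative
      dir_deriv f (x + a *\<^sub>R u + h *\<^sub>R v) u - dir_deriv f (x + a *\<^sub>R u + 0 *\<^sub>R v) u) (at a)"
      unfolding has_field_derivative_def
    proof (rule has_derivative_eq_rhs[OF has_derivative_diff[OF *[of h] *[of 0]]])
      have "x + a *\<^sub>R u + h *\<^sub>R v \<in> S" "x + a *\<^sub>R u + 0 *\<^sub>R v \<in> S"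
        using S[OF a] h by (metis order_refl less_imp_le)+
      note L = linear_cmul[OF lin(1)[OF this(1)]] linear_cmul[OF lin(1)[OF this(2)]]
      show "(\<lambda>t. dir_deriv f (x + a *\<^sub>R u + h *\<^sub>R v) (t *\<^sub>R u) - dir_deriv f (x + a *\<^sub>R u + 0 *\<^sub>R v) (t *\<^sub>R u)) =
        (*) (dir_deriv f (x + a *\<^sub>R u + h *\<^sub>R v) u - dir_deriv f (x + a *\<^sub>R u + 0 *\<^sub>R v) u)"
        unfolding L fun_eq_iff real_scaleR_def
        by (intro allI) (simp only: left_diff_distrib right_diff_distrib mult.commute)
    qed (use h in auto)
  qed
  then obtain a where a: "0 < a" "a < h" "?G h - ?G 0 = h *
     (dir_deriv f (x + a *\<^sub>R u + h *\<^sub>R v) u - dir_deriv f (x + a *\<^sub>R u + 0 *\<^sub>R v) u)" by auto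
  let ?H = "\<lambda>b. dir_deriv f (x + a *\<^sub>R u + b *\<^sub>R v) u"
  have "\<exists>b>0. b < h \<and> ?H h - ?H 0 = (h - 0) *
     dir_deriv (\<lambda>y. dir_deriv f y u) (x + a *\<^sub>R u + b *\<^sub>R v) v"
  proof (rule MVT2[OF h])
    fix b assume b: "0 \<le> b" "b \<le> h"
    have "((\<lambda>b. dir_deriv f (x + a *\<^sub>R u + b *\<^sub>R v) u) has_derivative
       (\<lambda>t. dir_deriv (\<lambda>y. dir_deriv f y u) (x + a *\<^sub>R u + b *\<^sub>R v) (t *\<^sub>R v))) (at b)"
      by (rule has_derivative_compose[where f="\<lambda>b. x + a *\<^sub>R u + b *\<^sub>R v" and
            g="\<lambda>y. dir_deriv f y u", OF _ ffd[OF S]])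
         (use a b in \<open>auto intro!: derivative_eq_intros\<close>)
    then show "(?H has_real_derivative
       dir_deriv (\<lambda>y. dir_deriv f y u) (x + a *\<^sub>R u + b *\<^sub>R v) v) (at b)"
      unfolding has_field_derivative_def
    proof (rule has_derivative_eq_rhs)
      have "x + a *\<^sub>R u + b *\<^sub>R v \<in> S" using S[of a b] a b by simp
      note L = linear_cmul[OF lin(2)[OF this]]
      show "(\<lambda>t. dir_deriv (\<lambda>y. dir_deriv f y u) (x + a *\<^sub>R u + b *\<^sub>R v) (t *\<^sub>R v)) =
        (*) (dir_deriv (\<lambda>y. dir_deriv f y u) (x + a *\<^sub>R u + b *\<^sub>R v) v)"
        unfolding L fun_eq_iff real_scaleR_def by (intro allI) (rule mult.commute)
    qed
  qed
  then obtain b where "0 < b" "b < h" "?H h - ?H 0 = h *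
     dir_deriv (\<lambda>y. dir_deriv f y u) (x + a *\<^sub>R u + b *\<^sub>R v) v" by auto
  then show ?thesis using a
    by (intro exI[of _ a] exI[of _ b]) (simp add: algebra_simps)
qed

lemma mixed_derivatives_commute_real:
  fixes f :: "'a::real_normed_vector \<Rightarrow> real"
  assumes "open S" "x \<in> S" "k_smooth_on 2 S f"
  shows "dir_deriv (\<lambda>y. dir_deriv f y u) x v = dir_deriv (\<lambda>y. dir_deriv f y v) x u"
proof (rule ccontr)
  let ?P = "\<lambda>y. dir_deriv (\<lambda>y. dir_deriv f y u) y v" and ?Q = "\<lambda>y. dir_deriv (\<lambda>y. dir_deriv f y v) y u"
  define e where "e = \<bar>?P x - ?Q x\<bar> / 2"
  assume "?P x \<noteq> ?Q x"
  then have e: "e > 0" by (simp add: e_def)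
  have cont: "isCont ?P x" "isCont ?Q x"
    using assms by (auto simp: numeral_2_eq_2 continuous_on_eq_continuous_at)
  obtain d1 where d1: "d1 > 0" "\<And>y. dist y x < d1 \<Longrightarrow> dist (?P y) (?P x) < e"
    using cont(1) e unfolding continuous_at_eps_delta by blast
  obtain d2 where d2: "d2 > 0" "\<And>y. dist y x < d2 \<Longrightarrow> dist (?Q y) (?Q x) < e"
    using cont(2) e unfolding continuous_at_eps_delta by blast
  obtain d3 where d3: "d3 > 0" "ball x d3 \<subseteq> S"
    using assms openE by blast
  define d where "d = min d1 (min d2 d3)"
  define N where "N = norm u + norm v + 1"
  define h where "h = d / (2 * N)"
  have pos: "N > 0" unfolding N_def by (smt (verit) norm_ge_zero)
  have d: "d > 0" using d1 d2 d3 by (simp add: d_def)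
  then have h: "h > 0" using pos by (simp add: h_def)
  have near: "dist (x + a *\<^sub>R u + b *\<^sub>R v) x < d" if "0 \<le> a" "a \<le> h" "0 \<le> b" "b \<le> h" for a b
  proof -
    have "norm (a *\<^sub>R u + b *\<^sub>R v) \<le> a * norm u + b * norm v"
      using norm_triangle_ineq[of "a *\<^sub>R u" "b *\<^sub>R v"] that by simp
    also have "\<dots> \<le> h * norm u + h * norm v"
      using that by (intro add_mono mult_right_mono) auto
    also have "\<dots> \<le> h * N" using h by (simp add: algebra_simps N_def)
    also have "\<dots> = d / 2" using pos by (simp add: h_def)
    finally show ?thesis using d by (simp add: dist_norm add.assoc)
  qed
  have inS: "x + a *\<^sub>R u + b *\<^sub>R v \<in> S" if "0 \<le> a" "a \<le> h" "0 \<le> b" "b \<le> h" for a b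
    using near[OF that] d3 by (auto simp: d_def dist_commute)
  have inS': "x + b *\<^sub>R v + a *\<^sub>R u \<in> S" if "0 \<le> b" "b \<le> h" "0 \<le> a" "a \<le> h" for a b
    using inS[of a b] that by (simp add: add.commute add.left_commute)
  obtain a b where ab: "0 < a" "a < h" "0 < b" "b < h"
    "f (x + h *\<^sub>R u + h *\<^sub>R v) - f (x + h *\<^sub>R u) - f (x + h *\<^sub>R v) + f x
      = h * (h * ?P (x + a *\<^sub>R u + b *\<^sub>R v))"
    using second_difference[OF _ assms(3) h, of x u v] inS by blast
  obtain b' a' where ab': "0 < b'" "b' < h" "0 < a'" "a' < h"
    "f (x + h *\<^sub>R v + h *\<^sub>R u) - f (x + h *\<^sub>R v) - f (x + h *\<^sub>R u) + f x
      = h * (h * ?Q (x + b' *\<^sub>R v + a' *\<^sub>R u))"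
    using second_difference[OF _ assms(3) h, of x v u] inS' by blast
  have "?P (x + a *\<^sub>R u + b *\<^sub>R v) = ?Q (x + a' *\<^sub>R u + b' *\<^sub>R v)"
    using ab(5) ab'(5) h by (simp add: algebra_simps)
  moreover have "dist (?P (x + a *\<^sub>R u + b *\<^sub>R v)) (?P x) < e" "dist (?Q (x + a' *\<^sub>R u + b' *\<^sub>R v)) (?Q x) < e"
    using near[of a b] near[of a' b'] ab ab' by (auto intro!: d1(2) d2(2) simp: d_def)
  ultimately show False unfolding e_def dist_real_def by argo
qed

lemma mixed_derivatives_commute:
  fixes f :: "'a::real_normed_vector \<Rightarrow> 'b::euclidean_space"
  assumes "open S" "x \<in> S" "smooth_on S f"
  shows "dir_deriv (\<lambda>y. dir_deriv f y u) x v = dir_deriv (\<lambda>y. dir_deriv f y v) x u"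
proof (rule euclidean_eqI)
  fix i :: 'b assume "i \<in> Basis"
  have c1: "dir_deriv (\<lambda>y. h y \<bullet> i) y w = dir_deriv h y w \<bullet> i"
    if "smooth_on S h" "y \<in> S" for h :: "'a \<Rightarrow> 'b" and y w
    using dir_deriv_eqI[OF has_derivative_inner_left[OF smooth_on_has_derivative[OF that]]] by simp
  have c2: "dir_deriv (\<lambda>y. dir_deriv f y a) x b \<bullet> i = dir_deriv (\<lambda>y. dir_deriv (\<lambda>y. f y \<bullet> i) y a) x b" for a b
    using c1[OF smooth_on_dir_deriv[OF assms(3)] assms(2), of a b]
      dir_deriv_cong[OF assms(1,2), of "\<lambda>y. dir_deriv f y a \<bullet> i" "\<lambda>y. dir_deriv (\<lambda>y. f y \<bullet> i) y a"]
    by (simp add: c1[OF assms(3)])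
  show "dir_deriv (\<lambda>y. dir_deriv f y u) x v \<bullet> i = dir_deriv (\<lambda>y. dir_deriv f y v) x u \<bullet> i"
    unfolding c2
    by (intro mixed_derivatives_commute_real[OF assms(1,2)] smooth_onD smooth_on_inner assms smooth_on_const)
qed

lemma dir_deriv_along_field:
  fixes f :: "'a::euclidean_space \<Rightarrow> 'b::real_normed_vector"
  assumes "open S" "x \<in> S" "smooth_on S f" "X differentiable (at x)"
  shows "dir_deriv (\<lambda>y. dir_deriv f y (X y)) x u =
    dir_deriv (\<lambda>y. dir_deriv f y (X x)) x u + dir_deriv f x (dir_deriv X x u)"
proof -
  have rep: "dir_deriv f y w = (\<Sum>i\<in>Basis. (w \<bullet> i) *\<^sub>R dir_deriv f y i)" if "y \<in> S" for y w
    by (rule linear_Basis_expansion[OF smooth_on_linear[OF assms(3) that]])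
  have D: "((\<lambda>y. \<Sum>i\<in>Basis. (Y y \<bullet> i) *\<^sub>R dir_deriv f y i) has_derivative
    (\<lambda>u. \<Sum>i\<in>Basis. (Y x \<bullet> i) *\<^sub>R dir_deriv (\<lambda>y. dir_deriv f y i) x u + (Y' u \<bullet> i) *\<^sub>R dir_deriv f x i)) (at x)"
    if "(Y has_derivative Y') (at x)" for Y Y'
    by (intro has_derivative_sum has_derivative_scaleR has_derivative_inner_left that
        smooth_on_has_derivative[OF smooth_on_dir_deriv[OF assms(3)] assms(2)])
  have 1: "dir_deriv (\<lambda>y. dir_deriv f y (X y)) x u =
     (\<Sum>i\<in>Basis. (X x \<bullet> i) *\<^sub>R dir_deriv (\<lambda>y. dir_deriv f y i) x u + (dir_deriv X x u \<bullet> i) *\<^sub>R dir_deriv f x i)"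
    using dir_deriv_cong[OF assms(1,2), of "\<lambda>y. dir_deriv f y (X y)" "\<lambda>y. \<Sum>i\<in>Basis. (X y \<bullet> i) *\<^sub>R dir_deriv f y i"] rep
      dir_deriv_eqI[OF D[OF has_dir_deriv[OF assms(4)]]] by auto
  have 2: "dir_deriv (\<lambda>y. dir_deriv f y (X x)) x u =
     (\<Sum>i\<in>Basis. (X x \<bullet> i) *\<^sub>R dir_deriv (\<lambda>y. dir_deriv f y i) x u)"
    using dir_deriv_cong[OF assms(1,2), of "\<lambda>y. dir_deriv f y (X x)" "\<lambda>y. \<Sum>i\<in>Basis. (X x \<bullet> i) *\<^sub>R dir_deriv f y i"] rep
      dir_deriv_eqI[OF D[OF has_derivative_const[of "X x"]]] by auto
  show ?thesis unfolding 1 2 rep[OF assms(2), of "dir_deriv X x u"] by (simp add: sum.distrib)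
qed

section \<open>Linear algebra of a positive definite form\<close>

lemma inner_at_add_left: "inner_at G (u + v) w = inner_at G u w + inner_at G v w"
  and inner_at_add_right: "inner_at G w (u + v) = inner_at G w u + inner_at G w v"
  and inner_at_diff_left: "inner_at G (u - v) w = inner_at G u w - inner_at G v w"
  and inner_at_diff_right: "inner_at G w (u - v) = inner_at G w u - inner_at G w v"
  and inner_at_scaleR_left: "inner_at G (r *\<^sub>R u) w = r * inner_at G u w"
  and inner_at_scaleR_right: "inner_at G w (r *\<^sub>R u) = r * inner_at G w u"
  and inner_at_zero_left: "inner_at G 0 w = 0"
  and inner_at_zero_right: "inner_at G w 0 = 0"
  by (simp_all add: inner_at_def inner_add_left inner_add_right inner_diff_left inner_diff_right
      matrix_vector_right_distrib matrix_vector_mult_diff_distrib matrix_vector_mult_scaleR)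

lemmas inner_at_simps = inner_at_add_left inner_at_add_right inner_at_diff_left inner_at_diff_right
  inner_at_scaleR_left inner_at_scaleR_right inner_at_zero_left inner_at_zero_right

lemma inner_at_sum_left: "inner_at G (\<Sum>i\<in>I. f i) w = (\<Sum>i\<in>I. inner_at G (f i) w)"
  by (simp add: inner_at_def inner_sum_left)

lemma inner_at_commute: "transpose G = G \<Longrightarrow> inner_at G u v = inner_at G v u"
  unfolding inner_at_def
  by (metis dot_lmul_matrix inner_commute transpose_matrix_vector)

lemma inner_at_axis: "inner_at G (axis i 1) (axis j 1) = G $ i $ j"
  by (simp add: inner_at_def inner_axis' matrix_vector_mul_component inner_axis)

definition positive_definite :: "real^'n^'n \<Rightarrow> bool" where
  "positive_definite G \<longleftrightarrow> transpose G = G \<and> (\<forall>v. v \<noteq> 0 \<longrightarrow> inner_at G v v > 0)"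

lemma positive_definite_sym: "positive_definite G \<Longrightarrow> inner_at G u v = inner_at G v u"
  by (simp add: positive_definite_def inner_at_commute)

lemma positive_definite_nonneg: "positive_definite G \<Longrightarrow> inner_at G v v \<ge> 0"
  by (cases "v = 0") (auto simp: positive_definite_def inner_at_simps less_imp_le)

lemma positive_definite_eq_0: "positive_definite G \<Longrightarrow> inner_at G v v = 0 \<longleftrightarrow> v = 0"
  by (cases "v = 0") (auto simp: positive_definite_def inner_at_simps dest!: spec[of _ v])

lemma positive_definite_nondegenerate:
  assumes "positive_definite G" "\<And>w. inner_at G u w = inner_at G v w"
  shows "u = v"
proof -
  have "inner_at G (u - v) (u - v) = 0"
    by (simp add: inner_at_diff_left assms(2))
  then show ?thesis using positive_definite_eq_0[OF assms(1)] by force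
qed

lemma positive_definite_invertible:
  fixes G :: "real^'n^'n"
  assumes "positive_definite G"
  shows "invertible G"
proof -
  have "v = 0" if "G *v v = 0" for v
    using positive_definite_eq_0[OF assms, of v] that by (simp add: inner_at_def)
  then show ?thesis
    by (metis invertible_left_inverse matrix_left_invertible_ker)
qed

lemma matrix_inv_left_right:
  fixes A :: "real^'n^'n"
  assumes "invertible A"
  shows "matrix_inv A ** A = mat 1" "A ** matrix_inv A = mat 1"
  using someI_ex[OF assms[unfolded invertible_def]] by (simp_all add: matrix_inv_def)

lemma matrix_inv_mul_vec:
  fixes A :: "real^'n^'n"
  assumes "invertible A"
  shows "A *v (matrix_inv A *v v) = v" "matrix_inv A *v (A *v v) = v"
  using matrix_inv_left_right[OF assms]
  by (simp_all add: matrix_vector_mul_assoc)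

lemma matrix_inv_unique_vec:
  fixes A :: "real^'n^'n"
  assumes "invertible A" "A *v u = v"
  shows "matrix_inv A *v v = u"
  using matrix_inv_mul_vec(2)[OF assms(1), of u] assms(2) by simp

lemma transpose_matrix_inv_sym:
  fixes G :: "real^'n^'n"
  assumes "invertible G" "transpose G = G"
  shows "transpose (matrix_inv G) = matrix_inv G"
proof -
  have "transpose (matrix_inv G) ** G = mat 1"
    by (metis assms matrix_inv_left_right(2) matrix_transpose_mul transpose_mat)
  then show ?thesis
    by (metis assms(1) matrix_inv_left_right(2) matrix_mul_assoc matrix_mul_lid matrix_mul_rid)
qed

text \<open>One step of the Gram-Schmidt process.\<close>

lemma orthonormal_set_extend:
  fixes G :: "real^'n^'n"
  assumes G: "positive_definite G" and B: "finite B" "card B < CARD('n)"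
    "\<And>b c. b \<in> B \<Longrightarrow> c \<in> B \<Longrightarrow> inner_at G b c = (if b = c then 1 else 0)"
  shows "\<exists>w. w \<notin> B \<and> inner_at G w w = 1 \<and> (\<forall>b\<in>B. inner_at G w b = 0)"
proof -
  have "dim B < DIM(real^'n)"
    using dim_le_card'[OF B(1)] B(2) by simp
  then have "span B \<noteq> UNIV"
    by (metis dim_UNIV dim_span less_irrefl)
  then obtain w where w: "w \<notin> span B" by auto
  define u where "u = w - (\<Sum>b\<in>B. inner_at G w b *\<^sub>R b)"
  have "(\<Sum>b\<in>B. inner_at G w b *\<^sub>R b) \<in> span B"
    by (intro span_sum span_scale span_base)
  with w have u0: "u \<noteq> 0" unfolding u_def by auto
  have ub: "inner_at G u b = 0" if "b \<in> B" for b
  proof -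
    have "(\<Sum>c\<in>B. inner_at G w c * inner_at G c b) = (\<Sum>c\<in>B. if c = b then inner_at G w c else 0)"
      by (intro sum.cong) (auto simp: B(3) that)
    then show ?thesis
      using that B(1) by (simp add: u_def inner_at_simps inner_at_sum_left)
  qed
  define n where "n = sqrt (inner_at G u u)"
  have n: "n > 0" "n * n = inner_at G u u"
    using u0 G by (auto simp: n_def positive_definite_def)
  define v where "v = inverse n *\<^sub>R u"
  have v1: "inner_at G v v = 1"
    using n(1) by (simp add: v_def inner_at_simps n(2)[symmetric] field_simps)
  have vb: "inner_at G v b = 0" if "b \<in> B" for b
    using ub[OF that] by (simp add: v_def inner_at_simps)
  then have "v \<notin> B" using v1 by force
  then show ?thesis using v1 vb by blast
qed

lemma orthonormal_frame:
  fixes G :: "real^'n^'n"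
  assumes G: "positive_definite G"
  obtains E :: "real^'n^'n" where "transpose E ** G ** E = mat 1"
proof -
  have "k \<le> CARD('n) \<Longrightarrow> \<exists>B. finite B \<and> card B = k \<and>
    (\<forall>b\<in>B. \<forall>c\<in>B. inner_at G b c = (if b = c then 1 else 0))" for k
  proof (induction k)
    case 0
    then show ?case by (intro exI[of _ "{}"]) auto
  next
    case (Suc k)
    then obtain B where B: "finite B" "card B = k"
      "\<And>b c. b \<in> B \<Longrightarrow> c \<in> B \<Longrightarrow> inner_at G b c = (if b = c then 1 else 0)" by auto
    obtain w where "w \<notin> B" "inner_at G w w = 1" "\<forall>b\<in>B. inner_at G w b = 0"
      using orthonormal_set_extend[OF G B(1) _ B(3)] B(2) Suc.prems by auto
    then show ?case
      using B positive_definite_sym[OF G]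
      by (intro exI[of _ "insert w B"]) auto
  qed
  then obtain B where B: "finite B" "card B = CARD('n)"
    "\<forall>b\<in>B. \<forall>c\<in>B. inner_at G b c = (if b = c then 1 else 0)" by blast
  then obtain e where e: "bij_betw e (UNIV :: 'n set) B"
    using finite_same_card_bij[of "UNIV :: 'n set" B] by auto
  define E where "E = (\<chi> i j. e j $ i)"
  have "inner_at G (e i) (e j) = (if i = j then 1 else 0)" for i j
    using B(3) e by (auto simp: bij_betw_def inj_on_def)
  moreover have "(transpose E ** G ** E) $ i $ j = inner_at G (e i) (e j)" for i j
  proof -
    have "(transpose E ** (G ** E)) $ i $ j = (\<Sum>k\<in>UNIV. e i $ k * (\<Sum>l\<in>UNIV. G $ k $ l * e j $ l))"
      by (simp add: matrix_matrix_mult_def transpose_def E_def)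
    also have "\<dots> = inner_at G (e i) (e j)"
      by (simp add: inner_at_def inner_vec_def matrix_vector_mult_def)
    finally show ?thesis by (simp add: matrix_mul_assoc)
  qed
  ultimately have "transpose E ** G ** E = mat 1"
    by (simp add: vec_eq_iff mat_def)
  then show ?thesis by (rule that)
qed

lemma positive_definite_det:
  fixes G :: "real^'n^'n"
  assumes "positive_definite G"
  shows "det G > 0"
proof -
  obtain E :: "real^'n^'n" where "transpose E ** G ** E = mat 1"
    by (rule orthonormal_frame[OF assms])
  then have "det E * det G * det E = 1"
    by (metis det_I det_mul det_transpose)
  then have "(det E)\<^sup>2 * det G = 1" by (simp add: power2_eq_square mult_ac)
  then show ?thesis
    by (metis zero_less_mult_pos zero_less_one zero_less_power2 mult_zero_left zero_neq_one power_zero_numeral)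
qed

text \<open>If \<open>S\<close> is skew, then \<open>- tr S\<^sup>2\<close> is the sum of the squared lengths of the images of an
  orthonormal basis.\<close>

lemma skew_eq_0_if_trace_square_0:
  fixes G :: "real^'n^'n"
  assumes G: "positive_definite G" and S: "linear S"
    and skew: "\<And>u v. inner_at G (S u) v = - inner_at G u (S v)"
    and tr: "trace (matrix (\<lambda>u. S (S u))) = 0"
  shows "S u = 0"
proof -
  obtain E :: "real^'n^'n" where E: "transpose E ** G ** E = mat 1"
    by (rule orthonormal_frame[OF G])
  then have E': "E ** (transpose E ** G) = mat 1"
    by (metis matrix_left_right_inverse)
  let ?M = "matrix S"
  have SM: "S u = ?M *v u" for u using S by simp
  have M2: "matrix (\<lambda>u. S (S u)) = ?M ** ?M"
    using matrix_compose[OF S S] by (simp add: o_def)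
  have "trace (transpose E ** G ** (?M ** ?M ** E)) = trace ((?M ** ?M ** E) ** (transpose E ** G))"
    by (rule trace_mul_sym)
  also have "\<dots> = trace (?M ** ?M)"
    by (metis E' matrix_mul_assoc matrix_mul_rid)
  finally have tr0: "trace (transpose E ** G ** (?M ** ?M ** E)) = 0" using tr M2 by simp
  let ?e = "\<lambda>i. E *v axis i 1"
  have "(transpose E ** G ** (?M ** ?M ** E)) $ i $ i = - inner_at G (S (?e i)) (S (?e i))" for i
  proof -
    have "(transpose E ** G ** (?M ** ?M ** E)) $ i $ i
      = axis i 1 \<bullet> ((transpose E ** G ** (?M ** ?M ** E)) *v axis i 1)"
      by (metis inner_at_axis inner_at_def)
    also have "\<dots> = axis i 1 \<bullet> (transpose E *v (G *v S (S (?e i))))"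
      by (simp add: SM matrix_vector_mul_assoc matrix_mul_assoc)
    also have "\<dots> = inner_at G (?e i) (S (S (?e i)))"
      by (metis inner_at_def dot_lmul_matrix vector_transpose_matrix inner_commute transpose_matrix_vector transpose_transpose)
    also have "\<dots> = - inner_at G (S (?e i)) (S (?e i))" using skew[of "?e i" "S (?e i)"] by simp
    finally show ?thesis .
  qed
  then have "(\<Sum>i\<in>UNIV. inner_at G (S (?e i)) (S (?e i))) = 0"
    using tr0 by (simp add: trace_def sum_negf)
  then have "inner_at G (S (?e i)) (S (?e i)) = 0" for i
    by (subst (asm) sum_nonneg_eq_0_iff) (auto simp: positive_definite_nonneg[OF G])
  then have S0: "S (?e i) = 0" for i by (simp add: positive_definite_eq_0[OF G])
  have "u = E *v ((transpose E ** G) *v u)"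
    by (simp add: matrix_vector_mul_assoc E')
  also have "S \<dots> = (?M ** E) *v ((transpose E ** G) *v u)"
    by (simp add: SM matrix_vector_mul_assoc matrix_mul_assoc)
  also have "?M ** E = 0"
  proof -
    have "(?M ** E) *v axis i 1 = 0" for i
      using S0[of i] by (simp add: SM matrix_vector_mul_assoc)
    then show ?thesis
      by (simp add: matrix_vector_mult_basis column_def vec_eq_iff)
  qed
  finally show ?thesis by simp
qed

lemma trace_matrix: "trace (matrix f) = (\<Sum>i\<in>UNIV. f (axis i 1) $ i)"
  by (simp add: trace_def matrix_def)

lemma trace_comp_commute:
  fixes f g :: "real^'n \<Rightarrow> real^'n"
  assumes "linear f" "linear g"
  shows "trace (matrix (\<lambda>u. f (g u))) = trace (matrix (\<lambda>u. g (f u)))"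
  using matrix_compose[OF assms(1,2)] matrix_compose[OF assms(2,1)] trace_mul_sym
  by (simp add: o_def)

section \<open>Smoothness of matrix inversion\<close>

lemma smooth_on_prod:
  fixes f :: "'i \<Rightarrow> 'a::real_normed_vector \<Rightarrow> real"
  assumes "open S" "\<And>i. i \<in> I \<Longrightarrow> smooth_on S (f i)"
  shows "smooth_on S (\<lambda>x. \<Prod>i\<in>I. f i x)"
  using assms(2)
proof (induction I rule: infinite_finite_induct)
  case (insert i I)
  then show ?case by (simp add: smooth_on_mult[OF assms(1)])
qed (simp_all add: smooth_on_const)

lemma smooth_on_mat_nth:
  fixes f :: "'a::real_normed_vector \<Rightarrow> real^'n^'m"
  shows "open S \<Longrightarrow> smooth_on S f \<Longrightarrow> smooth_on S (\<lambda>x. f x $ i $ j)"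
  by (rule smooth_on_vec_nth[OF _ smooth_on_vec_nth])

lemma smooth_on_det:
  fixes f :: "'a::real_normed_vector \<Rightarrow> real^'n^'n"
  assumes "open S" "\<And>i j. smooth_on S (\<lambda>x. f x $ i $ j)"
  shows "smooth_on S (\<lambda>x. det (f x))"
  unfolding det_def
  by (rule smooth_on_sum[OF assms(1)], rule smooth_on_mult[OF assms(1) smooth_on_const],
      rule smooth_on_prod[OF assms(1)], rule assms(2))

lemma matrix_inv_cramer:
  fixes A :: "real^'n^'n"
  assumes "det A \<noteq> 0"
  shows "matrix_inv A $ k $ l = det (\<chi> i j. if j = k then axis l 1 $ i else A $ i $ j) / det A"
proof -
  have inv: "invertible A" using assms by (simp add: invertible_det_nz)
  have "matrix_inv A *v axis l 1 = (\<chi> k. det (\<chi> i j. if j = k then axis l 1 $ i else A $ i $ j) / det A)"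
    using cramer[OF assms, of "matrix_inv A *v axis l 1" "axis l 1"] matrix_inv_mul_vec(1)[OF inv]
    by simp
  moreover have "(matrix_inv A *v axis l 1) $ k = matrix_inv A $ k $ l"
    by (simp add: matrix_vector_mult_basis column_def)
  ultimately show ?thesis by simp
qed

lemma smooth_on_matrix_inv:
  fixes f :: "'a::real_normed_vector \<Rightarrow> real^'n^'n"
  assumes "open S" "smooth_on S f" "\<And>x. x \<in> S \<Longrightarrow> invertible (f x)"
  shows "smooth_on S (\<lambda>x. matrix_inv (f x))"
proof (rule smooth_on_matI[OF assms(1)])
  fix k l
  have nz: "det (f x) \<noteq> 0" if "x \<in> S" for x
    using assms(3)[OF that] by (simp add: invertible_det_nz)
  have ent: "smooth_on S (\<lambda>x. f x $ i $ j)" for i j by (rule smooth_on_mat_nth[OF assms(1,2)])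
  have cof: "smooth_on S (\<lambda>x. det (\<chi> i j. if j = k then axis l 1 $ i else f x $ i $ j))"
  proof (rule smooth_on_det[OF assms(1)])
    fix i j show "smooth_on S (\<lambda>x. (\<chi> i j. if j = k then axis l 1 $ i else f x $ i $ j) $ i $ j)"
      by (cases "j = k") (simp_all add: ent smooth_on_const)
  qed
  show "smooth_on S (\<lambda>x. matrix_inv (f x) $ k $ l)"
  proof (rule smooth_on_cong[OF assms(1)])
    show "smooth_on S (\<lambda>x. det (\<chi> i j. if j = k then axis l 1 $ i else f x $ i $ j) * inverse (det (f x)))"
      by (rule smooth_on_mult[OF assms(1) cof smooth_on_inverse[OF assms(1) nz smooth_on_det[OF assms(1) ent]]])
  qed (simp add: matrix_inv_cramer[OF nz] divide_inverse)
qed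

lemma smooth_on_matrix_vector_mult:
  fixes f :: "'a::real_normed_vector \<Rightarrow> real^'n^'m"
  assumes "open S" "smooth_on S f" "smooth_on S X"
  shows "smooth_on S (\<lambda>x. f x *v X x)"
proof (rule smooth_on_vecI[OF assms(1)])
  fix i
  show "smooth_on S (\<lambda>x. (f x *v X x) $ i)"
    unfolding matrix_vector_mult_def vec_lambda_beta
    by (rule smooth_on_sum[OF assms(1)], rule smooth_on_mult[OF assms(1)])
       (rule smooth_on_mat_nth[OF assms(1,2)], rule smooth_on_vec_nth[OF assms(1,3)])
qed

lemma smooth_on_inner_at:
  fixes G :: "'a::real_normed_vector \<Rightarrow> real^'n^'n"
  assumes "open S" "smooth_on S G" "smooth_on S X" "smooth_on S Y"
  shows "smooth_on S (\<lambda>x. inner_at (G x) (X x) (Y x))"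
  unfolding inner_at_def
  by (rule smooth_on_inner[OF assms(1,3) smooth_on_matrix_vector_mult[OF assms(1,2,4)]])

section \<open>The Levi-Civita connection in a chart\<close>

lemma trace_matrix_diff:
  fixes f g :: "real^'n \<Rightarrow> real^'n"
  shows "trace (matrix (\<lambda>u. f u - g u)) = trace (matrix f) - trace (matrix g)"
  by (simp add: trace_matrix sum_subtractf)

lemma bounded_bilinear_matrix_vector_mult:
  "bounded_bilinear ((*v) :: real^'n^'m \<Rightarrow> real^'n \<Rightarrow> real^'m)"
proof -
  have "bilinear ((*v) :: real^'n^'m \<Rightarrow> real^'n \<Rightarrow> real^'m)"
    unfolding bilinear_def
    by (auto intro!: linearI simp: matrix_vector_mult_add_rdistrib matrix_vector_right_distrib
        matrix_vector_mult_scaleR scaleR_matrix_vector_assoc[symmetric])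
  then show ?thesis by (simp only: bilinear_conv_bounded_bilinear)
qed

lemma has_derivative_inner_at_const:
  fixes G :: "'a::real_normed_vector \<Rightarrow> real^'n^'n"
  assumes "G differentiable (at x)"
  shows "((\<lambda>y. inner_at (G y) u v) has_derivative (\<lambda>w. u \<bullet> (dir_deriv G x w *v v))) (at x)"
  unfolding inner_at_def
  by (rule has_derivative_inner_right,
      rule bounded_linear.has_derivative[OF bounded_bilinear.bounded_linear_left[OF
          bounded_bilinear_matrix_vector_mult] has_dir_deriv[OF assms]])

text \<open>In contrast to \<open>levi_civita\<close>, the direction is a single tangent vector, so that the covariant
  derivative of a field at a point is an endomorphism, which has a trace and a square.\<close>

definition cov_deriv ::
  "(real^'n::finite \<Rightarrow> real^'n^'n) \<Rightarrow> (real^'n \<Rightarrow> real^'n) \<Rightarrow> real^'n \<Rightarrow> real^'n \<Rightarrow> real^'n" where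
  "cov_deriv G X x w = dir_deriv X x w + christoffel G x w (X x)"

lemma levi_civita_cov_deriv: "levi_civita G X Y x = cov_deriv G Y x (X x)"
  by (simp add: levi_civita_def cov_deriv_def)

lemma linear_axis_expansion:
  fixes f :: "real^'n \<Rightarrow> 'a::real_vector"
  assumes "linear f"
  shows "f w = (\<Sum>l\<in>UNIV. w $ l *\<^sub>R f (axis l 1))"
proof -
  have "f (\<Sum>l\<in>UNIV. w $ l *\<^sub>R axis l 1) = (\<Sum>l\<in>UNIV. w $ l *\<^sub>R f (axis l 1))"
    by (simp add: linear_sum[OF assms] linear_cmul[OF assms])
  then show ?thesis
    using basis_expansion[of w] by (simp add: scalar_mult_eq_scaleR)
qed

locale metric_chart =
  fixes D :: "(real^'n::finite) set" and G :: "real^'n \<Rightarrow> real^'n^'n"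
  assumes open_dom: "open D" and smooth_metric: "smooth_on D G"
    and posdef: "x \<in> D \<Longrightarrow> positive_definite (G x)"
begin

lemma inner_sym: "x \<in> D \<Longrightarrow> inner_at (G x) u v = inner_at (G x) v u"
  by (rule positive_definite_sym[OF posdef])

lemma invertible_metric: "x \<in> D \<Longrightarrow> invertible (G x)"
  by (rule positive_definite_invertible[OF posdef])

lemma metric_deriv_eq: "x \<in> D \<Longrightarrow> metric_deriv G x w u v = u \<bullet> (dir_deriv G x w *v v)"
  unfolding metric_deriv_def
  by (subst dir_deriv_eqI[OF has_derivative_inner_at_const[OF smooth_on_differentiable[OF smooth_metric]]]) auto

lemma metric_deriv_commute: "x \<in> D \<Longrightarrow> metric_deriv G x w u v = metric_deriv G x w v u"
  unfolding metric_deriv_def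
  by (subst dir_deriv_cong[OF open_dom, of x "\<lambda>y. inner_at (G y) u v" "\<lambda>y. inner_at (G y) v u"])
     (auto intro: inner_sym)

lemma metric_deriv_linear:
  assumes "x \<in> D"
  shows "linear (\<lambda>w. metric_deriv G x w u v)" "linear (\<lambda>u. metric_deriv G x w u v)"
    "linear (\<lambda>v. metric_deriv G x w u v)"
proof -
  have lin: "linear (dir_deriv G x)" by (rule smooth_on_linear[OF smooth_metric assms])
  show "linear (\<lambda>w. metric_deriv G x w u v)" "linear (\<lambda>u. metric_deriv G x w u v)"
    "linear (\<lambda>v. metric_deriv G x w u v)"
    unfolding metric_deriv_eq[OF assms]
    by (auto intro!: linearI simp: linear_add[OF lin] linear_cmul[OF lin] inner_add_left
        inner_add_right matrix_vector_mult_add_rdistrib matrix_vector_right_distrib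
        matrix_vector_mult_scaleR scaleR_matrix_vector_assoc[symmetric])
qed

text \<open>The Koszul formula for fields with constant components. By nondegeneracy it determines the
  Christoffel symbols, which gives their symmetry and bilinearity.\<close>

lemma inner_christoffel:
  assumes "x \<in> D"
  shows "inner_at (G x) (christoffel G x u v) w =
    (metric_deriv G x u v w + metric_deriv G x v u w - metric_deriv G x w u v) / 2"
proof -
  let ?k = "\<lambda>w. (metric_deriv G x u v w + metric_deriv G x v u w - metric_deriv G x w u v) / 2"
  have "linear ?k"
    by (intro linearI) (simp_all add: linear_add[OF metric_deriv_linear(1)[OF assms]]
        linear_add[OF metric_deriv_linear(3)[OF assms]] linear_cmul[OF metric_deriv_linear(1)[OF assms]]
        linear_cmul[OF metric_deriv_linear(3)[OF assms]] field_simps)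
  then have "?k w = (\<Sum>l\<in>UNIV. w $ l *\<^sub>R ?k (axis l 1))"
    by (rule linear_axis_expansion)
  also have "\<dots> = w \<bullet> (\<chi> l. ?k (axis l 1))"
    by (simp add: inner_vec_def)
  also have "\<dots> = inner_at (G x) w (christoffel G x u v)"
    by (simp add: inner_at_def christoffel_def matrix_inv_mul_vec[OF invertible_metric[OF assms]])
  finally show ?thesis using inner_sym[OF assms] by simp
qed

lemma christoffel_commute:
  assumes "x \<in> D"
  shows "christoffel G x u v = christoffel G x v u"
proof (rule positive_definite_nondegenerate[OF posdef[OF assms]])
  fix w show "inner_at (G x) (christoffel G x u v) w = inner_at (G x) (christoffel G x v u) w"
    using metric_deriv_commute[OF assms, of w u v] by (simp add: inner_christoffel[OF assms])
qed

lemma christoffel_linear: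
  assumes "x \<in> D"
  shows "linear (\<lambda>u. christoffel G x u v)" "linear (christoffel G x u)"
proof -
  show *: "linear (\<lambda>u. christoffel G x u v)" for v
  proof (rule linearI)
    fix a b and r :: real
    show "christoffel G x (a + b) v = christoffel G x a v + christoffel G x b v"
      by (rule positive_definite_nondegenerate[OF posdef[OF assms]])
         (simp add: inner_at_simps inner_christoffel[OF assms] linear_add[OF metric_deriv_linear(1)[OF assms]]
           linear_add[OF metric_deriv_linear(2)[OF assms]] linear_add[OF metric_deriv_linear(3)[OF assms]] field_simps)
    show "christoffel G x (r *\<^sub>R a) v = r *\<^sub>R christoffel G x a v"
      by (rule positive_definite_nondegenerate[OF posdef[OF assms]])
         (simp add: inner_at_simps inner_christoffel[OF assms] linear_cmul[OF metric_deriv_linear(1)[OF assms]]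
           linear_cmul[OF metric_deriv_linear(2)[OF assms]] linear_cmul[OF metric_deriv_linear(3)[OF assms]] field_simps)
  qed
  show "linear (christoffel G x u)"
    using *[of u] christoffel_commute[OF assms, of u] by presburger
qed

lemma inner_has_derivative:
  assumes "x \<in> D" "(X has_derivative X') (at x)" "(Y has_derivative Y') (at x)"
  shows "((\<lambda>y. inner_at (G y) (X y) (Y y)) has_derivative
    (\<lambda>w. metric_deriv G x w (X x) (Y x) + inner_at (G x) (X' w) (Y x) + inner_at (G x) (X x) (Y' w))) (at x)"
proof -
  note G' = smooth_on_has_derivative[OF smooth_metric assms(1)]
  have 1: "((\<lambda>y. G y *v Y y) has_derivative (\<lambda>w. G x *v Y' w + dir_deriv G x w *v Y x)) (at x)"
    by (rule bounded_bilinear.FDERIV[OF bounded_bilinear_matrix_vector_mult G' assms(3)])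
  show ?thesis
    unfolding inner_at_def metric_deriv_eq[OF assms(1)]
    by (rule has_derivative_eq_rhs[OF has_derivative_inner[OF assms(2) 1]])
       (simp add: fun_eq_iff inner_add_right)
qed

lemma dir_deriv_inner:
  assumes "x \<in> D" "X differentiable (at x)" "Y differentiable (at x)"
  shows "dir_deriv (\<lambda>y. inner_at (G y) (X y) (Y y)) x w =
    inner_at (G x) (cov_deriv G X x w) (Y x) + inner_at (G x) (X x) (cov_deriv G Y x w)"
proof -
  have "inner_at (G x) (christoffel G x w (X x)) (Y x) + inner_at (G x) (X x) (christoffel G x w (Y x))
    = metric_deriv G x w (X x) (Y x)"
    unfolding inner_sym[OF assms(1), of "X x"] inner_christoffel[OF assms(1)]
    using metric_deriv_commute[OF assms(1)] by (simp add: field_simps)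
  then show ?thesis
    by (simp add: dir_deriv_eqI[OF inner_has_derivative[OF assms(1) has_dir_deriv[OF assms(2)] has_dir_deriv[OF assms(3)]]]
        cov_deriv_def inner_at_simps)
qed

lemma cov_deriv_linear:
  assumes "x \<in> D" "X differentiable (at x)"
  shows "linear (cov_deriv G X x)"
  unfolding cov_deriv_def
  by (rule linear_compose_add[OF linear_frechet_derivative[OF assms(2)] christoffel_linear(1)[OF assms(1)]])

lemma lie_bracket_cov_deriv:
  assumes "x \<in> D"
  shows "lie_bracket X Y x = cov_deriv G Y x (X x) - cov_deriv G X x (Y x)"
  using christoffel_commute[OF assms] by (simp add: lie_bracket_def cov_deriv_def)

lemma smooth_on_metric_deriv:
  assumes "smooth_on D W" "smooth_on D X" "smooth_on D Y"
  shows "smooth_on D (\<lambda>x. metric_deriv G x (W x) (X x) (Y x))"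
proof (rule smooth_on_cong[OF open_dom])
  show "smooth_on D (\<lambda>x. X x \<bullet> (dir_deriv G x (W x) *v Y x))"
    by (intro smooth_on_inner smooth_on_matrix_vector_mult open_dom assms
        smooth_on_dir_deriv_field smooth_metric)
qed (simp add: metric_deriv_eq)

lemma smooth_on_christoffel:
  assumes X: "smooth_on D X" and Y: "smooth_on D Y"
  shows "smooth_on D (\<lambda>x. christoffel G x (X x) (Y x))"
  unfolding christoffel_def
proof (rule smooth_on_matrix_vector_mult[OF open_dom])
  show "smooth_on D (\<lambda>x. matrix_inv (G x))"
    by (rule smooth_on_matrix_inv[OF open_dom smooth_metric invertible_metric])
  show "smooth_on D (\<lambda>x. \<chi> l. (metric_deriv G x (X x) (Y x) (axis l 1) + metric_deriv G x (Y x) (X x) (axis l 1)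
               - metric_deriv G x (axis l 1) (X x) (Y x)) / 2)"
    unfolding divide_inverse
    by (rule smooth_on_vecI[OF open_dom], unfold vec_lambda_beta,
        intro smooth_on_mult smooth_on_const smooth_on_add smooth_on_diff smooth_on_metric_deriv X Y open_dom)
qed

lemma smooth_on_cov_deriv:
  assumes "smooth_on D X" "smooth_on D W"
  shows "smooth_on D (\<lambda>x. cov_deriv G X x (W x))"
  unfolding cov_deriv_def
  by (intro smooth_on_add open_dom smooth_on_dir_deriv_field smooth_on_christoffel assms)

lemma smooth_on_levi_civita: "smooth_on D X \<Longrightarrow> smooth_on D Y \<Longrightarrow> smooth_on D (levi_civita G X Y)"
  unfolding levi_civita_cov_deriv[abs_def] by (rule smooth_on_cov_deriv)

text \<open>For constant \<open>u\<close> expand \<open>R (u, V) V\<close> and take the trace over \<open>u\<close>. The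
  Christoffel terms form the commutator of \<open>DV\<close> with \<open>\<Gamma> (V, \<cdot>)\<close>, whose trace is zero; the terms that remain are the
  divergence of \<open>D\<^sub>V V\<close>, the derivative of \<open>tr DV\<close> along \<open>V\<close> and \<open>tr (DV)\<^sup>2\<close>.\<close>

lemma ricci_formula:
  assumes x: "x \<in> D" and V: "smooth_on D V"
  shows "ricci G V V x = trace (matrix (cov_deriv G (levi_civita G V V) x))
    - dir_deriv (\<lambda>y. trace (matrix (cov_deriv G V y))) x (V x)
    - trace (matrix (\<lambda>u. cov_deriv G V x (cov_deriv G V x u)))"
proof -
  let ?S = "cov_deriv G V" and ?c = "christoffel G x (V x)"
  have Vd: "V differentiable (at x)" by (rule smooth_on_differentiable[OF V x])
  have linS: "linear (?S x)" by (rule cov_deriv_linear[OF x Vd])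
  have linc: "linear ?c" by (rule christoffel_linear(2)[OF x])
  have smS: "smooth_on D (\<lambda>y. ?S y u)" for u by (rule smooth_on_cov_deriv[OF V smooth_on_const])
  have lc: "levi_civita G (\<lambda>_. u) V = (\<lambda>y. ?S y u)" for u
    by (simp add: levi_civita_cov_deriv fun_eq_iff)
  have DV: "dir_deriv V x u = ?S x u - ?c u" for u
    using christoffel_commute[OF x, of u "V x"] by (simp add: cov_deriv_def)
  have br: "lie_bracket (\<lambda>_. u) V x = dir_deriv V x u" for u
    by (simp add: lie_bracket_def)
  have "curvature G (\<lambda>_. u) V V x = cov_deriv G (levi_civita G V V) x u
      - dir_deriv (\<lambda>y. ?S y u) x (V x) - (?c (?S x u) - ?S x (?c u)) - ?S x (?S x u)" for u
    unfolding curvature_def lc levi_civita_cov_deriv br DV linear_diff[OF linS]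
    by (simp add: cov_deriv_def[of G "\<lambda>y. ?S y u"] levi_civita_cov_deriv[abs_def])
  then have "ricci G V V x = trace (matrix (\<lambda>u. cov_deriv G (levi_civita G V V) x u
      - dir_deriv (\<lambda>y. ?S y u) x (V x) - (?c (?S x u) - ?S x (?c u)) - ?S x (?S x u)))"
    by (simp add: ricci_def trace_matrix)
  also have "\<dots> = trace (matrix (cov_deriv G (levi_civita G V V) x))
      - trace (matrix (\<lambda>u. dir_deriv (\<lambda>y. ?S y u) x (V x)))
      - (trace (matrix (\<lambda>u. ?c (?S x u))) - trace (matrix (\<lambda>u. ?S x (?c u))))
      - trace (matrix (\<lambda>u. ?S x (?S x u)))"
    by (simp only: trace_matrix_diff)
  also have "trace (matrix (\<lambda>u. ?c (?S x u))) = trace (matrix (\<lambda>u. ?S x (?c u)))"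
    by (rule trace_comp_commute[OF linc linS])
  also have "trace (matrix (\<lambda>u. dir_deriv (\<lambda>y. ?S y u) x (V x))) =
      dir_deriv (\<lambda>y. trace (matrix (?S y))) x (V x)"
  proof -
    have "((\<lambda>y. \<Sum>i\<in>UNIV. ?S y (axis i 1) $ i) has_derivative
        (\<lambda>w. \<Sum>i\<in>UNIV. dir_deriv (\<lambda>y. ?S y (axis i 1)) x w $ i)) (at x)"
      by (intro has_derivative_sum bounded_linear.has_derivative[OF bounded_linear_vec_nth]
          smooth_on_has_derivative[OF smS x])
    from dir_deriv_eqI[OF this] show ?thesis by (simp add: trace_matrix)
  qed
  finally show ?thesis by simp
qed

end

section \<open>Unit vector fields\<close>

locale unit_field_chart = metric_chart +
  fixes V :: "real^'n \<Rightarrow> real^'n"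
  assumes smooth_field: "smooth_on D V"
    and unit: "x \<in> D \<Longrightarrow> inner_at (G x) (V x) (V x) = 1"
begin

abbreviation acceleration :: "real^'n \<Rightarrow> real^'n" where
  "acceleration \<equiv> levi_civita G V V"

lemma field_differentiable: "x \<in> D \<Longrightarrow> V differentiable (at x)"
  by (rule smooth_on_differentiable[OF smooth_field])

lemma acceleration_cov_deriv: "acceleration x = cov_deriv G V x (V x)"
  by (rule levi_civita_cov_deriv)

lemma smooth_acceleration: "smooth_on D acceleration"
  by (rule smooth_on_levi_civita[OF smooth_field smooth_field])

lemma linear_cov_deriv_field: "x \<in> D \<Longrightarrow> linear (cov_deriv G V x)"
  by (rule cov_deriv_linear[OF _ field_differentiable])

lemma inner_cov_deriv_field:
  assumes "x \<in> D"
  shows "inner_at (G x) (cov_deriv G V x u) (V x) = 0"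
proof -
  have "dir_deriv (\<lambda>y. inner_at (G y) (V y) (V y)) x u = dir_deriv (\<lambda>y. 1) x u"
    by (subst dir_deriv_cong[OF open_dom assms, of _ "\<lambda>y. 1"]) (auto simp: unit)
  then show ?thesis
    using dir_deriv_inner[OF assms field_differentiable field_differentiable, OF assms assms, of u]
      inner_sym[OF assms, of "V x"] by simp
qed

lemma inner_acceleration: "x \<in> D \<Longrightarrow> inner_at (G x) (acceleration x) (V x) = 0"
  by (simp add: acceleration_cov_deriv inner_cov_deriv_field)

lemma dir_deriv_dual:
  assumes "x \<in> D"
  shows "dir_deriv (\<lambda>y. inner_at (G y) v (V y)) x u =
    inner_at (G x) (christoffel G x u v) (V x) + inner_at (G x) v (cov_deriv G V x u)"
  using dir_deriv_inner[OF assms differentiable_const field_differentiable[OF assms], of v u]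
  by (simp add: cov_deriv_def)

text \<open>Both terms contain the same Christoffel symbol, by its symmetry, and it cancels.\<close>

lemma ext_deriv_dual:
  assumes "x \<in> D"
  shows "dir_deriv (\<lambda>y. inner_at (G y) v (V y)) x u - dir_deriv (\<lambda>y. inner_at (G y) u (V y)) x v =
    inner_at (G x) (cov_deriv G V x u) v - inner_at (G x) (cov_deriv G V x v) u"
  unfolding dir_deriv_dual[OF assms]
  using christoffel_commute[OF assms, of u v] inner_sym[OF assms] by simp

text \<open>Polarization of the hypothesis kills the symmetric part of \<open>DV\<close> on the orthogonal complement of \<open>V\<close>. Since
  \<open>\<langle>D\<^sub>u V, V\<rangle> = 0\<close>, the only other contribution comes from \<open>D\<^sub>V V\<close>.\<close>

lemma cov_deriv_sym_part:
  assumes x: "x \<in> D"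
    and H: "\<And>u. inner_at (G x) u (V x) = 0 \<Longrightarrow> inner_at (G x) (cov_deriv G V x u) u = 0"
  shows "inner_at (G x) (cov_deriv G V x u) v + inner_at (G x) (cov_deriv G V x v) u =
    inner_at (G x) u (V x) * inner_at (G x) (acceleration x) v +
    inner_at (G x) v (V x) * inner_at (G x) (acceleration x) u"
proof -
  let ?g = "inner_at (G x)" and ?S = "cov_deriv G V x"
  note lin = linear_add[OF linear_cov_deriv_field[OF x]] linear_diff[OF linear_cov_deriv_field[OF x]]
    linear_cmul[OF linear_cov_deriv_field[OF x]]
  define u0 where "u0 = u - ?g u (V x) *\<^sub>R V x"
  define v0 where "v0 = v - ?g v (V x) *\<^sub>R V x"
  have h: "?g u0 (V x) = 0" "?g v0 (V x) = 0"
    by (simp_all add: u0_def v0_def inner_at_simps unit[OF x])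
  then have "?g (u0 + v0) (V x) = 0" by (simp add: inner_at_simps)
  from H[OF this] H[OF h(1)] H[OF h(2)] have "?g (?S u0) v0 + ?g (?S v0) u0 = 0"
    by (simp add: lin inner_at_simps)
  moreover have "?g (?S u0) v0 = ?g (?S u) v - ?g u (V x) * ?g (acceleration x) v"
    "?g (?S v0) u0 = ?g (?S v) u - ?g v (V x) * ?g (acceleration x) u"
    by (simp_all add: u0_def v0_def lin inner_at_simps inner_cov_deriv_field[OF x] acceleration_cov_deriv)
  ultimately show ?thesis by simp
qed

text \<open>The trace sees only the symmetric part of \<open>DV\<close>, which is the symmetric product of \<open>V\<close> with its
  acceleration, and these are orthogonal.\<close>

lemma trace_cov_deriv_eq_0:
  assumes x: "x \<in> D"
    and H: "\<And>u. inner_at (G x) u (V x) = 0 \<Longrightarrow> inner_at (G x) (cov_deriv G V x u) u = 0"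
  shows "trace (matrix (cov_deriv G V x)) = 0"
proof -
  let ?S = "cov_deriv G V x" and ?H = "matrix_inv (G x)" and ?g = "inner_at (G x)" and ?t = "acceleration x"
  let ?e = "\<lambda>i. axis i (1::real) :: real^'n"
  have "transpose ?H = ?H"
    using transpose_matrix_inv_sym[OF invertible_metric[OF x]] posdef[OF x]
    by (simp add: positive_definite_def)
  then have Hs: "?H $ i $ l = ?H $ l $ i" for i l
    unfolding transpose_def by (metis vec_lambda_beta)
  have comp: "w $ i = (\<Sum>l\<in>UNIV. ?H $ i $ l * ?g w (?e l))" for w i
  proof -
    have "w $ i = (?H *v (G x *v w)) $ i" by (simp add: matrix_inv_mul_vec[OF invertible_metric[OF x]])
    also have "\<dots> = (\<Sum>l\<in>UNIV. ?H $ i $ l * (G x *v w) $ l)" by (simp add: matrix_vector_mult_def)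
    also have "\<dots> = (\<Sum>l\<in>UNIV. ?H $ i $ l * ?g w (?e l))"
      unfolding inner_sym[OF x, of w] by (simp add: inner_at_def inner_axis')
    finally show ?thesis .
  qed
  have tr: "trace (matrix ?S) = (\<Sum>i\<in>UNIV. \<Sum>l\<in>UNIV. ?H $ i $ l * ?g (?S (?e i)) (?e l))"
    unfolding trace_matrix by (rule sum.cong[OF refl comp])
  also have "\<dots> = (\<Sum>i\<in>UNIV. \<Sum>l\<in>UNIV. ?H $ i $ l * ?g (?S (?e l)) (?e i))"
    by (subst sum.swap) (simp add: Hs)
  finally have "2 * trace (matrix ?S) =
      (\<Sum>i\<in>UNIV. \<Sum>l\<in>UNIV. ?H $ i $ l * (?g (?S (?e i)) (?e l) + ?g (?S (?e l)) (?e i)))"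
    using tr by (simp add: sum.distrib distrib_left)
  also have "\<dots> = (\<Sum>i\<in>UNIV. \<Sum>l\<in>UNIV. ?H $ i $ l * (?g (?e i) (V x) * ?g ?t (?e l)))
      + (\<Sum>i\<in>UNIV. \<Sum>l\<in>UNIV. ?H $ i $ l * (?g (?e l) (V x) * ?g ?t (?e i)))"
    by (simp add: cov_deriv_sym_part[OF x H] sum.distrib distrib_left)
  also have "(\<Sum>i\<in>UNIV. \<Sum>l\<in>UNIV. ?H $ i $ l * (?g (?e l) (V x) * ?g ?t (?e i)))
     = (\<Sum>i\<in>UNIV. \<Sum>l\<in>UNIV. ?H $ i $ l * (?g (?e i) (V x) * ?g ?t (?e l)))"
    by (subst sum.swap) (simp add: Hs)
  also have "(\<Sum>i\<in>UNIV. \<Sum>l\<in>UNIV. ?H $ i $ l * (?g (?e i) (V x) * ?g ?t (?e l)))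
     = (\<Sum>i\<in>UNIV. ?t $ i * ?g (?e i) (V x))"
    unfolding comp[of ?t] sum_distrib_right by (simp add: mult_ac)
  also have "\<dots> = ?g ?t (V x)"
    unfolding inner_at_def inner_axis' by (simp add: inner_vec_def)
  also have "\<dots> = 0" by (rule inner_acceleration[OF x])
  finally show ?thesis by simp
qed

text \<open>Without acceleration \<open>DV\<close> is skew, and the Ricci curvature in the direction of \<open>V\<close> is
  \<open>- tr (DV)\<^sup>2\<close>.\<close>

lemma cov_deriv_eq_0_if_ricci_0:
  assumes x: "x \<in> D"
    and H: "\<And>y u. y \<in> D \<Longrightarrow> inner_at (G y) u (V y) = 0 \<Longrightarrow> inner_at (G y) (cov_deriv G V y u) u = 0"
    and a: "\<And>y. y \<in> D \<Longrightarrow> acceleration y = 0"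
    and ric: "ricci G V V x = 0"
  shows "cov_deriv G V x u = 0"
proof (rule skew_eq_0_if_trace_square_0[OF posdef[OF x] linear_cov_deriv_field[OF x]])
  fix u v
  show "inner_at (G x) (cov_deriv G V x u) v = - inner_at (G x) u (cov_deriv G V x v)"
    using cov_deriv_sym_part[OF x H[OF x], of u v] a[OF x] inner_sym[OF x, of u]
    by (simp add: inner_at_simps)
next
  have "dir_deriv acceleration x = dir_deriv (\<lambda>_. 0) x"
    by (rule dir_deriv_cong[OF open_dom x a])
  moreover have "linear (christoffel G x u)" for u by (rule christoffel_linear(2)[OF x])
  ultimately have 1: "cov_deriv G acceleration x = (\<lambda>_. 0)"
    using a[OF x] by (simp add: cov_deriv_def fun_eq_iff linear_0)
  have "dir_deriv (\<lambda>y. trace (matrix (cov_deriv G V y))) x = dir_deriv (\<lambda>_. 0) x"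
    by (rule dir_deriv_cong[OF open_dom x trace_cov_deriv_eq_0[OF _ H]])
  then show "trace (matrix (\<lambda>u. cov_deriv G V x (cov_deriv G V x u))) = 0"
    using ricci_formula[OF x smooth_field] ric 1 by (simp add: trace_matrix)
qed

lemma ricci_eq_0_if_parallel:
  assumes x: "x \<in> D" and S: "\<And>y u. y \<in> D \<Longrightarrow> cov_deriv G V y u = 0"
  shows "ricci G V V x = 0"
proof -
  have "dir_deriv acceleration x = dir_deriv (\<lambda>_. 0) x"
    by (rule dir_deriv_cong[OF open_dom x]) (simp add: acceleration_cov_deriv S)
  moreover have "linear (christoffel G x u)" for u by (rule christoffel_linear(2)[OF x])
  ultimately have 1: "cov_deriv G acceleration x = (\<lambda>_. 0)"
    using S[OF x] by (simp add: cov_deriv_def[of G acceleration] acceleration_cov_deriv fun_eq_iff linear_0)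
  have "dir_deriv (\<lambda>y. trace (matrix (cov_deriv G V y))) x = dir_deriv (\<lambda>_. 0) x"
    by (rule dir_deriv_cong[OF open_dom x]) (simp add: S trace_matrix)
  then show ?thesis
    using ricci_formula[OF x smooth_field] 1 by (simp add: trace_matrix S[OF x])
qed

end

section \<open>Co-closed two-forms in dimension three\<close>

abbreviation triple :: "real^3 \<Rightarrow> real^3 \<Rightarrow> real^3 \<Rightarrow> real" where
  "triple u v w \<equiv> det (vector [u, v, w] :: real^3^3)"

lemma triple_expand: "triple u v w =
   u$1 * v$2 * w$3 + u$2 * v$3 * w$1 + u$3 * v$1 * w$2 - u$1 * v$3 * w$2 - u$2 * v$1 * w$3 - u$3 * v$2 * w$1"
  by (simp add: det_3 vector_3)

lemma axis_nth_3: "axis i (1::real) $ j = (if i = j then 1 else 0)"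
  by (simp add: axis_def)

lemma triple_has_derivative:
  fixes A B :: "'a::real_normed_vector \<Rightarrow> real^3"
  assumes "(A has_derivative A') (at x)" "(B has_derivative B') (at x)"
  shows "((\<lambda>y. triple (A y) (B y) w) has_derivative (\<lambda>u. triple (A' u) (B x) w + triple (A x) (B' u) w)) (at x)"
proof -
  have "((\<lambda>y. A y $ i) has_derivative (\<lambda>u. A' u $ i)) (at x)" "((\<lambda>y. B y $ i) has_derivative (\<lambda>u. B' u $ i)) (at x)" for i
    using assms by (auto intro: bounded_linear.has_derivative[OF bounded_linear_vec_nth])
  note [derivative_intros] = this
  show ?thesis
    unfolding triple_expand by (auto intro!: derivative_eq_intros simp: algebra_simps)
qed

text \<open>The classical formula \<open>curl (A \<times> B) = A div B - B div A + (B \<cdot> \<nabla>) A - (A \<cdot> \<nabla>) B\<close>;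
  closedness of the one-form \<open>det (A, B, \<cdot>)\<close> means that the left hand side is zero.\<close>

lemma curl_cross_product:
  fixes A B :: "real^3 \<Rightarrow> real^3"
  assumes A: "(A has_derivative A') (at x)" and B: "(B has_derivative B') (at x)"
    and closed: "\<And>u v. dir_deriv (\<lambda>y. triple (A y) (B y) v) x u = dir_deriv (\<lambda>y. triple (A y) (B y) u) x v"
  shows "trace (matrix B') *\<^sub>R A x - trace (matrix A') *\<^sub>R B x + A' (B x) - B' (A x) = 0"
proof -
  have *: "triple (A' u) (B x) v + triple (A x) (B' u) v = triple (A' v) (B x) u + triple (A x) (B' v) u" for u v
    using closed[of v u] by (simp add: dir_deriv_eqI[OF triple_has_derivative[OF A B]])
  note A'3 = linear_axis_expansion[OF has_derivative_linear[OF A], of "B x"]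
  note B'3 = linear_axis_expansion[OF has_derivative_linear[OF B], of "A x"]
  show ?thesis
    unfolding vec_eq_iff forall_3 A'3 B'3
    using *[of "axis 2 1" "axis 3 1"] *[of "axis 3 1" "axis 1 1"] *[of "axis 1 1" "axis 2 1"]
    by (simp add: triple_expand trace_matrix sum_3 axis_nth_3 algebra_simps)
qed

text \<open>Raising an index of the form \<open>\<langle>\<cdot>, a\<rangle>\<close> gives back the vector \<open>a\<close>, so the star of the wedge product of two such forms
  is the volume form with the two vectors inserted.\<close>

lemma hodge_star_wedge_vectors:
  assumes "invertible (g c x)" "transpose (g c x) = g c x"
    and "\<And>u v. \<omega> c x u v = inner_at (g c x) u a * inner_at (g c x) v b - inner_at (g c x) v a * inner_at (g c x) u b"
  shows "hodge_star2 g \<omega> c x w = sqrt (det (g c x)) * triple a b w"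
proof -
  have *: "inner_at (g c x) (matrix_inv (g c x) *v axis i 1) v = v $ i" for i v
    unfolding inner_at_commute[OF assms(2), of _ v]
    by (simp add: inner_at_def matrix_inv_mul_vec(1)[OF assms(1)] inner_axis)
  show ?thesis
    by (simp add: hodge_star2_def volume_form_def assms(3) * sum_3 triple_expand axis_nth_3 field_simps)
qed

text \<open>The star operator is injective: evaluated at the coordinate vectors, it returns up to a common
  factor the three independent components of \<open>\<eta>\<close> in the basis of the vectors \<open>g\<^sup>-\<^sup>1 \<partial>\<^sub>i\<close>.\<close>

lemma hodge_star_eq_0:
  fixes g :: "('a, 3) metric"
  assumes inv: "invertible (g c x)" and det: "det (g c x) > 0"
    and star: "\<And>w. hodge_star2 g \<eta> c x w = 0"
    and alt: "\<And>u v. \<eta> c x u v = - \<eta> c x v u"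
    and lin: "\<And>u. linear (\<eta> c x u)"
  shows "\<eta> c x u v = 0"
proof -
  let ?H = "matrix_inv (g c x)"
  let ?h = "\<lambda>i. ?H *v axis i 1"
  define m where "m i j = \<eta> c x (?h i) (?h j)" for i j
  have malt: "m i j = - m j i" for i j unfolding m_def by (rule alt)
  have "(\<Sum>i\<in>UNIV. \<Sum>j\<in>UNIV. m i j * triple (axis i 1) (axis j 1) (axis k 1)) = 0" for k
  proof -
    have "sqrt (det (g c x)) * (\<Sum>i\<in>UNIV. \<Sum>j\<in>UNIV. m i j * triple (axis i 1) (axis j 1) (axis k 1)) = 0"
      using star[of "axis k 1"]
      by (simp add: hodge_star2_def volume_form_def m_def sum_distrib_left mult_ac)
    then show ?thesis using det by simp
  qed
  from this[of 1] this[of 2] this[of 3] have "m 2 3 = m 3 2" "m 3 1 = m 1 3" "m 1 2 = m 2 1"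
    by (simp_all add: sum_3 triple_expand axis_nth_3)
  then have m0: "m i j = 0" for i j
    using malt[of 1 1] malt[of 2 2] malt[of 3 3] malt[of 1 2] malt[of 2 3] malt[of 3 1]
      exhaust_3[of i] exhaust_3[of j] by auto
  have rep: "w = (\<Sum>i\<in>UNIV. (g c x *v w) $ i *\<^sub>R ?h i)" for w
  proof -
    have "w = ?H *v (g c x *v w)" by (simp add: matrix_inv_mul_vec(2)[OF inv])
    also have "\<dots> = (\<Sum>i\<in>UNIV. (g c x *v w) $ i *\<^sub>R ?h i)"
      by (rule linear_axis_expansion[OF matrix_vector_mul_linear])
    finally show ?thesis .
  qed
  have h0: "\<eta> c x (?h i) w = 0" for i w
    using m0[of i] by (subst rep[of w]) (simp add: linear_sum[OF lin] linear_cmul[OF lin] m_def)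
  have "\<eta> c x v u = 0"
    using h0 alt[of v] by (subst rep[of u]) (simp add: linear_sum[OF lin] linear_cmul[OF lin])
  then show ?thesis using alt[of u v] by simp
qed

lemma (in unit_field_chart) mean_curvature_eq_acceleration:
  assumes "g c = G" "W c = V" "x \<in> D"
  shows "mean_curvature_field g W c x = acceleration x"
  using assms by (simp add: mean_curvature_field_def inner_acceleration)

locale unit_field_chart3 = unit_field_chart D G V for D :: "(real^3) set" and G V
begin

definition density :: "real^3 \<Rightarrow> real" where
  "density x = sqrt (det (G x))"

lemma density_pos: "x \<in> D \<Longrightarrow> density x > 0"
  by (simp add: density_def positive_definite_det[OF posdef])

lemma smooth_density: "smooth_on D density"
  unfolding density_def[abs_def]
  by (rule smooth_on_sqrt[OF open_dom positive_definite_det[OF posdef]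
      smooth_on_det[OF open_dom smooth_on_mat_nth[OF open_dom smooth_metric]]])

text \<open>Put \<open>A = s \<tau>\<close> with the volume density \<open>s\<close>. Co-closedness of \<open>\<kappa> \<and> \<chi>\<close> says that the one-form
  \<open>\<star>(\<kappa> \<and> \<chi>) = det (A, V, \<cdot>)\<close> is closed, hence \<open>A div V - V div A + [V, A] = 0\<close>. In the inner product with \<open>V\<close> the
  first term drops out, and \<open>\<langle>[V, A], V\<rangle> = \<langle>D\<^sub>V A, V\<rangle> = - \<langle>A, D\<^sub>V V\<rangle> = - s \<langle>\<tau>, \<tau>\<rangle>\<close>.\<close>

lemma divergence_if_coclosed:
  fixes g :: "('a, 3) metric"
  assumes gc: "g c = G" and Vc: "W c = V" and x: "x \<in> D"
    and co: "\<And>w. codifferential2 g (wedge (mean_curvature_form g W) (characteristic_form g W)) c x w = 0"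
  shows "(\<Sum>i\<in>UNIV. dir_deriv (\<lambda>y. density y * acceleration y $ i) x (axis i 1)) =
    - density x * inner_at (G x) (acceleration x) (acceleration x)"
proof -
  let ?\<omega> = "wedge (mean_curvature_form g W) (characteristic_form g W)"
  let ?g = "inner_at (G x)"
  define A where "A = (\<lambda>y. density y *\<^sub>R acceleration y)"
  have smA: "smooth_on D A"
    unfolding A_def by (rule smooth_on_scaleR[OF open_dom smooth_density smooth_acceleration])
  note A' = smooth_on_has_derivative[OF smA x]
  note V' = smooth_on_has_derivative[OF smooth_field x]
  have star: "hodge_star2 g ?\<omega> c y w = triple (A y) (V y) w" if "y \<in> D" for y w
  proof -
    have "hodge_star2 g ?\<omega> c y w = sqrt (det (g c y)) * triple (acceleration y) (V y) w"
      using posdef[OF that] invertible_metric[OF that] mean_curvature_eq_acceleration[of g c W, OF gc Vc that]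
      by (intro hodge_star_wedge_vectors)
         (auto simp: gc Vc positive_definite_def wedge_def mean_curvature_form_def characteristic_form_def)
    then show ?thesis by (simp add: A_def gc density_def triple_expand algebra_simps)
  qed
  define \<eta> where "\<eta> = ext_deriv1 (hodge_star2 g ?\<omega>)"
  have D\<theta>: "dir_deriv (\<lambda>y. hodge_star2 g ?\<omega> c y v) x u = dir_deriv (\<lambda>y. triple (A y) (V y) v) x u" for u v
    by (rule fun_cong[OF dir_deriv_cong[OF open_dom x star]])
  have \<eta>: "\<eta> c x u v = dir_deriv (\<lambda>y. triple (A y) (V y) v) x u - dir_deriv (\<lambda>y. triple (A y) (V y) u) x v" for u v
    by (simp add: \<eta>_def ext_deriv1_def D\<theta>)
  have "\<eta> c x u v = 0" for u v
  proof (rule hodge_star_eq_0)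
    show "invertible (g c x)" "det (g c x) > 0"
      using invertible_metric[OF x] positive_definite_det[OF posdef[OF x]] by (simp_all add: gc)
    show "hodge_star2 g \<eta> c x w = 0" for w
      using co[of w] by (simp add: codifferential2_def \<eta>_def)
    show "linear (\<eta> c x u)" for u
      unfolding \<eta>[abs_def] dir_deriv_eqI[OF triple_has_derivative[OF A' V']]
      using linear_add[OF has_derivative_linear[OF A']] linear_add[OF has_derivative_linear[OF V']]
        linear_cmul[OF has_derivative_linear[OF A']] linear_cmul[OF has_derivative_linear[OF V']]
      by (intro linearI) (simp_all add: triple_expand algebra_simps)
  qed (simp add: \<eta>)
  then have closed: "dir_deriv (\<lambda>y. triple (A y) (V y) v) x u = dir_deriv (\<lambda>y. triple (A y) (V y) u) x v" for u v
    using \<eta>[of u v] by simp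
  have curl: "trace (matrix (dir_deriv V x)) *\<^sub>R A x - trace (matrix (dir_deriv A x)) *\<^sub>R V x
      + dir_deriv A x (V x) - dir_deriv V x (A x) = 0"
    by (rule curl_cross_product[OF A' V' closed])
  have AV: "?g (A x) (V x) = 0" by (simp add: A_def inner_at_simps inner_acceleration[OF x])
  have "?g (dir_deriv A x (V x) - dir_deriv V x (A x)) (V x) = trace (matrix (dir_deriv A x))"
  proof -
    have "dir_deriv A x (V x) - dir_deriv V x (A x) =
      trace (matrix (dir_deriv A x)) *\<^sub>R V x - trace (matrix (dir_deriv V x)) *\<^sub>R A x"
      using curl by (simp add: algebra_simps)
    then show ?thesis by (simp add: inner_at_simps AV unit[OF x])
  qed
  moreover have "dir_deriv A x (V x) - dir_deriv V x (A x) = cov_deriv G A x (V x) - cov_deriv G V x (A x)"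
    using lie_bracket_cov_deriv[OF x, of V A] by (simp add: lie_bracket_def)
  moreover have "?g (cov_deriv G A x (V x)) (V x) = - ?g (A x) (acceleration x)"
  proof -
    have "dir_deriv (\<lambda>y. inner_at (G y) (A y) (V y)) x (V x) = dir_deriv (\<lambda>_. 0) x (V x)"
      by (subst dir_deriv_cong[OF open_dom x, of _ "\<lambda>_. 0"])
         (simp_all add: A_def inner_at_simps inner_acceleration)
    then show ?thesis
      using dir_deriv_inner[OF x smooth_on_differentiable[OF smA x] field_differentiable[OF x], of "V x"]
      by (simp add: acceleration_cov_deriv)
  qed
  ultimately have "trace (matrix (dir_deriv A x)) = - ?g (A x) (acceleration x)"
    by (simp add: inner_at_simps inner_cov_deriv_field[OF x])
  moreover have "trace (matrix (dir_deriv A x)) = (\<Sum>i\<in>UNIV. dir_deriv (\<lambda>y. density y * acceleration y $ i) x (axis i 1))"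
  proof -
    have "dir_deriv (\<lambda>y. A y $ i) x = (\<lambda>u. dir_deriv A x u $ i)" for i
      by (rule dir_deriv_eqI[OF bounded_linear.has_derivative[OF bounded_linear_vec_nth A']])
    then show ?thesis by (simp add: trace_matrix A_def)
  qed
  ultimately show ?thesis by (simp add: A_def inner_at_simps)
qed

end

section \<open>Charts and coordinate changes\<close>

locale atlas =
  fixes M :: "'a topology" and A :: "('a, 'n::finite) chart set"
  assumes smooth_atlas: "smooth_atlas M A"
begin

abbreviation cran :: "('a, 'n) chart \<Rightarrow> (real^'n) set" where
  "cran c \<equiv> coord c ` cdom c"

lemma chartD:
  assumes "c \<in> A"
  shows "openin M (cdom c)" "open (cran c)"
    "homeomorphic_map (subtopology M (cdom c)) (top_of_set (cran c)) (coord c)"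
  using smooth_atlas assms by (auto simp: smooth_atlas_def is_chart_def)

lemma cdom_subset: "c \<in> A \<Longrightarrow> cdom c \<subseteq> topspace M"
  by (rule openin_subset[OF chartD(1)])

lemma inj_on_coord: "c \<in> A \<Longrightarrow> inj_on (coord c) (cdom c)"
  using homeomorphic_imp_injective_map[OF chartD(3)] cdom_subset
  by (simp add: topspace_subtopology Int_absorb1)

lemma cinv_coord: "c \<in> A \<Longrightarrow> p \<in> cdom c \<Longrightarrow> cinv c (coord c p) = p"
  by (simp add: cinv_def inj_on_coord)

lemma coord_cinv: "x \<in> cran c \<Longrightarrow> coord c (cinv c x) = x"
  by (simp add: cinv_def f_inv_into_f)

lemma cinv_in: "x \<in> cran c \<Longrightarrow> cinv c x \<in> cdom c"
  by (simp add: cinv_def inv_into_into)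

lemma mem_cimg: "c \<in> A \<Longrightarrow> x \<in> cimg c S \<longleftrightarrow> x \<in> cran c \<and> cinv c x \<in> S"
  by (auto simp: cimg_def cinv_coord cinv_in coord_cinv image_iff)

lemma cimg_subset: "cimg c S \<subseteq> cran c"
  by (auto simp: cimg_def)

lemma cimg_topspace: "c \<in> A \<Longrightarrow> cimg c (topspace M) = cran c"
  using cdom_subset by (auto simp: cimg_def)

lemma topspace_covered:
  assumes "p \<in> topspace M"
  obtains c where "c \<in> A" "p \<in> cdom c"
  using smooth_atlas assms unfolding smooth_atlas_def by blast

definition chart_at :: "'a \<Rightarrow> ('a, 'n) chart" where
  "chart_at p = (SOME c. c \<in> A \<and> p \<in> cdom c)"

lemma chart_at:
  assumes "p \<in> topspace M"
  shows "chart_at p \<in> A" "p \<in> cdom (chart_at p)"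
proof -
  obtain c where "c \<in> A" "p \<in> cdom c" by (rule topspace_covered[OF assms])
  then have "chart_at p \<in> A \<and> p \<in> cdom (chart_at p)"
    unfolding chart_at_def by (intro someI) blast
  then show "chart_at p \<in> A" "p \<in> cdom (chart_at p)" by auto
qed

lemma continuous_map_coord: "c \<in> A \<Longrightarrow> continuous_map (subtopology M (cdom c)) euclidean (coord c)"
  using homeomorphic_imp_continuous_map[OF chartD(3)] continuous_map_into_fulltopology by blast

lemma continuous_map_cinv:
  assumes "c \<in> A"
  shows "continuous_map (top_of_set (cran c)) M (cinv c)"
proof -
  obtain h where h: "homeomorphic_maps (subtopology M (cdom c)) (top_of_set (cran c)) (coord c) h"
    using chartD(3)[OF assms] homeomorphic_map_maps by blast
  then have "continuous_map (top_of_set (cran c)) (subtopology M (cdom c)) h"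
    by (simp add: homeomorphic_maps_def)
  moreover have "h x = cinv c x" if x: "x \<in> cran c" for x
  proof -
    have "h (coord c (cinv c x)) = cinv c x"
      using h cinv_in[OF x] cdom_subset[OF assms] by (auto simp: homeomorphic_maps_def)
    then show ?thesis by (simp add: coord_cinv x)
  qed
  ultimately have "continuous_map (top_of_set (cran c)) (subtopology M (cdom c)) (cinv c)"
    by (auto intro: continuous_map_eq)
  then show ?thesis using continuous_map_into_fulltopology by blast
qed

lemma open_cimg:
  assumes "c \<in> A" "openin M S"
  shows "open (cimg c S)"
proof -
  have "openin (top_of_set (cran c)) {x \<in> topspace (top_of_set (cran c)). cinv c x \<in> S}"
    by (rule openin_continuous_map_preimage[OF continuous_map_cinv[OF assms(1)] assms(2)])
  moreover have "{x \<in> topspace (top_of_set (cran c)). cinv c x \<in> S} = cimg c S"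
    using mem_cimg[OF assms(1)] by auto
  ultimately show ?thesis
    using openin_open_trans chartD(2)[OF assms(1)] by metis
qed

lemma cinv_image_eq: "c \<in> A \<Longrightarrow> T \<subseteq> cran c \<Longrightarrow> cinv c ` T = {p \<in> cdom c. coord c p \<in> T}"
  by (auto simp: cinv_in subset_iff coord_cinv image_iff) (metis cinv_coord)

lemma openin_cinv_image:
  assumes "c \<in> A" "open T" "T \<subseteq> cran c"
  shows "openin M (cinv c ` T)"
proof -
  have "openin (subtopology M (cdom c)) {p \<in> topspace (subtopology M (cdom c)). coord c p \<in> T}"
    by (rule openin_continuous_map_preimage[OF continuous_map_coord[OF assms(1)]]) (use assms in simp)
  moreover have "{p \<in> topspace (subtopology M (cdom c)). coord c p \<in> T} = cinv c ` T"
    using cinv_image_eq[OF assms(1,3)] cdom_subset[OF assms(1)] by auto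
  ultimately show ?thesis
    using chartD(1)[OF assms(1)] openin_trans_full by metis
qed

lemma open_overlap: "c \<in> A \<Longrightarrow> c' \<in> A \<Longrightarrow> open (cimg c (cdom c'))"
  by (rule open_cimg[OF _ chartD(1)])

lemma smooth_trans_map: "c \<in> A \<Longrightarrow> c' \<in> A \<Longrightarrow> smooth_on (cimg c (cdom c')) (trans_map c c')"
  using smooth_atlas by (simp add: smooth_atlas_def)

lemma cinv_trans_map:
  assumes "c \<in> A" "c' \<in> A" "x \<in> cimg c (cdom c')"
  shows "cinv c' (trans_map c c' x) = cinv c x"
  using assms by (simp add: mem_cimg trans_map_def cinv_coord)

lemma trans_map_in:
  assumes "c \<in> A" "c' \<in> A" "x \<in> cimg c (cdom c')"
  shows "trans_map c c' x \<in> cimg c' (cdom c)" "trans_map c c' x \<in> cran c'"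
  using assms cinv_trans_map[OF assms] cinv_in
  by (auto simp: mem_cimg) (auto simp: trans_map_def)

lemma trans_map_inverse:
  assumes "c \<in> A" "c' \<in> A" "x \<in> cimg c (cdom c')"
  shows "trans_map c' c (trans_map c c' x) = x"
  using cinv_trans_map[OF assms] assms mem_cimg[OF assms(1)]
  by (simp add: trans_map_def[of c' c] coord_cinv)

lemma trans_map_cimg:
  assumes "c \<in> A" "c' \<in> A"
  shows "trans_map c c' ` cimg c (cdom c') = cimg c' (cdom c)"
proof
  show "trans_map c c' ` cimg c (cdom c') \<subseteq> cimg c' (cdom c)"
    using trans_map_in(1)[OF assms] by auto
  show "cimg c' (cdom c) \<subseteq> trans_map c c' ` cimg c (cdom c')"
    using trans_map_inverse[OF assms(2,1)] trans_map_in(1)[OF assms(2,1)] by (metis image_eqI subsetI)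
qed

lemma inj_on_trans_map: "c \<in> A \<Longrightarrow> c' \<in> A \<Longrightarrow> inj_on (trans_map c c') (cimg c (cdom c'))"
  by (rule inj_on_inverseI[of _ "trans_map c' c"]) (rule trans_map_inverse)

abbreviation dtrans :: "('a, 'n) chart \<Rightarrow> ('a, 'n) chart \<Rightarrow> real^'n \<Rightarrow> real^'n \<Rightarrow> real^'n" where
  "dtrans c c' x \<equiv> dir_deriv (trans_map c c') x"

lemma trans_map_has_derivative:
  "c \<in> A \<Longrightarrow> c' \<in> A \<Longrightarrow> x \<in> cimg c (cdom c') \<Longrightarrow> (trans_map c c' has_derivative dtrans c c' x) (at x)"
  by (rule smooth_on_has_derivative[OF smooth_trans_map])

lemma dtrans_inverse:
  assumes "c \<in> A" "c' \<in> A" "x \<in> cimg c (cdom c')"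
  shows "dtrans c' c (trans_map c c' x) (dtrans c c' x v) = v"
proof -
  have "((\<lambda>y. trans_map c' c (trans_map c c' y)) has_derivative
      (\<lambda>v. dtrans c' c (trans_map c c' x) (dtrans c c' x v))) (at x)"
    by (rule has_derivative_compose[OF trans_map_has_derivative[OF assms]
          trans_map_has_derivative[OF assms(2,1) trans_map_in(1)[OF assms]]])
  then have "((\<lambda>y. y) has_derivative (\<lambda>v. dtrans c' c (trans_map c c' x) (dtrans c c' x v))) (at x)"
    by (rule has_derivative_transform_within_open[OF _ open_overlap[OF assms(1,2)] assms(3)])
       (rule trans_map_inverse[OF assms(1,2)])
  from fun_cong[OF dir_deriv_eqI[OF this], of v] show ?thesis by simp
qed

lemma dtrans_inverse':
  assumes "c \<in> A" "c' \<in> A" "x \<in> cimg c (cdom c')"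
  shows "dtrans c c' x (dtrans c' c (trans_map c c' x) v) = v"
  using dtrans_inverse[OF assms(2,1) trans_map_in(1)[OF assms]] trans_map_inverse[OF assms] by simp

lemma tangent_map_trans:
  assumes c: "c \<in> A" "c' \<in> A" and x: "x \<in> cimg c (cdom c')"
    and f: "(f \<circ> cinv c') differentiable (at (trans_map c c' x))"
  shows "tangent_map f c x v = tangent_map f c' (trans_map c c' x) (dtrans c c' x v)"
proof -
  have "dir_deriv (f \<circ> cinv c) x = dir_deriv (\<lambda>y. (f \<circ> cinv c') (trans_map c c' y)) x"
    by (rule dir_deriv_cong[OF open_overlap[OF c] x]) (simp add: cinv_trans_map[OF c])
  then show ?thesis
    using dir_deriv_compose[OF smooth_on_differentiable[OF smooth_trans_map[OF c] x] f]
    by (simp add: tangent_map_def o_def)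
qed

lemma k_smooth_on_trans:
  assumes c: "c \<in> A" "c' \<in> A" and S: "open S" "S \<subseteq> cimg c (cdom c')" "trans_map c c' ` S \<subseteq> T"
    and f: "k_smooth_on k T (f \<circ> cinv c')"
  shows "k_smooth_on k S (f \<circ> cinv c)"
proof (rule k_smooth_on_cong[OF S(1)])
  show "k_smooth_on k S (\<lambda>x. (f \<circ> cinv c') (trans_map c c' x))"
    by (rule k_smooth_on_compose[OF S(1,3) f])
       (rule smooth_onD[OF smooth_on_subset[OF smooth_trans_map[OF c] S(2)]])
  show "(f \<circ> cinv c') (trans_map c c' x) = (f \<circ> cinv c) x" if "x \<in> S" for x
    using S(2) that cinv_trans_map[OF c] by auto
qed

lemma vector_field_on_subset:
  assumes "vector_field_on A S X" "T \<subseteq> S"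
  shows "vector_field_on A T X"
proof -
  have "cimg c T \<subseteq> cimg c S" "cimg c (cdom c' \<inter> T) \<subseteq> cimg c (cdom c' \<inter> S)" for c c' :: "('a, 'n) chart"
    using assms(2) by (auto simp: cimg_def)
  then show ?thesis
    using assms(1) unfolding vector_field_on_def by (meson smooth_on_subset subsetD)
qed

lemma vector_field_smooth:
  "vector_field_on A S X \<Longrightarrow> c \<in> A \<Longrightarrow> smooth_on (cimg c S) (X c)"
  by (simp add: vector_field_on_def)

lemma vector_field_trans:
  "vector_field_on A (topspace M) X \<Longrightarrow> c \<in> A \<Longrightarrow> c' \<in> A \<Longrightarrow> x \<in> cimg c (cdom c') \<Longrightarrow>
    X c' (trans_map c c' x) = dtrans c c' x (X c x)"
  using cdom_subset[of c'] by (simp add: vector_field_on_def Int_absorb2)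

end

section \<open>The divergence theorem on a closed manifold\<close>

lemma k_smooth_on_Un:
  assumes "open S" "open T"
  shows "k_smooth_on k S f \<Longrightarrow> k_smooth_on k T f \<Longrightarrow> k_smooth_on k (S \<union> T) f"
  by (induction k arbitrary: f) (auto simp: assms continuous_on_open_Un)

lemma k_smooth_on_zero_extension:
  assumes S: "open S" "k_smooth_on k S f" and K: "compact K" "K \<subseteq> S" "\<And>x. x \<in> S - K \<Longrightarrow> f x = 0"
  shows "k_smooth_on k UNIV (\<lambda>x. if x \<in> S then f x else 0)"
proof -
  let ?f = "\<lambda>x. if x \<in> S then f x else 0"
  have oK: "open (- K)" using K(1) by (simp add: compact_imp_closed open_Compl)
  have "k_smooth_on k S ?f" by (rule k_smooth_on_cong[OF S(1) _ S(2)]) simp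
  moreover have "k_smooth_on k (- K) ?f"
    by (rule k_smooth_on_cong[OF oK _ k_smooth_on_const[of k _ 0]]) (use K in auto)
  ultimately have "k_smooth_on k (S \<union> - K) ?f" by (rule k_smooth_on_Un[OF S(1) oK])
  moreover have "S \<union> - K = UNIV" using K(2) by auto
  ultimately show ?thesis by simp
qed

lemma integral_eq_on_support:
  fixes f :: "'a::euclidean_space \<Rightarrow> 'b::banach"
  assumes "\<And>x. x \<notin> S \<Longrightarrow> f x = 0"
  shows "integral S f = integral UNIV f"
proof -
  have "(\<lambda>x. if x \<in> S then f x else 0) = f" using assms by auto
  then show ?thesis using integral_restrict_UNIV[of S f] by simp
qed

lemma absolutely_integrable_compact_support:
  fixes f :: "'a::euclidean_space \<Rightarrow> 'b::euclidean_space"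
  assumes "continuous_on UNIV f" "compact K" "\<And>x. x \<notin> K \<Longrightarrow> f x = 0"
  shows "f absolutely_integrable_on UNIV"
proof -
  obtain a where a: "K \<subseteq> cbox (-a) a"
    by (rule bounded_subset_cbox_symmetric[OF compact_imp_bounded[OF assms(2)]])
  have "(\<lambda>x. if x \<in> cbox (-a) a then f x else 0) = f"
    by (rule ext) (use assms(3) a in auto)
  moreover have "f absolutely_integrable_on cbox (-a) a"
    by (rule absolutely_integrable_continuous[OF continuous_on_subset[OF assms(1)]]) simp
  ultimately show ?thesis using absolutely_integrable_restrict_UNIV[of "cbox (-a) a" f] by simp
qed

text \<open>Translation invariance of the integral makes \<open>t \<mapsto> \<integral> f (x + t e) dx\<close> constant, and the
  integral in question is its derivative at \<open>0\<close>.\<close>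

lemma integral_dir_deriv_compact_support:
  fixes f :: "'a::euclidean_space \<Rightarrow> real"
  assumes f: "k_smooth_on 1 UNIV f" and K: "compact K" "\<And>x. x \<notin> K \<Longrightarrow> f x = 0"
  shows "integral UNIV (\<lambda>x. dir_deriv f x e) = 0"
proof -
  have fd: "(f has_derivative dir_deriv f x) (at x)" for x using f by (simp add: has_dir_deriv)
  have f0: "continuous_on UNIV f" by (rule k_smooth_on_imp_continuous[OF f])
  have cont: "continuous_on UNIV (\<lambda>x. dir_deriv f x e)" using f by simp
  \<comment> \<open>the supports of all translates by \<open>t e\<close> with \<open>\<bar>t\<bar> \<le> 1\<close>, so that one box serves for all of them\<close>
  define L where "L = (\<lambda>z. fst z - snd z *\<^sub>R e) ` (K \<times> {-1..1::real})"
  have "compact L" unfolding L_def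
    by (intro compact_continuous_image compact_Times K compact_Icc continuous_intros)
  then obtain a where a: "L \<subseteq> cbox (-a) a"
    by (rule bounded_subset_cbox_symmetric[OF compact_imp_bounded])
  have supp: "f (x + t *\<^sub>R e) = 0" if "x \<notin> cbox (-a) a" "t \<in> {-1..1}" for x t
  proof (rule K(2))
    show "x + t *\<^sub>R e \<notin> K"
    proof
      assume "x + t *\<^sub>R e \<in> K"
      then have "x \<in> L" using that(2) unfolding L_def by (intro image_eqI[of _ _ "(x + t *\<^sub>R e, t)"]) auto
      then show False using a that(1) by auto
    qed
  qed
  let ?I = "\<lambda>t. integral (cbox (-a) a) (\<lambda>x. f (x + t *\<^sub>R e))"
  have const: "?I t = ?I 0" if t: "t \<in> {-1..1}" for t
  proof -
    have "?I t = integral UNIV (\<lambda>x. f (x + t *\<^sub>R e))"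
      using supp[OF _ t] by (rule integral_eq_on_support)
    also have "\<dots> = integral (cbox (-a - t *\<^sub>R e) (a - t *\<^sub>R e)) (\<lambda>x. f (x + t *\<^sub>R e))"
    proof (rule integral_eq_on_support[symmetric])
      fix x assume "x \<notin> cbox (-a - t *\<^sub>R e) (a - t *\<^sub>R e)"
      then have "x + t *\<^sub>R e \<notin> cbox (-a) a" by (auto simp: mem_box algebra_simps)
      then show "f (x + t *\<^sub>R e) = 0" using supp[of "x + t *\<^sub>R e" 0] by simp
    qed
    also have "\<dots> = integral (cbox (-a) a) f" by (rule integral_shift_cbox)
    finally show ?thesis by simp
  qed
  have der: "(?I has_vector_derivative integral (cbox (-a) a) (\<lambda>x. dir_deriv f (x + 0 *\<^sub>R e) e)) (at 0 within {-1<..<1})"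
  proof (rule leibniz_rule_vector_derivative)
    fix t :: real and x
    have "((\<lambda>t. f (x + t *\<^sub>R e)) has_derivative (\<lambda>s. dir_deriv f (x + t *\<^sub>R e) (s *\<^sub>R e))) (at t within {-1<..<1})"
      by (rule has_derivative_compose[where f="\<lambda>t. x + t *\<^sub>R e" and g=f, OF _ fd]) (auto intro!: derivative_eq_intros)
    then show "((\<lambda>t. f (x + t *\<^sub>R e)) has_vector_derivative dir_deriv f (x + t *\<^sub>R e) e) (at t within {-1<..<1})"
      unfolding has_vector_derivative_def
      by (rule has_derivative_eq_rhs) (simp add: linear_cmul[OF has_derivative_linear[OF fd]] fun_eq_iff)
  next
    show "(\<lambda>x. f (x + t *\<^sub>R e)) integrable_on cbox (-a) a" for t
      by (intro integrable_continuous continuous_on_compose2[OF f0] continuous_intros) auto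
    show "continuous_on ({-1<..<1} \<times> cbox (-a) a) (\<lambda>(t, x). dir_deriv f (x + t *\<^sub>R e) e)"
      unfolding split_beta by (intro continuous_on_compose2[OF cont] continuous_intros) auto
  qed auto
  have "(?I has_vector_derivative 0) (at 0 within {-1<..<1})"
    by (rule has_vector_derivative_transform[OF _ _ has_vector_derivative_const[of "?I 0"]])
       (auto simp: const[simplified])
  then have "integral (cbox (-a) a) (\<lambda>x. dir_deriv f (x + 0 *\<^sub>R e) e) = 0"
    using der at_within_open[of "0::real" "{-1<..<1}"] vector_derivative_unique_at by auto
  moreover have "integral (cbox (-a) a) (\<lambda>x. dir_deriv f x e) = integral UNIV (\<lambda>x. dir_deriv f x e)"
  proof (rule integral_eq_on_support)
    fix x assume x: "x \<notin> cbox (-a) a"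
    have "dir_deriv f x = dir_deriv (\<lambda>_. 0) x"
      by (rule dir_deriv_cong[of "- cbox (-a) a"]) (use x supp[of _ 0] in \<open>auto simp: open_Compl\<close>)
    then show "dir_deriv f x e = 0" by simp
  qed
  ultimately show ?thesis by simp
qed

lemma integral_change_of_variables:
  fixes \<phi> :: "real^'n::{finite,wellorder} \<Rightarrow> real^'n::_" and h :: "real^'n::_ \<Rightarrow> real"
  assumes S: "open S" and \<phi>: "\<And>x. x \<in> S \<Longrightarrow> (\<phi> has_derivative \<phi>' x) (at x)" "inj_on \<phi> S"
    and h: "h absolutely_integrable_on \<phi> ` S"
  shows "integral S (\<lambda>x. \<bar>det (matrix (\<phi>' x))\<bar> * h (\<phi> x)) = integral (\<phi> ` S) h"
proof -
  \<comment> \<open>real values are identified with vectors in \<open>\<real>\<^sup>1\<close>\<close>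
  let ?L = "\<lambda>r::real. r *\<^sub>R axis (1::1) (1::real)" and ?c = "\<lambda>v. v \<bullet> axis (1::1) (1::real)"
  have L: "bounded_linear ?L" by (rule bounded_linear_scaleR_left)
  have c: "bounded_linear ?c" by (rule bounded_linear_inner_left)
  have cL: "?c (?L r) = r" for r by (simp add: inner_axis)
  have "(\<lambda>x. ?L (h x)) absolutely_integrable_on \<phi> ` S"
    using absolutely_integrable_linear[OF h L] by (simp add: o_def)
  then have *: "(\<lambda>x. \<bar>det (matrix (\<phi>' x))\<bar> *\<^sub>R ?L (h (\<phi> x))) absolutely_integrable_on S"
    "integral S (\<lambda>x. \<bar>det (matrix (\<phi>' x))\<bar> *\<^sub>R ?L (h (\<phi> x))) = integral (\<phi> ` S) (\<lambda>x. ?L (h x))"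
    using has_absolute_integral_change_of_variables[of S \<phi> \<phi>' "\<lambda>x. ?L (h x)" "integral (\<phi> ` S) (\<lambda>x. ?L (h x))"]
      S \<phi> by (auto simp: has_derivative_at_withinI lborelD)
  have "integral S (?c \<circ> (\<lambda>x. \<bar>det (matrix (\<phi>' x))\<bar> *\<^sub>R ?L (h (\<phi> x)))) =
     ?c (integral S (\<lambda>x. \<bar>det (matrix (\<phi>' x))\<bar> *\<^sub>R ?L (h (\<phi> x))))"
    by (rule integral_linear[OF set_lebesgue_integral_eq_integral(1)[OF *(1)] c])
  also have "\<dots> = ?c (integral (\<phi> ` S) (?L \<circ> h))" using *(2) by (simp add: o_def)
  also have "\<dots> = integral (\<phi> ` S) h"
    by (subst integral_linear[OF set_lebesgue_integral_eq_integral(1)[OF h] L]) (rule cL)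
  finally show ?thesis by (simp add: o_def inner_axis)
qed

lemma has_derivative_square_of_positive_part:
  "((\<lambda>t::real. (max 0 t)\<^sup>2) has_real_derivative 2 * max 0 t) (at t)"
proof (cases t "0::real" rule: linorder_cases)
  case less
  have "((\<lambda>t::real. 0) has_real_derivative 2 * max 0 t) (at t)" using less by simp
  then show ?thesis
    by (rule has_field_derivative_transform_within_open[of _ _ _ "{..<0}"]) (use less in auto)
next
  case greater
  have "((\<lambda>t::real. t\<^sup>2) has_real_derivative 2 * max 0 t) (at t)"
    using greater by (auto intro!: derivative_eq_intros)
  then show ?thesis
    by (rule has_field_derivative_transform_within_open[of _ _ _ "{0<..}"]) (use greater in auto)
next
  case equal
  have "(\<lambda>h::real. (max 0 h)\<^sup>2 / h) \<midarrow>0\<rightarrow> 0"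
  proof (rule Lim_null_comparison)
    show "\<forall>\<^sub>F h::real in at 0. norm ((max 0 h)\<^sup>2 / h) \<le> \<bar>h\<bar>"
      by (rule always_eventually) (auto simp: max_def power2_eq_square)
    show "((\<lambda>h::real. \<bar>h\<bar>) \<longlongrightarrow> 0) (at 0)" by (intro tendsto_rabs_zero tendsto_ident_at)
  qed
  then show ?thesis using equal by (simp add: DERIV_def)
qed

lemma k_smooth_on_square_of_positive_part: "k_smooth_on 1 S (\<lambda>t::real. (max 0 t)\<^sup>2)"
proof -
  have D: "dir_deriv (\<lambda>t::real. (max 0 t)\<^sup>2) t = (*) (2 * max 0 t)" for t :: real
    using has_derivative_square_of_positive_part[of t] unfolding has_field_derivative_def
    by (rule dir_deriv_eqI)
  have "(\<lambda>t::real. (max 0 t)\<^sup>2) differentiable (at t)" for t :: real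
    using has_derivative_square_of_positive_part[of t] real_differentiable_def by blast
  then show ?thesis by (auto simp: D intro!: continuous_intros)
qed

locale closed_atlas = atlas M A
  for M :: "'a topology" and A :: "('a, 'n::{finite,wellorder}) chart set" +
  assumes compact: "compact_space M" and hausdorff: "Hausdorff_space M"
begin

lemma compact_coord_image:
  assumes "c \<in> A" "compactin M K" "K \<subseteq> cdom c"
  shows "compact (coord c ` K)"
proof -
  have "compactin (subtopology M (cdom c)) K"
    using assms cdom_subset by (simp add: compactin_subtopology)
  from image_compactin[OF this continuous_map_coord[OF assms(1)]] show ?thesis by simp
qed

text \<open>In a chart around \<open>p\<close> with coordinates \<open>x\<^sub>0\<close> the function \<open>(max 0 (r\<^sup>2 - \<bar>x - x\<^sub>0\<bar>\<^sup>2))\<^sup>2\<close> is of class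
  \<open>C\<^sup>1\<close>, which is all that the divergence theorem asks of a partition of unity.\<close>

lemma bump_function:
  assumes p: "p \<in> topspace M"
  obtains c K and b :: "'a \<Rightarrow> real" where "c \<in> A" "compactin M K" "K \<subseteq> cdom c"
    "\<And>q. b q \<ge> 0" "\<And>q. q \<notin> K \<Longrightarrow> b q = 0" "\<And>c'. c' \<in> A \<Longrightarrow> k_smooth_on 1 (cran c') (b \<circ> cinv c')"
    "\<exists>U. openin M U \<and> p \<in> U \<and> (\<forall>q\<in>U. b q > 0)"
proof -
  obtain c where c: "c \<in> A" "p \<in> cdom c" by (rule topspace_covered[OF p])
  define x0 where "x0 = coord c p"
  obtain r where r: "r > 0" "cball x0 r \<subseteq> cran c"
    using open_contains_cball[of "cran c"] chartD(2)[OF c(1)] c(2) unfolding x0_def by blast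
  define h where "h x = (max 0 (r\<^sup>2 - (x - x0) \<bullet> (x - x0)))\<^sup>2" for x
  define b where "b q = (if q \<in> cdom c then h (coord c q) else 0)" for q
  define K where "K = cinv c ` cball x0 r"
  have hz: "h x = 0" if "x \<notin> cball x0 r" for x
  proof -
    have "r\<^sup>2 < (norm (x - x0))\<^sup>2"
      using that r(1) by (intro power_strict_mono) (auto simp: dist_norm norm_minus_commute)
    then show ?thesis by (simp add: h_def power2_norm_eq_inner)
  qed
  have hp: "h x > 0" if "x \<in> ball x0 r" for x
  proof -
    have "(norm (x - x0))\<^sup>2 < r\<^sup>2"
      using that r(1) by (intro power_strict_mono) (auto simp: dist_norm norm_minus_commute)
    then show ?thesis by (simp add: h_def power2_norm_eq_inner)
  qed
  have hs: "k_smooth_on 1 S h" if "open S" for S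
    unfolding h_def
    by (rule k_smooth_on_compose[OF that subset_UNIV k_smooth_on_square_of_positive_part],
        rule smooth_onD, intro smooth_on_diff smooth_on_inner smooth_on_const smooth_on_id that)
  have "compactin (top_of_set (cran c)) (cball x0 r)"
    using r(2) by (simp add: compactin_subtopology)
  from image_compactin[OF this continuous_map_cinv[OF c(1)]] have Kc: "compactin M K"
    by (simp add: K_def)
  have Ks: "K \<subseteq> cdom c" using r(2) cinv_in unfolding K_def by blast
  have K0: "b q = 0" if "q \<notin> K" for q
  proof (cases "q \<in> cdom c")
    case True
    then have "coord c q \<notin> cball x0 r"
      using that cinv_coord[OF c(1) True] unfolding K_def by (metis image_eqI)
    then show ?thesis by (simp add: b_def hz)
  qed (simp add: b_def)
  have sm: "k_smooth_on 1 (cran c') (b \<circ> cinv c')" if c': "c' \<in> A" for c'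
  proof -
    let ?W = "cimg c' (topspace M - K)"
    have oW: "open ?W"
      using compactin_imp_closedin[OF hausdorff Kc] by (intro open_cimg[OF c']) (rule openin_diff[OF openin_topspace])
    have "k_smooth_on 1 (cran c) (b \<circ> cinv c)"
      by (rule k_smooth_on_cong[OF chartD(2)[OF c(1)] _ hs[OF chartD(2)[OF c(1)]]])
         (simp add: b_def cinv_in coord_cinv)
    moreover have "trans_map c' c ` cimg c' (cdom c) \<subseteq> cran c"
      using trans_map_in(2)[OF c' c(1)] by blast
    ultimately have "k_smooth_on 1 (cimg c' (cdom c)) (b \<circ> cinv c')"
      using k_smooth_on_trans[OF c' c(1) open_overlap[OF c' c(1)] subset_refl] by metis
    moreover have "k_smooth_on 1 ?W (b \<circ> cinv c')"
      by (rule k_smooth_on_cong[OF oW _ k_smooth_on_const[of _ _ 0]]) (use K0 mem_cimg[OF c'] in auto)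
    ultimately have "k_smooth_on 1 (cimg c' (cdom c) \<union> ?W) (b \<circ> cinv c')"
      by (rule k_smooth_on_Un[OF open_overlap[OF c' c(1)] oW])
    moreover have "cimg c' (cdom c) \<union> ?W = cran c'"
      using Ks cdom_subset[OF c'] by (auto simp: cimg_def)
    ultimately show ?thesis by simp
  qed
  have U: "openin M (cinv c ` ball x0 r)"
    by (rule openin_cinv_image[OF c(1)]) (use r(2) in auto)
  have "x0 \<in> ball x0 r" using r(1) by simp
  then have pU: "p \<in> cinv c ` ball x0 r"
    by (rule rev_image_eqI) (simp add: x0_def cinv_coord[OF c])
  have "b q > 0" if q: "q \<in> cinv c ` ball x0 r" for q
  proof -
    obtain x where x: "x \<in> ball x0 r" "q = cinv c x" using q by auto
    then have "x \<in> cran c" using r(2) by auto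
    then show ?thesis using x hp by (simp add: b_def cinv_in coord_cinv)
  qed
  then have exU: "\<exists>U. openin M U \<and> p \<in> U \<and> (\<forall>q\<in>U. b q > 0)" using U pU by blast
  have "b q \<ge> 0" for q by (simp add: b_def h_def)
  then show ?thesis using that[OF c(1) Kc Ks _ K0 sm exU] by blast
qed

lemma partition_of_unity:
  obtains P :: "'a set" and cc :: "'a \<Rightarrow> ('a, 'n) chart" and K and \<rho> :: "'a \<Rightarrow> 'a \<Rightarrow> real" where
    "finite P" "\<And>i. i \<in> P \<Longrightarrow> cc i \<in> A" "\<And>i. i \<in> P \<Longrightarrow> compactin M (K i)"
    "\<And>i. i \<in> P \<Longrightarrow> K i \<subseteq> cdom (cc i)" "\<And>i q. i \<in> P \<Longrightarrow> \<rho> i q \<ge> 0"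
    "\<And>i q. i \<in> P \<Longrightarrow> q \<notin> K i \<Longrightarrow> \<rho> i q = 0"
    "\<And>i c. i \<in> P \<Longrightarrow> c \<in> A \<Longrightarrow> k_smooth_on 1 (cran c) (\<rho> i \<circ> cinv c)"
    "\<And>q. q \<in> topspace M \<Longrightarrow> (\<Sum>i\<in>P. \<rho> i q) = 1"
proof -
  have "\<forall>p\<in>topspace M. \<exists>c K b. c \<in> A \<and> compactin M K \<and> K \<subseteq> cdom c \<and> (\<forall>q. b q \<ge> (0::real)) \<and>
    (\<forall>q. q \<notin> K \<longrightarrow> b q = 0) \<and> (\<forall>c'\<in>A. k_smooth_on 1 (cran c') (b \<circ> cinv c')) \<and>
    (\<exists>U. openin M U \<and> p \<in> U \<and> (\<forall>q\<in>U. b q > 0))"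
    by (intro ballI, erule bump_function) blast
  then obtain cc K b where b: "\<And>p. p \<in> topspace M \<Longrightarrow> cc p \<in> A \<and> compactin M (K p) \<and> K p \<subseteq> cdom (cc p) \<and>
    (\<forall>q. b p q \<ge> (0::real)) \<and> (\<forall>q. q \<notin> K p \<longrightarrow> b p q = 0) \<and> (\<forall>c'\<in>A. k_smooth_on 1 (cran c') (b p \<circ> cinv c')) \<and>
    (\<exists>U. openin M U \<and> p \<in> U \<and> (\<forall>q\<in>U. b p q > 0))"
    by metis
  then have "\<forall>p\<in>topspace M. \<exists>U. openin M U \<and> p \<in> U \<and> (\<forall>q\<in>U. b p q > 0)" by blast
  then obtain U where U: "\<And>p. p \<in> topspace M \<Longrightarrow> openin M (U p) \<and> p \<in> U p \<and> (\<forall>q\<in>U p. b p q > 0)"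
    by metis
  have "\<exists>\<F>. finite \<F> \<and> \<F> \<subseteq> U ` topspace M \<and> topspace M \<subseteq> \<Union>\<F>"
    using compact U unfolding compact_space_def by (intro compactinD) auto
  then obtain P where P: "finite P" "P \<subseteq> topspace M" "topspace M \<subseteq> \<Union>(U ` P)"
    by (metis finite_subset_image)
  define s where "s q = (\<Sum>i\<in>P. b i q)" for q
  have s: "s q > 0" if q: "q \<in> topspace M" for q
  proof -
    obtain i where i: "i \<in> P" "q \<in> U i" using P(3) q by auto
    have "b i q > 0" using U i P(2) by blast
    also have "b i q \<le> s q"
      unfolding s_def using b P by (intro member_le_sum i) auto
    finally show ?thesis .
  qed
  have ssm: "k_smooth_on 1 (cran c) (\<lambda>x. s (cinv c x))" if "c \<in> A" for c
    unfolding s_def using b P(2) that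
    by (intro k_smooth_on_sum chartD(2)[OF that]) (auto simp: o_def subset_iff)
  show ?thesis
  proof (rule that[of P cc K "\<lambda>i q. b i q * inverse (s q)"])
    fix i assume i: "i \<in> P"
    then have iM: "i \<in> topspace M" using P(2) by auto
    show "b i q * inverse (s q) \<ge> 0" for q
      using b[OF iM] b P(2) unfolding s_def
      by (intro mult_nonneg_nonneg, blast) (auto intro!: sum_nonneg simp: subset_iff)
    show "k_smooth_on 1 (cran c) ((\<lambda>q. b i q * inverse (s q)) \<circ> cinv c)" if c: "c \<in> A" for c
    proof -
      have "k_smooth_on 1 (cran c) (\<lambda>x. b i (cinv c x))" using b[OF iM] c by (simp add: o_def)
      moreover have "s (cinv c x) \<noteq> 0" if "x \<in> cran c" for x
        using s[of "cinv c x"] cinv_in[OF that] cdom_subset[OF c] by auto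
      ultimately show ?thesis
        unfolding o_def
        using k_smooth_on_mult[OF chartD(2)[OF c] _ k_smooth_on_inverse[OF chartD(2)[OF c] _ ssm[OF c]]] by blast
    qed
  next
    fix q assume "q \<in> topspace M"
    then show "(\<Sum>i\<in>P. b i q * inverse (s q)) = 1"
      using s[of q] by (simp add: sum_distrib_right[symmetric] s_def[symmetric])
  next
    show "cc i \<in> A" "compactin M (K i)" "K i \<subseteq> cdom (cc i)" if "i \<in> P" for i
      using that P(2) b by blast+
    show "b i q * inverse (s q) = 0" if "i \<in> P" "q \<notin> K i" for i q
    proof -
      have "b i q = 0" using that P(2) b by blast
      then show ?thesis by simp
    qed
  qed (rule P)
qed

end

locale volume_atlas = closed_atlas M A
  for M :: "'a topology" and A :: "('a, 'n::{finite,wellorder}) chart set" +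
  fixes \<sigma>
  assumes smooth_volume: "c \<in> A \<Longrightarrow> smooth_on (cran c) (\<sigma> c)"
    and volume_pos: "c \<in> A \<Longrightarrow> x \<in> cran c \<Longrightarrow> \<sigma> c x > 0"
    and volume_trans: "c \<in> A \<Longrightarrow> c' \<in> A \<Longrightarrow> x \<in> cimg c (cdom c') \<Longrightarrow>
      \<sigma> c x = \<bar>det (matrix (dtrans c c' x))\<bar> * \<sigma> c' (trans_map c c' x)"
begin

text \<open>Continuity is tested in charts, since integrals are computed there.\<close>

definition cont :: "('a \<Rightarrow> real) \<Rightarrow> bool" where
  "cont f \<longleftrightarrow> (\<forall>c\<in>A. continuous_on (cran c) (f \<circ> cinv c))"

definition supported_in :: "('a, 'n) chart \<Rightarrow> ('a \<Rightarrow> real) \<Rightarrow> bool" where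
  "supported_in c f \<longleftrightarrow> (\<exists>K. compactin M K \<and> K \<subseteq> cdom c \<and> (\<forall>p. p \<notin> K \<longrightarrow> f p = 0))"

text \<open>Extension by zero turns every integral over a chart into an integral over the whole of \<open>\<real>\<^sup>n\<close>.\<close>

definition zero_ext :: "('a, 'n) chart \<Rightarrow> ('a \<Rightarrow> real) \<Rightarrow> real^'n::_ \<Rightarrow> real" where
  "zero_ext c f x = (if x \<in> cran c then \<sigma> c x * f (cinv c x) else 0)"

definition vol_integral :: "('a, 'n) chart \<Rightarrow> ('a \<Rightarrow> real) \<Rightarrow> real" where
  "vol_integral c f = integral UNIV (zero_ext c f)"

lemma cont_mult: "cont f \<Longrightarrow> cont h \<Longrightarrow> cont (\<lambda>p. f p * h p)"
  by (auto simp: cont_def o_def intro: continuous_on_mult)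

lemma supported_in_mult: "supported_in c f \<Longrightarrow> supported_in c (\<lambda>p. f p * h p)" "supported_in c f \<Longrightarrow> supported_in c (\<lambda>p. h p * f p)"
  by (auto simp: supported_in_def)

lemma compact_support_in_chart:
  assumes c: "c \<in> A" and f: "supported_in c f"
  obtains L where "compact L" "L \<subseteq> cran c" "\<And>x. x \<in> cran c \<Longrightarrow> x \<notin> L \<Longrightarrow> f (cinv c x) = 0"
proof -
  obtain K where K: "compactin M K" "K \<subseteq> cdom c" "\<And>p. p \<notin> K \<Longrightarrow> f p = 0"
    using f by (auto simp: supported_in_def)
  have "f (cinv c x) = 0" if "x \<in> cran c" "x \<notin> coord c ` K" for x
    using that K(3) by (metis coord_cinv image_eqI)
  then show ?thesis using that[OF compact_coord_image[OF c K(1,2)]] K(2) by blast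
qed

lemma zero_ext_integrable:
  assumes c: "c \<in> A" and f: "cont f" "supported_in c f"
  shows "continuous_on UNIV (zero_ext c f)" "zero_ext c f absolutely_integrable_on UNIV" "zero_ext c f integrable_on UNIV"
proof -
  obtain L where L: "compact L" "L \<subseteq> cran c" "\<And>x. x \<in> cran c \<Longrightarrow> x \<notin> L \<Longrightarrow> f (cinv c x) = 0"
    using compact_support_in_chart[OF c f(2)] by metis
  have "k_smooth_on 0 (cran c) (\<lambda>x. \<sigma> c x * f (cinv c x))"
    using smooth_on_imp_continuous[OF smooth_volume[OF c]] f(1) c by (auto simp: cont_def o_def intro!: continuous_on_mult)
  from k_smooth_on_zero_extension[OF chartD(2)[OF c] this L(1,2)] L(3)
  show 1: "continuous_on UNIV (zero_ext c f)" unfolding zero_ext_def by auto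
  show 2: "zero_ext c f absolutely_integrable_on UNIV"
    by (rule absolutely_integrable_compact_support[OF 1 L(1)]) (use L(3) in \<open>auto simp: zero_ext_def\<close>)
  show "zero_ext c f integrable_on UNIV" by (rule set_lebesgue_integral_eq_integral(1)[OF 2])
qed

lemma vol_integral_sum:
  assumes "c \<in> A" "finite I" "\<And>i. i \<in> I \<Longrightarrow> cont (f i)" "\<And>i. i \<in> I \<Longrightarrow> supported_in c (f i)"
  shows "vol_integral c (\<lambda>p. \<Sum>i\<in>I. f i p) = (\<Sum>i\<in>I. vol_integral c (f i))"
proof -
  have "zero_ext c (\<lambda>p. \<Sum>i\<in>I. f i p) = (\<lambda>x. \<Sum>i\<in>I. zero_ext c (f i) x)"
    by (auto simp: zero_ext_def fun_eq_iff sum_distrib_left)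
  then show ?thesis
    unfolding vol_integral_def using integral_sum[OF assms(2) zero_ext_integrable(3)[OF assms(1,3,4)]] by simp
qed

lemma vol_integral_cong:
  assumes "c \<in> A" "\<And>p. p \<in> topspace M \<Longrightarrow> f p = h p"
  shows "vol_integral c f = vol_integral c h"
proof -
  have "zero_ext c f = zero_ext c h"
    using assms(2) cinv_in subsetD[OF cdom_subset[OF assms(1)]] by (auto simp: zero_ext_def fun_eq_iff)
  then show ?thesis by (simp add: vol_integral_def)
qed

lemma vol_integral_indep_of_chart:
  assumes c: "c \<in> A" "c' \<in> A" and f: "cont f" "supported_in c f" "supported_in c' f"
  shows "vol_integral c f = vol_integral c' f"
proof -
  let ?S = "cimg c (cdom c')" and ?S' = "cimg c' (cdom c)"
  have z: "zero_ext c f x = 0" if "supported_in c' f" "x \<notin> cimg c (cdom c')" "c \<in> A" for c c' x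
    using that by (auto simp: zero_ext_def supported_in_def mem_cimg)
  note z' = z[OF f(3) _ c(1)] z[OF f(2) _ c(2)]
  have "(\<lambda>x. if x \<in> ?S' then zero_ext c' f x else 0) = zero_ext c' f" using z'(2) by auto
  then have "zero_ext c' f absolutely_integrable_on trans_map c c' ` ?S"
    using zero_ext_integrable(2)[OF c(2) f(1,3)] absolutely_integrable_restrict_UNIV[of ?S' "zero_ext c' f"]
    by (simp add: trans_map_cimg[OF c])
  from integral_change_of_variables[OF open_overlap[OF c] trans_map_has_derivative[OF c] inj_on_trans_map[OF c] this]
  have "integral ?S (\<lambda>x. \<bar>det (matrix (dtrans c c' x))\<bar> * zero_ext c' f (trans_map c c' x)) = integral ?S' (zero_ext c' f)"
    by (simp add: trans_map_cimg[OF c])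
  moreover have "integral ?S (\<lambda>x. \<bar>det (matrix (dtrans c c' x))\<bar> * zero_ext c' f (trans_map c c' x)) = integral ?S (zero_ext c f)"
  proof (rule integral_cong)
    fix x assume x: "x \<in> ?S"
    have "x \<in> cran c" using x cimg_subset by blast
    then show "\<bar>det (matrix (dtrans c c' x))\<bar> * zero_ext c' f (trans_map c c' x) = zero_ext c f x"
      using trans_map_in(2)[OF c x] by (simp add: zero_ext_def volume_trans[OF c x] cinv_trans_map[OF c x])
  qed
  moreover have "integral ?S (zero_ext c f) = vol_integral c f" "integral ?S' (zero_ext c' f) = vol_integral c' f"
    unfolding vol_integral_def by (rule integral_eq_on_support, erule z')+
  ultimately show ?thesis by simp
qed

lemma vol_integral_nonneg:
  assumes "c \<in> A" "cont f" "supported_in c f" "\<And>p. p \<in> topspace M \<Longrightarrow> f p \<ge> 0"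
  shows "vol_integral c f \<ge> 0" "vol_integral c f = 0 \<Longrightarrow> p \<in> cdom c \<Longrightarrow> f p = 0"
proof -
  let ?h = "zero_ext c f"
  note hc = zero_ext_integrable(1)[OF assms(1-3)] and hi = zero_ext_integrable(3)[OF assms(1-3)]
  have h: "?h x \<ge> 0" for x
  proof (cases "x \<in> cran c")
    case True
    then have "cinv c x \<in> topspace M" using cinv_in cdom_subset[OF assms(1)] by blast
    then show ?thesis using volume_pos[OF assms(1) True] assms(4) by (simp add: zero_ext_def)
  qed (simp add: zero_ext_def)
  show "vol_integral c f \<ge> 0" unfolding vol_integral_def by (rule integral_nonneg[OF hi h])
  assume 0: "vol_integral c f = 0" and p: "p \<in> cdom c"
  obtain a where a: "coord c p \<in> box (-a) a"
    using bounded_subset_box_symmetric[of "{coord c p}"] by auto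
  have i: "?h integrable_on cbox (-a) a"
    by (rule integrable_continuous[OF continuous_on_subset[OF hc]]) simp
  have "integral (cbox (-a) a) ?h \<le> 0"
    using integral_subset_le[OF subset_UNIV i hi ballI[OF h]] 0 by (simp add: vol_integral_def)
  then have "integral (cbox (-a) a) ?h = 0" using integral_nonneg[OF i h] by (rule antisym)
  with integrable_integral[OF i] have "(?h has_integral 0) (cbox (-a) a)" by (rule back_subst)
  then have "?h (coord c p) = 0"
    using a box_subset_cbox[of "-a" a] h
    by (intro has_integral_0_cbox_imp_0[where a="-a" and b=a] continuous_on_subset[OF hc]) auto
  then show "f p = 0"
    using p volume_pos[OF assms(1), of "coord c p"] by (simp add: zero_ext_def cinv_coord[OF assms(1)])
qed

text \<open>The derivative of \<open>\<rho>\<close> along \<open>X\<close>, as a function on the manifold. A chart is chosen at each point; the result does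
  not depend on it.\<close>

definition field_deriv :: "('a, 'n) vfield \<Rightarrow> ('a \<Rightarrow> real) \<Rightarrow> 'a \<Rightarrow> real" where
  "field_deriv X \<rho> p = (if p \<in> topspace M then tangent_map \<rho> (chart_at p) (coord (chart_at p) p)
      (X (chart_at p) (coord (chart_at p) p)) else 0)"

lemma field_deriv_in_chart:
  assumes X: "vector_field_on A (topspace M) X" and \<rho>: "\<And>c. c \<in> A \<Longrightarrow> k_smooth_on 1 (cran c) (\<rho> \<circ> cinv c)"
    and c: "c \<in> A" and x: "x \<in> cran c"
  shows "field_deriv X \<rho> (cinv c x) = tangent_map \<rho> c x (X c x)"
proof -
  let ?c = "chart_at (cinv c x)"
  have p: "cinv c x \<in> topspace M" using cinv_in[OF x] cdom_subset[OF c] by auto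
  note c' = chart_at[OF p]
  have x': "x \<in> cimg c (cdom ?c)" using c' x by (simp add: mem_cimg[OF c])
  have "(\<rho> \<circ> cinv ?c) differentiable (at (trans_map c ?c x))"
    using \<rho>[OF c'(1)] trans_map_in(2)[OF c c'(1) x'] by auto
  from tangent_map_trans[OF c c'(1) x' this] vector_field_trans[OF X c c'(1) x'] p
  show ?thesis by (simp add: field_deriv_def trans_map_def)
qed

text \<open>In a chart the divergence of \<open>\<rho> X\<close> is the ordinary divergence of \<open>\<sigma> \<rho> X\<close>, divided by \<open>\<sigma>\<close>.\<close>

lemma vol_integral_divergence:
  assumes X: "vector_field_on A (topspace M) X"
    and q: "\<And>c x. c \<in> A \<Longrightarrow> x \<in> cran c \<Longrightarrow>
      (\<Sum>i\<in>UNIV. dir_deriv (\<lambda>y. \<sigma> c y * X c y $ i) x (axis i 1)) = - \<sigma> c x * q (cinv c x)"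
    and \<rho>: "\<And>c. c \<in> A \<Longrightarrow> k_smooth_on 1 (cran c) (\<rho> \<circ> cinv c)" "supported_in c \<rho>" and c: "c \<in> A"
  shows "vol_integral c (\<lambda>p. field_deriv X \<rho> p - \<rho> p * q p) = 0"
proof -
  let ?F = "\<lambda>l x. if x \<in> cran c then (\<rho> \<circ> cinv c) x * (\<sigma> c x * X c x $ l) else 0"
  note oc = chartD(2)[OF c]
  obtain L where L: "compact L" "L \<subseteq> cran c" and out: "\<And>x. x \<in> cran c \<Longrightarrow> x \<notin> L \<Longrightarrow> \<rho> (cinv c x) = 0"
    using compact_support_in_chart[OF c \<rho>(2)] by metis
  have prod: "smooth_on (cran c) (\<lambda>x. \<sigma> c x * X c x $ l)" for l
    using vector_field_smooth[OF X c] cimg_topspace[OF c]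
    by (intro smooth_on_mult[OF oc smooth_volume[OF c] smooth_on_vec_nth[OF oc]]) simp
  have F: "k_smooth_on 1 UNIV (?F l)" for l
    by (rule k_smooth_on_zero_extension[OF oc k_smooth_on_mult[OF oc \<rho>(1)[OF c] smooth_onD[OF prod]] L]) (use out in auto)
  have F0: "?F l x = 0" if "x \<notin> L" for l x using out that by auto
  have DF0: "dir_deriv (?F l) x v = 0" if x: "x \<notin> L" for l x v
  proof -
    have "dir_deriv (?F l) x = dir_deriv (\<lambda>_. 0) x"
      by (rule dir_deriv_cong[of "- L"]) (use x F0 L(1) in \<open>auto simp: open_Compl compact_imp_closed\<close>)
    then show ?thesis by simp
  qed
  have int: "(\<lambda>x. dir_deriv (?F l) x v) integrable_on UNIV" for l v
    by (rule set_lebesgue_integral_eq_integral(1)[OF absolutely_integrable_compact_support[OF _ L(1) DF0]])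
       (use F[of l] in simp)
  have "(\<Sum>l\<in>UNIV. dir_deriv (?F l) x (axis l 1)) = zero_ext c (\<lambda>p. field_deriv X \<rho> p - \<rho> p * q p) x" for x
  proof (cases "x \<in> cran c")
    case False
    then have "x \<notin> L" using L(2) by blast
    then have "(\<Sum>l\<in>UNIV. dir_deriv (?F l) x (axis l 1)) = 0" by (intro sum.neutral ballI DF0)
    also have "0 = zero_ext c (\<lambda>p. field_deriv X \<rho> p - \<rho> p * q p) x" using False by (simp add: zero_ext_def)
    finally show ?thesis .
  next
    case x: True
    have \<rho>d: "(\<rho> \<circ> cinv c) differentiable (at x)" using \<rho>(1)[OF c] x by auto
    have "dir_deriv (?F l) x = (\<lambda>v. (\<rho> \<circ> cinv c) x * dir_deriv (\<lambda>y. \<sigma> c y * X c y $ l) x v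
         + dir_deriv (\<rho> \<circ> cinv c) x v * (\<sigma> c x * X c x $ l))" for l
      by (rule trans[OF dir_deriv_cong[OF oc x] dir_deriv_eqI[OF has_derivative_mult[OF has_dir_deriv[OF \<rho>d]
              smooth_on_has_derivative[OF prod x]]]]) simp
    then have "(\<Sum>l\<in>UNIV. dir_deriv (?F l) x (axis l 1)) =
        \<rho> (cinv c x) * (\<Sum>l\<in>UNIV. dir_deriv (\<lambda>y. \<sigma> c y * X c y $ l) x (axis l 1))
        + \<sigma> c x * (\<Sum>l\<in>UNIV. X c x $ l * dir_deriv (\<rho> \<circ> cinv c) x (axis l 1))"
      by (simp add: sum.distrib sum_distrib_left mult_ac)
    also have "(\<Sum>l\<in>UNIV. X c x $ l * dir_deriv (\<rho> \<circ> cinv c) x (axis l 1)) = field_deriv X \<rho> (cinv c x)"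
      using linear_axis_expansion[OF linear_frechet_derivative[OF \<rho>d], of "X c x"]
      by (simp add: field_deriv_in_chart[OF X \<rho>(1) c x] tangent_map_def)
    finally show ?thesis using x by (simp add: q[OF c x] zero_ext_def algebra_simps)
  qed
  then have "vol_integral c (\<lambda>p. field_deriv X \<rho> p - \<rho> p * q p) =
      (\<Sum>l\<in>UNIV. integral UNIV (\<lambda>x. dir_deriv (?F l) x (axis l 1)))"
    unfolding vol_integral_def by (subst integral_sum[OF _ int, symmetric]) (auto simp: fun_eq_iff[symmetric])
  then show ?thesis using integral_dir_deriv_compact_support[OF F L(1) F0] by simp
qed

text \<open>Here \<open>\<sigma>\<close> is the density of a volume, and \<open>q\<close> is minus the divergence of \<open>X\<close>. For a partition of unity
  \<open>1 = \<Sum>\<^sub>i \<rho>\<^sub>i\<close> subordinate to charts, the divergence \<open>X \<rho>\<^sub>i - \<rho>\<^sub>i q\<close> of \<open>\<rho>\<^sub>i X\<close> has integral zero. The sum over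
  \<open>i\<close> is \<open>X 1 - q = - q\<close>. So \<open>q\<close> has integral zero, and it is nonnegative.\<close>

theorem nonpositive_divergence_eq_0:
  assumes X: "vector_field_on A (topspace M) X"
    and q: "\<And>c x. c \<in> A \<Longrightarrow> x \<in> cran c \<Longrightarrow>
      (\<Sum>i\<in>UNIV. dir_deriv (\<lambda>y. \<sigma> c y * X c y $ i) x (axis i 1)) = - \<sigma> c x * q (cinv c x)"
    and q_nonneg: "\<And>p. p \<in> topspace M \<Longrightarrow> q p \<ge> 0"
    and p: "p \<in> topspace M"
  shows "q p = 0"
proof (rule partition_of_unity)
  fix P :: "'a set" and cc :: "'a \<Rightarrow> ('a, 'n) chart" and K and \<rho> :: "'a \<Rightarrow> 'a \<Rightarrow> real"
  assume P: "finite P" and cc: "\<And>i. i \<in> P \<Longrightarrow> cc i \<in> A"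
    and K: "\<And>i. i \<in> P \<Longrightarrow> compactin M (K i)" "\<And>i. i \<in> P \<Longrightarrow> K i \<subseteq> cdom (cc i)"
    and \<rho>: "\<And>i q. i \<in> P \<Longrightarrow> \<rho> i q \<ge> 0" "\<And>i q. i \<in> P \<Longrightarrow> q \<notin> K i \<Longrightarrow> \<rho> i q = 0"
      "\<And>i c. i \<in> P \<Longrightarrow> c \<in> A \<Longrightarrow> k_smooth_on 1 (cran c) (\<rho> i \<circ> cinv c)"
    and \<rho>_sum: "\<And>q. q \<in> topspace M \<Longrightarrow> (\<Sum>i\<in>P. \<rho> i q) = 1"
  let ?X = "\<lambda>i. field_deriv X (\<rho> i)"
  define f where "f i p = ?X i p - \<rho> i p * q p" for i p
  have X\<rho>: "?X i (cinv c x) = tangent_map (\<rho> i) c x (X c x)" if "i \<in> P" "c \<in> A" "x \<in> cran c" for i c x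
    by (rule field_deriv_in_chart[OF X \<rho>(3)[OF that(1)] that(2,3)])
  have \<rho>d: "(\<rho> i \<circ> cinv c) differentiable (at x)" if "i \<in> P" "c \<in> A" "x \<in> cran c" for i c x
    using \<rho>(3)[OF that(1,2)] that(3) by auto
  have Xs: "smooth_on (cran c) (X c)" if "c \<in> A" for c
    using vector_field_smooth[OF X that] cimg_topspace[OF that] by simp
  have supp: "supported_in (cc i) (\<rho> i)" if "i \<in> P" for i
    using K[OF that] \<rho>(2)[OF that] by (auto simp: supported_in_def)
  have X\<rho>0: "?X i p = 0" if i: "i \<in> P" and pK: "p \<notin> K i" for i p
  proof (cases "p \<in> topspace M")
    case True
    let ?W = "cimg (chart_at p) (topspace M - K i)"
    note c = chart_at[OF True]
    have "open ?W"
      using compactin_imp_closedin[OF hausdorff K(1)[OF i]] by (intro open_cimg c) (auto intro: openin_diff)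
    moreover have "coord (chart_at p) p \<in> ?W"
      using c True pK by (simp add: mem_cimg cinv_coord)
    ultimately have "dir_deriv (\<rho> i \<circ> cinv (chart_at p)) (coord (chart_at p) p) = dir_deriv (\<lambda>_. 0) (coord (chart_at p) p)"
      using \<rho>(2)[OF i] c by (intro dir_deriv_cong) (auto simp: mem_cimg)
    then show ?thesis by (simp add: field_deriv_def tangent_map_def)
  qed (simp add: field_deriv_def)
  have fsupp: "supported_in (cc i) (f i)" if "i \<in> P" for i
    using K[OF that] \<rho>(2)[OF that] X\<rho>0[OF that] by (auto simp: supported_in_def f_def)
  have X\<rho>_sum: "(\<Sum>i\<in>P. ?X i p) = 0" if pM: "p \<in> topspace M" for p
  proof -
    let ?c = "chart_at p" and ?x = "coord (chart_at p) p"
    have c: "?c \<in> A" "?x \<in> cran ?c" using chart_at[OF pM] by auto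
    have "dir_deriv (\<lambda>y. \<Sum>i\<in>P. (\<rho> i \<circ> cinv ?c) y) ?x = (\<lambda>v. \<Sum>i\<in>P. dir_deriv (\<rho> i \<circ> cinv ?c) ?x v)"
      by (rule dir_deriv_eqI[OF has_derivative_sum[OF has_dir_deriv[OF \<rho>d[OF _ c]]]])
    moreover have "dir_deriv (\<lambda>y. \<Sum>i\<in>P. (\<rho> i \<circ> cinv ?c) y) ?x = dir_deriv (\<lambda>_. 1) ?x"
      using \<rho>_sum cdom_subset[OF c(1)] cinv_in
      by (intro dir_deriv_cong[OF chartD(2)[OF c(1)] c(2)]) (auto simp: subset_iff)
    ultimately have "(\<Sum>i\<in>P. dir_deriv (\<rho> i \<circ> cinv ?c) ?x v) = 0" for v
      by (simp add: fun_eq_iff)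
    then show ?thesis using pM by (simp add: field_deriv_def tangent_map_def)
  qed
  have \<rho>c: "cont (\<rho> i)" if "i \<in> P" for i
    using k_smooth_on_imp_continuous[OF \<rho>(3)[OF that]] by (simp add: cont_def)
  have qc: "cont q"
    unfolding cont_def
  proof
    fix c assume c: "c \<in> A"
    let ?d = "\<lambda>x. \<Sum>i\<in>UNIV. dir_deriv (\<lambda>y. \<sigma> c y * X c y $ i) x (axis i 1)"
    have "smooth_on (cran c) (\<lambda>x. \<sigma> c x * X c x $ i)" for i
      by (rule smooth_on_mult[OF chartD(2)[OF c] smooth_volume[OF c] smooth_on_vec_nth[OF chartD(2)[OF c] Xs[OF c]]])
    then have "continuous_on (cran c) (\<lambda>x. - ?d x / \<sigma> c x)"
      using volume_pos[OF c] less_irrefl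
      by (intro continuous_intros smooth_on_imp_continuous[OF smooth_volume[OF c]]
          smooth_on_imp_continuous[OF smooth_on_dir_deriv]) force+
    then show "continuous_on (cran c) (q \<circ> cinv c)"
      by (rule continuous_on_eq) (use volume_pos[OF c] q[OF c] in \<open>auto simp: less_imp_neq[symmetric]\<close>)
  qed
  have fc: "cont (f i)" if i: "i \<in> P" for i
    unfolding cont_def
  proof
    fix c assume c: "c \<in> A"
    have "continuous_on (cran c) (\<lambda>x. tangent_map (\<rho> i) c x (X c x))"
      using k_smooth_on_dir_deriv_field[OF chartD(2)[OF c], of 0, OF _ smooth_onD[OF Xs[OF c]]] \<rho>(3)[OF i c]
      by (simp add: tangent_map_def)
    then have "continuous_on (cran c) (\<lambda>x. tangent_map (\<rho> i) c x (X c x) - (\<rho> i \<circ> cinv c) x * (q \<circ> cinv c) x)"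
      using \<rho>c[OF i] qc c by (intro continuous_on_diff continuous_on_mult) (auto simp: cont_def)
    then show "continuous_on (cran c) (f i \<circ> cinv c)"
      by (rule continuous_on_eq) (simp add: f_def X\<rho>[OF i c])
  qed
  \<comment> \<open>the integral over \<open>M\<close>; for functions supported in one chart it is the integral in that chart\<close>
  define I where "I h = (\<Sum>k\<in>P. vol_integral (cc k) (\<lambda>p. \<rho> k p * h p))" for h
  have If: "I (f i) = 0" if i: "i \<in> P" for i
  proof -
    have "I (f i) = (\<Sum>k\<in>P. vol_integral (cc i) (\<lambda>p. \<rho> k p * f i p))"
      unfolding I_def
      by (intro sum.cong vol_integral_indep_of_chart cont_mult supported_in_mult cc \<rho>c fc fsupp supp i refl)
    also have "\<dots> = vol_integral (cc i) (\<lambda>p. \<Sum>k\<in>P. \<rho> k p * f i p)"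
      by (intro vol_integral_sum[symmetric] cont_mult supported_in_mult cc P \<rho>c fc fsupp i)
    also have "\<dots> = vol_integral (cc i) (f i)"
      by (rule vol_integral_cong[OF cc[OF i]]) (simp add: sum_distrib_right[symmetric] \<rho>_sum)
    also have "\<dots> = 0"
      unfolding f_def by (rule vol_integral_divergence[OF X q \<rho>(3)[OF i] supp[OF i] cc[OF i]])
    finally show ?thesis .
  qed
  have "0 = (\<Sum>k\<in>P. \<Sum>i\<in>P. vol_integral (cc k) (\<lambda>p. \<rho> k p * f i p))"
    using If unfolding I_def by (subst sum.swap) simp
  also have "\<dots> = (\<Sum>k\<in>P. - vol_integral (cc k) (\<lambda>p. \<rho> k p * q p))"
  proof (rule sum.cong[OF refl])
    fix k assume k: "k \<in> P"
    have "(\<Sum>i\<in>P. vol_integral (cc k) (\<lambda>p. \<rho> k p * f i p)) = vol_integral (cc k) (\<lambda>p. \<Sum>i\<in>P. \<rho> k p * f i p)"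
      by (intro vol_integral_sum[symmetric] cont_mult supported_in_mult cc P \<rho>c fc supp k)
    also have "\<dots> = vol_integral (cc k) (\<lambda>p. - (\<rho> k p * q p))"
    proof (rule vol_integral_cong[OF cc[OF k]])
      fix p assume p: "p \<in> topspace M"
      have "(\<Sum>i\<in>P. f i p) = - q p"
        using X\<rho>_sum[OF p] \<rho>_sum[OF p] by (simp add: f_def sum_subtractf sum_distrib_right[symmetric])
      then show "(\<Sum>i\<in>P. \<rho> k p * f i p) = - (\<rho> k p * q p)" by (simp add: sum_distrib_left[symmetric])
    qed
    also have "zero_ext (cc k) (\<lambda>p. - (\<rho> k p * q p)) = (\<lambda>x. - zero_ext (cc k) (\<lambda>p. \<rho> k p * q p) x)"
      by (auto simp: zero_ext_def)
    then have "vol_integral (cc k) (\<lambda>p. - (\<rho> k p * q p)) = - vol_integral (cc k) (\<lambda>p. \<rho> k p * q p)"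
      by (simp add: vol_integral_def)
    finally show "(\<Sum>i\<in>P. vol_integral (cc k) (\<lambda>p. \<rho> k p * f i p)) = - vol_integral (cc k) (\<lambda>p. \<rho> k p * q p)" .
  qed
  finally have sum0: "(\<Sum>k\<in>P. vol_integral (cc k) (\<lambda>p. \<rho> k p * q p)) = 0" by (simp add: sum_negf)
  note nn = vol_integral_nonneg[OF cc cont_mult[OF \<rho>c qc] supported_in_mult(1)[OF supp] mult_nonneg_nonneg[OF \<rho>(1) q_nonneg]]
  have "\<exists>k\<in>P. \<rho> k p \<noteq> 0"
    using \<rho>_sum[OF p] by (metis sum.neutral zero_neq_one)
  then obtain k where k: "k \<in> P" "\<rho> k p \<noteq> 0" by blast
  have "vol_integral (cc k) (\<lambda>p. \<rho> k p * q p) = 0"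
    using sum0 nn(1) k(1) by (simp add: sum_nonneg_eq_0_iff[OF P])
  moreover have "p \<in> cdom (cc k)" using \<rho>(2)[OF k(1)] k(2) K(2)[OF k(1)] by blast
  ultimately have "\<rho> k p * q p = 0" using nn(2)[of k] k(1) by blast
  then show ?thesis using k(2) by simp
qed

end

section \<open>Riemannian flows on closed three-manifolds\<close>

lemma open_image_submersion:
  fixes h :: "'a::euclidean_space \<Rightarrow> 'b::euclidean_space"
  assumes S: "open S" and h: "smooth_on S h" and surj: "\<And>x. x \<in> S \<Longrightarrow> surj (dir_deriv h x)"
  shows "open (h ` S)"
proof -
  have "h x \<in> interior (h ` S)" if x: "x \<in> S" for x
  proof -
    obtain g' where g': "linear g'" "dir_deriv h x \<circ> g' = id"
      using linear_surjective_right_inverse[OF smooth_on_linear[OF h x] surj[OF x]] by blast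
    show ?thesis
      by (rule sussmann_open_mapping[OF S smooth_on_imp_continuous[OF h] x smooth_on_has_derivative[OF h x]
            _ g'(2) subset_refl]) (use x S g'(1) in \<open>auto simp: interior_open linear_conv_bounded_linear\<close>)
  qed
  then have "h ` S \<subseteq> interior (h ` S)" by blast
  then have "interior (h ` S) = h ` S" using interior_subset[of "h ` S"] by (rule subset_antisym[rotated])
  then show ?thesis by (simp add: interior_eq)
qed

locale riemannian_flow = closed_atlas M A
  for M :: "'a topology" and A :: "('a, 3) chart set" +
  fixes F :: "('a, 2) cocycle" and g :: "('a, 3) metric" and V :: "('a, 3) vfield"
  assumes foliation: "foliation M A F" and metric: "riemannian_metric A g"
    and bundle_like: "bundle_like M A F g" and unit_field: "unit_tangent_field M A F g V"
begin

lemma vertical_V: "vertical_field_on A F (topspace M) V"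
  using unit_field by (simp add: unit_tangent_field_def)

lemma vector_field_V: "vector_field_on A (topspace M) V"
  using vertical_V by (simp add: vertical_field_on_def)

lemma unit_field_chart3:
  assumes c: "c \<in> A"
  shows "unit_field_chart3 (cran c) (g c) (V c)"
proof unfold_locales
  show "open (cran c)" by (rule chartD(2)[OF c])
  show "smooth_on (cran c) (g c)" using metric c by (simp add: riemannian_metric_def)
  show "positive_definite (g c x)" if "x \<in> cran c" for x
    using metric c that unfolding riemannian_metric_def positive_definite_def by blast
  show "smooth_on (cran c) (V c)"
    using vector_field_smooth[OF vector_field_V c] by (simp add: cimg_topspace[OF c])
  show "inner_at (g c x) (V c x) (V c x) = 1" if "x \<in> cran c" for x
    using unit_field c that unfolding unit_tangent_field_def by blast
qed

lemma metric_trans: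
  assumes "c \<in> A" "c' \<in> A" "x \<in> cimg c (cdom c')"
  shows "inner_at (g c' (trans_map c c' x)) (dtrans c c' x u) (dtrans c c' x v) = inner_at (g c x) u v"
  using metric assms unfolding riemannian_metric_def by metis

lemma V_trans:
  assumes "c \<in> A" "c' \<in> A" "x \<in> cimg c (cdom c')"
  shows "dtrans c c' x (V c x) = V c' (trans_map c c' x)"
  using vector_field_trans[OF vector_field_V assms] by simp

lemma submersionD:
  assumes "(U, f) \<in> F"
  shows "openin M U" "c \<in> A \<Longrightarrow> smooth_on (cimg c U) (f \<circ> cinv c)"
    "c \<in> A \<Longrightarrow> x \<in> cimg c U \<Longrightarrow> surj (tangent_map f c x)"
proof -
  have "\<forall>(U, f)\<in>F. openin M U \<and> smooth_map_on A U f \<and> (\<forall>c\<in>A. \<forall>x\<in>cimg c U. surj (tangent_map f c x))"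
    using foliation unfolding foliation_def by (elim conjE)
  from bspec[OF this assms] show "openin M U" "c \<in> A \<Longrightarrow> smooth_on (cimg c U) (f \<circ> cinv c)"
    "c \<in> A \<Longrightarrow> x \<in> cimg c U \<Longrightarrow> surj (tangent_map f c x)"
    unfolding smooth_map_on_def case_prod_conv by simp_all
qed

lemma submersion_at:
  assumes "p \<in> topspace M"
  obtains U f where "(U, f) \<in> F" "p \<in> U"
proof -
  have "p \<in> (\<Union>(U, f)\<in>F. U)" using foliation assms unfolding foliation_def by simp
  then show ?thesis using that by (auto split: prod.splits)
qed

lemma submersion_derivative:
  assumes "(U, f) \<in> F" "c \<in> A" "x \<in> cimg c U"
  shows "((f \<circ> cinv c) has_derivative tangent_map f c x) (at x)" "linear (tangent_map f c x)"
  using smooth_on_has_derivative[OF submersionD(2)[OF assms(1,2)] assms(3)]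
  by (auto simp: tangent_map_def intro: has_derivative_linear)

lemma submersion_trans:
  assumes f: "(U, f) \<in> F" and c: "c \<in> A" "c' \<in> A" and x: "x \<in> cimg c (cdom c')" "x \<in> cimg c U"
  shows "tangent_map f c' (trans_map c c' x) (dtrans c c' x v) = tangent_map f c x v"
proof (rule tangent_map_trans[OF c x(1), symmetric])
  have "trans_map c c' x \<in> cimg c' U"
    using x trans_map_in[OF c x(1)] by (simp add: mem_cimg[OF c(1)] mem_cimg[OF c(2)] cinv_trans_map[OF c x(1)])
  then show "(f \<circ> cinv c') differentiable (at (trans_map c c' x))"
    by (rule smooth_on_differentiable[OF submersionD(2)[OF f c(2)]])
qed

lemma submersion_V:
  assumes "(U, f) \<in> F" "c \<in> A" "x \<in> cimg c U"
  shows "tangent_map f c x (V c x) = 0"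
proof -
  have x: "x \<in> cran c" "cinv c x \<in> U" using assms(3) by (simp_all add: mem_cimg[OF assms(2)])
  have "\<forall>c\<in>A. \<forall>x\<in>cimg c (topspace M). V c x \<in> vertical_space F c x"
    using vertical_V by (simp add: vertical_field_on_def)
  then have "V c x \<in> vertical_space F c x"
    using assms(2) x(1) cimg_topspace[OF assms(2)] by blast
  then have "\<forall>(U, f)\<in>F. cinv c x \<in> U \<longrightarrow> tangent_map f c x (V c x) = 0"
    by (simp add: vertical_space_def)
  from bspec[OF this assms(1)] x(2) show ?thesis by simp
qed

section \<open>Horizontal lifts and bundle-like metrics\<close>

text \<open>A local submersion together with the characteristic form identifies each tangent space with
  \<open>\<real>\<^sup>3\<close>; the inverse identification produces the horizontal lifts of constant vectors.\<close>

definition frame :: "('a \<Rightarrow> real^2) \<Rightarrow> ('a, 3) chart \<Rightarrow> real^3 \<Rightarrow> real^3^3" where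
  "frame f c x = matrix (\<lambda>w. vector [tangent_map f c x w $ 1, tangent_map f c x w $ 2, inner_at (g c x) w (V c x)])"

definition lift :: "('a \<Rightarrow> real^2) \<Rightarrow> real^2 \<Rightarrow> real \<Rightarrow> ('a, 3) vfield" where
  "lift f e s c x = matrix_inv (frame f c x) *v vector [e $ 1, e $ 2, s]"

lemma frame_vec:
  assumes "(U, f) \<in> F" "c \<in> A" "x \<in> cimg c U"
  shows "frame f c x *v w = vector [tangent_map f c x w $ 1, tangent_map f c x w $ 2, inner_at (g c x) w (V c x)]"
proof -
  note lin = submersion_derivative(2)[OF assms]
  have "linear (\<lambda>w. vector [tangent_map f c x w $ 1, tangent_map f c x w $ 2, inner_at (g c x) w (V c x)] :: real^3)"
    by (rule linearI) (simp_all add: vec_eq_iff forall_3 linear_add[OF lin] linear_cmul[OF lin] inner_at_simps)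
  then show ?thesis unfolding frame_def by (simp add: matrix_works)
qed

text \<open>The frame is onto: a preimage under the submersion can be corrected by a multiple of \<open>V\<close>, which the submersion does not see.\<close>

lemma frame_invertible:
  assumes f: "(U, f) \<in> F" and c: "c \<in> A" and x: "x \<in> cimg c U"
  shows "invertible (frame f c x)"
proof -
  interpret unit_field_chart3 "cran c" "g c" "V c" by (rule unit_field_chart3[OF c])
  have xc: "x \<in> cran c" using x cimg_subset by blast
  note lin = submersion_derivative(2)[OF f c x]
  have "\<exists>w. frame f c x *v w = y" for y
  proof -
    obtain w where w: "tangent_map f c x w = vector [y $ 1, y $ 2]"
      using submersionD(3)[OF f c x] by (metis surjD)
    define w' where "w' = w + (y $ 3 - inner_at (g c x) w (V c x)) *\<^sub>R V c x"
    have "tangent_map f c x w' = vector [y $ 1, y $ 2]"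
      by (simp add: w'_def linear_add[OF lin] linear_cmul[OF lin] w submersion_V[OF f c x])
    then have "frame f c x *v w' = y"
      unfolding frame_vec[OF f c x] by (simp add: vec_eq_iff forall_3 vector_2 w'_def inner_at_simps unit[OF xc])
    then show ?thesis ..
  qed
  then have "surj ((*v) (frame f c x))" by (metis surjI)
  then show ?thesis
    by (metis invertible_right_inverse matrix_right_invertible_surjective)
qed

lemma lift_unique:
  assumes "(U, f) \<in> F" "c \<in> A" "x \<in> cimg c U"
  shows "lift f (tangent_map f c x w) (inner_at (g c x) w (V c x)) c x = w"
  unfolding lift_def
  by (rule matrix_inv_unique_vec[OF frame_invertible[OF assms] frame_vec[OF assms]])

lemma frame_lift:
  assumes "(U, f) \<in> F" "c \<in> A" "x \<in> cimg c U"
  shows "tangent_map f c x (lift f e s c x) = e" "inner_at (g c x) (lift f e s c x) (V c x) = s"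
proof -
  have "frame f c x *v lift f e s c x = vector [e $ 1, e $ 2, s]"
    unfolding lift_def by (rule matrix_inv_mul_vec(1)[OF frame_invertible[OF assms]])
  then show "tangent_map f c x (lift f e s c x) = e" "inner_at (g c x) (lift f e s c x) (V c x) = s"
    unfolding frame_vec[OF assms] by (simp_all add: vec_eq_iff forall_3 forall_2)
qed

lemma submersion_kernel:
  assumes "(U, f) \<in> F" "c \<in> A" "x \<in> cimg c U" "tangent_map f c x w = 0"
  shows "w = inner_at (g c x) w (V c x) *\<^sub>R V c x"
proof -
  interpret unit_field_chart3 "cran c" "g c" "V c" by (rule unit_field_chart3[OF assms(2)])
  have "x \<in> cran c" using assms(3) cimg_subset by blast
  then have "lift f 0 (inner_at (g c x) w (V c x)) c x = inner_at (g c x) w (V c x) *\<^sub>R V c x"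
    using lift_unique[OF assms(1-3), of "inner_at (g c x) w (V c x) *\<^sub>R V c x"]
    by (simp add: linear_cmul[OF submersion_derivative(2)[OF assms(1-3)]] submersion_V[OF assms(1-3)]
        inner_at_simps unit)
  then show ?thesis using lift_unique[OF assms(1-3), of w] assms(4) by simp
qed

lemma vertical_space_eq:
  assumes c: "c \<in> A" and x: "x \<in> cran c"
  shows "vertical_space F c x = range (\<lambda>r. r *\<^sub>R V c x)"
proof -
  have pM: "cinv c x \<in> topspace M" using cinv_in[OF x] cdom_subset[OF c] by blast
  obtain U f where f: "(U, f) \<in> F" "cinv c x \<in> U" by (rule submersion_at[OF pM])
  then have xU: "x \<in> cimg c U" using x by (simp add: mem_cimg[OF c])
  show ?thesis
  proof
    show "vertical_space F c x \<subseteq> range (\<lambda>r. r *\<^sub>R V c x)"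
    proof
      fix v assume "v \<in> vertical_space F c x"
      then have "\<forall>(U, f)\<in>F. cinv c x \<in> U \<longrightarrow> tangent_map f c x v = 0"
        by (simp add: vertical_space_def)
      from bspec[OF this f(1)] f(2) have "tangent_map f c x v = 0" by simp
      from submersion_kernel[OF f(1) c xU this] show "v \<in> range (\<lambda>r. r *\<^sub>R V c x)"
        by (rule range_eqI)
    qed
    show "range (\<lambda>r. r *\<^sub>R V c x) \<subseteq> vertical_space F c x"
      unfolding vertical_space_def
      using linear_cmul[OF submersion_derivative(2)[OF _ c]] submersion_V[OF _ c] x
      by (auto simp: mem_cimg[OF c])
  qed
qed

lemma horizontal_space_eq:
  assumes "c \<in> A" "x \<in> cran c"
  shows "horizontal_space F g c x = {u. inner_at (g c x) u (V c x) = 0}"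
  unfolding horizontal_space_def vertical_space_eq[OF assms] by (auto simp: inner_at_simps)

lemma smooth_frame:
  assumes f: "(U, f) \<in> F" and c: "c \<in> A"
  shows "smooth_on (cimg c U) (frame f c)"
proof (rule smooth_on_matI)
  interpret unit_field_chart3 "cran c" "g c" "V c" by (rule unit_field_chart3[OF c])
  show O: "open (cimg c U)" by (rule open_cimg[OF c submersionD(1)[OF f]])
  have t: "smooth_on (cimg c U) (\<lambda>x. tangent_map f c x w $ k)" for w k
    unfolding tangent_map_def by (rule smooth_on_vec_nth[OF O smooth_on_dir_deriv[OF submersionD(2)[OF f c]]])
  have h: "smooth_on (cimg c U) (\<lambda>x. inner_at (g c x) w (V c x))" for w
    by (rule smooth_on_inner_at[OF O smooth_on_subset[OF smooth_metric cimg_subset] smooth_on_const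
          smooth_on_subset[OF smooth_field cimg_subset]])
  fix i j :: 3
  consider "i = 1" | "i = 2" | "i = 3" using exhaust_3 by blast
  then show "smooth_on (cimg c U) (\<lambda>x. frame f c x $ i $ j)"
    by cases (simp_all add: frame_def matrix_def t h)
qed

lemma smooth_lift:
  assumes f: "(U, f) \<in> F" and c: "c \<in> A"
  shows "smooth_on (cimg c U) (lift f e s c)"
  unfolding lift_def
  by (rule smooth_on_matrix_vector_mult[OF open_cimg[OF c submersionD(1)[OF f]]
        smooth_on_matrix_inv[OF open_cimg[OF c submersionD(1)[OF f]] smooth_frame[OF f c] frame_invertible[OF f c]]
        smooth_on_const])

lemma lift_trans:
  assumes f: "(U, f) \<in> F" and c: "c \<in> A" "c' \<in> A" and x: "x \<in> cimg c (cdom c' \<inter> U)"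
  shows "lift f e s c' (trans_map c c' x) = dtrans c c' x (lift f e s c x)"
proof -
  have x': "x \<in> cimg c (cdom c')" "x \<in> cimg c U" using x by (auto simp: mem_cimg[OF c(1)])
  have xU: "trans_map c c' x \<in> cimg c' U"
    using x' trans_map_in[OF c x'(1)] by (simp add: mem_cimg[OF c(1)] mem_cimg[OF c(2)] cinv_trans_map[OF c x'(1)])
  show ?thesis
    using lift_unique[OF f c(2) xU, of "dtrans c c' x (lift f e s c x)"] frame_lift[OF f c(1) x'(2)]
    by (simp add: submersion_trans[OF f c x'] metric_trans[OF c x'(1)] V_trans[OF c x'(1), symmetric])
qed

lemma vector_field_lift:
  assumes "(U, f) \<in> F"
  shows "vector_field_on A U (lift f e s)"
  unfolding vector_field_on_def
  by (intro conjI ballI smooth_lift[OF assms] lift_trans[OF assms])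

lemma open_submersion_image:
  assumes f: "(U, f) \<in> F" and W: "openin M W" "W \<subseteq> U"
  shows "open (f ` W)"
proof -
  have "open ((f \<circ> cinv c) ` cimg c W)" if c: "c \<in> A" for c
  proof (rule open_image_submersion[OF open_cimg[OF c W(1)]])
    have sub: "cimg c W \<subseteq> cimg c U" using W(2) by (auto simp: cimg_def)
    show "smooth_on (cimg c W) (f \<circ> cinv c)" by (rule smooth_on_subset[OF submersionD(2)[OF f c] sub])
    show "surj (dir_deriv (f \<circ> cinv c) x)" if "x \<in> cimg c W" for x
      using submersionD(3)[OF f c] that sub unfolding tangent_map_def by blast
  qed
  then have "open (\<Union>c\<in>A. (f \<circ> cinv c) ` cimg c W)" by blast
  moreover have "(\<Union>c\<in>A. (f \<circ> cinv c) ` cimg c W) = f ` W"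
  proof
    show "(\<Union>c\<in>A. (f \<circ> cinv c) ` cimg c W) \<subseteq> f ` W" by (auto simp: mem_cimg)
    show "f ` W \<subseteq> (\<Union>c\<in>A. (f \<circ> cinv c) ` cimg c W)"
    proof
      fix y assume "y \<in> f ` W"
      then obtain p where p: "p \<in> W" "y = f p" by blast
      then have "p \<in> topspace M" using W(1) openin_subset by blast
      then obtain c where c: "c \<in> A" "p \<in> cdom c" by (rule topspace_covered)
      then have "coord c p \<in> cimg c W" "y = (f \<circ> cinv c) (coord c p)"
        using p by (auto simp: cimg_def cinv_coord)
      then show "y \<in> (\<Union>c\<in>A. (f \<circ> cinv c) ` cimg c W)" using c by blast
    qed
  qed
  ultimately show ?thesis by simp
qed

text \<open>Another local submersion is locally \<open>f' = \<gamma> \<circ> f\<close>, so the lift of the constant \<open>e\<close> projects under \<open>f'\<close> to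
  \<open>D\<gamma> e\<close>. This is a function of \<open>f'\<close> because \<open>\<gamma>\<close> is invertible.\<close>

lemma basic_lift:
  assumes f: "(U, f) \<in> F"
  shows "basic_field_on M A F g U (lift f e 0)"
  unfolding basic_field_on_def
proof (intro conjI ballI)
  show "vector_field_on A U (lift f e 0)" by (rule vector_field_lift[OF f])
  show "lift f e 0 c x \<in> horizontal_space F g c x" if "c \<in> A" "x \<in> cimg c U" for c x
    using frame_lift(2)[OF f that] by (simp add: horizontal_space_eq[OF that(1) subsetD[OF cimg_subset that(2)]])
  fix u assume "u \<in> F"
  moreover obtain U' f' where u: "u = (U', f')" by fastforce
  ultimately have f': "(U', f') \<in> F" by simp
  show "case u of (U', f') \<Rightarrow> \<forall>p\<in>U' \<inter> U. \<exists>N Y. openin M N \<and> p \<in> N \<and> N \<subseteq> U' \<inter> U \<and> smooth_on (f' ` N) Y \<and>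
        (\<forall>c\<in>A. \<forall>x\<in>cimg c N. tangent_map f' c x (lift f e 0 c x) = Y (f' (cinv c x)))"
    unfolding u case_prod_conv
  proof
    fix p assume p: "p \<in> U' \<inter> U"
    obtain W \<gamma> where W: "openin M W" "p \<in> W" "W \<subseteq> U \<inter> U'" and tc: "transverse_change f f' W \<gamma>"
    proof -
      have "\<forall>(U, f)\<in>F. \<forall>(U', f')\<in>F. \<forall>p\<in>U \<inter> U'.
          \<exists>W \<gamma>. openin M W \<and> p \<in> W \<and> W \<subseteq> U \<inter> U' \<and> transverse_change f f' W \<gamma>"
        using foliation unfolding foliation_def by (elim conjE)
      from bspec[OF bspec[OF this f, unfolded case_prod_conv] f', unfolded case_prod_conv]
      show ?thesis using p that by blast
    qed
    from tc obtain \<gamma>' where \<gamma>: "smooth_on (f ` W) \<gamma>" "\<And>q. q \<in> W \<Longrightarrow> f' q = \<gamma> (f q)"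
      "smooth_on (f' ` W) \<gamma>'" "\<And>q. q \<in> W \<Longrightarrow> f q = \<gamma>' (f' q)"
      unfolding transverse_change_def by blast
    let ?Y = "\<lambda>z. dir_deriv \<gamma> (\<gamma>' z) e"
    have "open (f' ` W)" using W(3) by (intro open_submersion_image[OF f' W(1)]) auto
    then have "smooth_on (f' ` W) ?Y"
      using \<gamma>(4) by (intro smooth_on_compose[OF _ _ smooth_on_dir_deriv[OF \<gamma>(1)] \<gamma>(3)]) auto
    moreover have "tangent_map f' c x (lift f e 0 c x) = ?Y (f' (cinv c x))" if c: "c \<in> A" and x: "x \<in> cimg c W" for c x
    proof -
      have xU: "x \<in> cimg c U" and q: "cinv c x \<in> W" using x W(3) by (auto simp: mem_cimg[OF c])
      have "dir_deriv (f' \<circ> cinv c) x = dir_deriv (\<lambda>y. \<gamma> ((f \<circ> cinv c) y)) x"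
        using \<gamma>(2) by (intro dir_deriv_cong[OF open_cimg[OF c W(1)] x]) (auto simp: mem_cimg[OF c])
      moreover have "dir_deriv (\<lambda>y. \<gamma> ((f \<circ> cinv c) y)) x v = dir_deriv \<gamma> ((f \<circ> cinv c) x) (tangent_map f c x v)" for v
        unfolding tangent_map_def
        by (rule dir_deriv_compose[OF smooth_on_differentiable[OF submersionD(2)[OF f c] xU]])
           (use smooth_on_differentiable[OF \<gamma>(1)] q in auto)
      ultimately show ?thesis
        using frame_lift(1)[OF f c xU] \<gamma>(4)[OF q] by (simp add: tangent_map_def)
    qed
    ultimately show "\<exists>N Y. openin M N \<and> p \<in> N \<and> N \<subseteq> U' \<inter> U \<and> smooth_on (f' ` N) Y \<and>
        (\<forall>c\<in>A. \<forall>x\<in>cimg c N. tangent_map f' c x (lift f e 0 c x) = Y (f' (cinv c x)))"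
      using W by (intro exI[of _ W] exI[of _ ?Y]) auto
  qed
qed

lemma lift_add:
  "lift f (e + e') (s + s') c x = lift f e s c x + lift f e' s' c x"
proof -
  have "(vector [(e + e') $ 1, (e + e') $ 2, s + s'] :: real^3) = vector [e $ 1, e $ 2, s] + vector [e' $ 1, e' $ 2, s']"
    by (simp add: vec_eq_iff forall_3)
  then show ?thesis unfolding lift_def by (metis matrix_vector_right_distrib)
qed

text \<open>Bundle-likeness concerns the squares of basic fields; products of two lifts follow by polarization.\<close>

lemma lift_inner_constant:
  assumes f: "(U, f) \<in> F" and c: "c \<in> A" and x: "x \<in> cimg c U"
  shows "dir_deriv (\<lambda>y. inner_at (g c y) (lift f e 0 c y) (lift f e' 0 c y)) x (V c x) = 0"
proof -
  interpret unit_field_chart3 "cran c" "g c" "V c" by (rule unit_field_chart3[OF c])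
  have O: "open (cimg c U)" by (rule open_cimg[OF c submersionD(1)[OF f]])
  let ?q = "\<lambda>e e' y. inner_at (g c y) (lift f e 0 c y) (lift f e' 0 c y)"
  have vU: "vertical_field_on A F U V"
  proof -
    have "U \<subseteq> topspace M" by (rule openin_subset[OF submersionD(1)[OF f]])
    moreover have "cimg c U \<subseteq> cimg c (topspace M)" for c :: "('a, 3) chart"
      using \<open>U \<subseteq> topspace M\<close> unfolding cimg_def by blast
    ultimately show ?thesis
      using vertical_V vector_field_on_subset[OF vector_field_V] unfolding vertical_field_on_def by (meson subsetD)
  qed
  have q0: "dir_deriv (?q e e) x (V c x) = 0" for e
    using bundle_like[unfolded bundle_like_def, rule_format, OF conjI[OF submersionD(1)[OF f] conjI[OF basic_lift[OF f] vU]] c x] .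
  have sm: "smooth_on (cimg c U) (?q e e')" for e e'
    by (rule smooth_on_inner_at[OF O smooth_on_subset[OF smooth_metric cimg_subset] smooth_lift[OF f c] smooth_lift[OF f c]])
  have "dir_deriv (?q (e + e') (e + e')) x = dir_deriv (\<lambda>y. ?q e e y + ?q e' e' y + 2 * ?q e e' y) x"
  proof (rule dir_deriv_cong[OF O x])
    fix y assume "y \<in> cimg c U"
    then have "y \<in> cran c" using cimg_subset by blast
    then show "?q (e + e') (e + e') y = ?q e e y + ?q e' e' y + 2 * ?q e e' y"
      using lift_add[of f e e' 0 0 c y] inner_sym[of y "lift f e' 0 c y" "lift f e 0 c y"]
      by (simp add: inner_at_simps)
  qed
  also have "\<dots> = (\<lambda>v. dir_deriv (?q e e) x v + dir_deriv (?q e' e') x v + 2 * dir_deriv (?q e e') x v)"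
    by (intro dir_deriv_eqI has_derivative_add has_derivative_mult_right smooth_on_has_derivative[OF sm x])
  finally have "dir_deriv (?q (e + e') (e + e')) x (V c x) = 2 * dir_deriv (?q e e') x (V c x)"
    by (simp add: q0)
  then show ?thesis by (simp add: q0)
qed

text \<open>The bracket of \<open>V\<close> with a basic field is vertical. So bundle-likeness, \<open>V \<langle>X, X\<rangle> = 0\<close>, turns into
  \<open>\<langle>D\<^sub>X V, X\<rangle> = \<langle>D\<^sub>V X, X\<rangle> = 0\<close> for basic \<open>X\<close>, and every horizontal vector is a value of a basic field.\<close>

lemma bundle_like_cov_deriv:
  assumes c: "c \<in> A" and x: "x \<in> cran c" and u: "inner_at (g c x) u (V c x) = 0"
  shows "inner_at (g c x) (cov_deriv (g c) (V c) x u) u = 0"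
proof -
  interpret unit_field_chart3 "cran c" "g c" "V c" by (rule unit_field_chart3[OF c])
  have "cinv c x \<in> topspace M" using cinv_in[OF x] cdom_subset[OF c] by blast
  then obtain U f where f: "(U, f) \<in> F" "cinv c x \<in> U" by (rule submersion_at)
  have xU: "x \<in> cimg c U" using f x by (simp add: mem_cimg[OF c])
  have O: "open (cimg c U)" by (rule open_cimg[OF c submersionD(1)[OF f(1)]])
  define e where "e = tangent_map f c x u"
  define X where "X = lift f e 0 c"
  let ?h = "f \<circ> cinv c"
  have h: "smooth_on (cimg c U) ?h" by (rule submersionD(2)[OF f(1) c])
  have smX: "smooth_on (cimg c U) X" unfolding X_def by (rule smooth_lift[OF f(1) c])
  have smV: "smooth_on (cimg c U) (V c)" by (rule smooth_on_subset[OF smooth_field cimg_subset])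
  note dX = smooth_on_differentiable[OF smX xU] and dV = smooth_on_differentiable[OF smV xU]
  have Xx: "X x = u" using lift_unique[OF f(1) c xU, of u] u by (simp add: X_def e_def)
  have "dir_deriv (\<lambda>y. dir_deriv ?h y (X y)) x = dir_deriv (\<lambda>_. e) x"
    using frame_lift(1)[OF f(1) c] by (intro dir_deriv_cong[OF O xU]) (simp add: X_def tangent_map_def)
  then have 1: "dir_deriv (\<lambda>y. dir_deriv ?h y u) x (V c x) + dir_deriv ?h x (dir_deriv X x (V c x)) = 0"
    using dir_deriv_along_field[OF O xU h dX, of "V c x"] by (simp add: Xx)
  have "dir_deriv (\<lambda>y. dir_deriv ?h y (V c y)) x = dir_deriv (\<lambda>_. 0) x"
    using submersion_V[OF f(1) c] by (intro dir_deriv_cong[OF O xU]) (simp add: tangent_map_def)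
  then have 2: "dir_deriv (\<lambda>y. dir_deriv ?h y (V c x)) x u + dir_deriv ?h x (dir_deriv (V c) x u) = 0"
    using dir_deriv_along_field[OF O xU h dV, of u] by simp
  have "dir_deriv ?h x (dir_deriv X x (V c x)) = dir_deriv ?h x (dir_deriv (V c) x u)"
    using 1 2 mixed_derivatives_commute[OF O xU h, of u "V c x"] by (metis add_left_cancel)
  then have "tangent_map f c x (lie_bracket (V c) X x) = 0"
    by (simp add: tangent_map_def lie_bracket_def Xx linear_diff[OF smooth_on_linear[OF h xU]])
  then obtain a where a: "lie_bracket (V c) X x = a *\<^sub>R V c x"
    using submersion_kernel[OF f(1) c xU] by blast
  have "inner_at (g c x) (lie_bracket (V c) X x) u = 0"
    using u inner_sym[OF x, of u "V c x"] by (simp add: a inner_at_simps)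
  moreover have "inner_at (g c x) (cov_deriv (g c) X x (V c x)) u = 0"
    using lift_inner_constant[OF f(1) c xU, of e e] dir_deriv_inner[OF x dX dX, of "V c x"]
      inner_sym[OF x, of u "cov_deriv (g c) X x (V c x)"]
    by (simp add: Xx X_def[symmetric])
  ultimately show ?thesis
    by (simp add: lie_bracket_cov_deriv[OF x] Xx inner_at_simps)
qed

section \<open>The mean curvature field\<close>

lemma mean_curvature_acceleration:
  assumes "c \<in> A" "x \<in> cran c"
  shows "mean_curvature_field g V c x = levi_civita (g c) (V c) (V c) x"
proof -
  interpret unit_field_chart3 "cran c" "g c" "V c" by (rule unit_field_chart3[OF assms(1)])
  show ?thesis by (rule mean_curvature_eq_acceleration[where g=g and W=V and c=c, OF refl refl assms(2)])
qed

lemma ext_deriv_characteristic: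
  assumes "c \<in> A" "x \<in> cran c"
  shows "ext_deriv1 (characteristic_form g V) c x u v =
    inner_at (g c x) (cov_deriv (g c) (V c) x u) v - inner_at (g c x) (cov_deriv (g c) (V c) x v) u"
proof -
  interpret unit_field_chart3 "cran c" "g c" "V c" by (rule unit_field_chart3[OF assms(1)])
  show ?thesis using ext_deriv_dual[OF assms(2)] by (simp add: ext_deriv1_def characteristic_form_def)
qed

text \<open>Since \<open>\<langle>D\<^sub>v V, V\<rangle> = 0\<close>, contraction of \<open>d\<chi>\<close> with \<open>V\<close> leaves only \<open>\<kappa>\<close>. This expression is free of
  the connection, so that coordinate changes of \<open>\<tau>\<close> reduce to those of \<open>d\<chi>\<close>.\<close>

lemma mean_curvature_form_eq:
  assumes "c \<in> A" "x \<in> cran c"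
  shows "inner_at (g c x) (mean_curvature_field g V c x) v = ext_deriv1 (characteristic_form g V) c x (V c x) v"
proof -
  interpret unit_field_chart3 "cran c" "g c" "V c" by (rule unit_field_chart3[OF assms(1)])
  show ?thesis
    unfolding ext_deriv_characteristic[OF assms] mean_curvature_acceleration[OF assms]
    by (simp add: acceleration_cov_deriv inner_cov_deriv_field[OF assms(2)])
qed

text \<open>The second derivatives of the coordinate change are symmetric, so they cancel in \<open>d\<chi>\<close>.\<close>

lemma ext_deriv_characteristic_trans:
  assumes c: "c \<in> A" "c' \<in> A" and x: "x \<in> cimg c (cdom c')"
  shows "ext_deriv1 (characteristic_form g V) c' (trans_map c c' x) (dtrans c c' x u) (dtrans c c' x v) =
    ext_deriv1 (characteristic_form g V) c x u v"
proof -
  interpret c': unit_field_chart3 "cran c'" "g c'" "V c'" by (rule unit_field_chart3[OF c(2)])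
  let ?\<phi> = "trans_map c c'" and ?O = "cimg c (cdom c')"
  have O: "open ?O" by (rule open_overlap[OF c])
  note \<phi> = smooth_trans_map[OF c]
  define a where "a = (\<lambda>z. g c' z *v V c' z)"
  have a: "smooth_on (cran c') a"
    unfolding a_def by (rule smooth_on_matrix_vector_mult[OF c'.open_dom c'.smooth_metric c'.smooth_field])
  have z: "?\<phi> x \<in> cran c'" by (rule trans_map_in(2)[OF c x])
  note a' = smooth_on_has_derivative[OF a z]
  have c'd: "dir_deriv (\<lambda>z. characteristic_form g V c' z w) (?\<phi> x) w' = w \<bullet> dir_deriv a (?\<phi> x) w'" for w w'
  proof -
    have "(\<lambda>z. characteristic_form g V c' z w) = (\<lambda>z. w \<bullet> a z)"
      by (simp add: fun_eq_iff characteristic_form_def inner_at_def a_def)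
    then show ?thesis using dir_deriv_eqI[OF has_derivative_inner_right[OF a', of w]] by simp
  qed
  have cd: "dir_deriv (\<lambda>y. characteristic_form g V c y w) x w' =
      dtrans c c' x w \<bullet> dir_deriv a (?\<phi> x) (dtrans c c' x w') + dir_deriv (\<lambda>y. dtrans c c' y w) x w' \<bullet> a (?\<phi> x)" for w w'
  proof -
    have "dir_deriv (\<lambda>y. characteristic_form g V c y w) x = dir_deriv (\<lambda>y. dtrans c c' y w \<bullet> a (?\<phi> y)) x"
    proof (rule dir_deriv_cong[OF O x])
      fix y assume y: "y \<in> ?O"
      show "characteristic_form g V c y w = dtrans c c' y w \<bullet> a (?\<phi> y)"
        using metric_trans[OF c y, of w "V c y"] by (simp add: characteristic_form_def V_trans[OF c y] a_def inner_at_def)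
    qed
    moreover have "dir_deriv (\<lambda>y. dtrans c c' y w \<bullet> a (?\<phi> y)) x =
      (\<lambda>w'. dtrans c c' x w \<bullet> dir_deriv a (?\<phi> x) (dtrans c c' x w') + dir_deriv (\<lambda>y. dtrans c c' y w) x w' \<bullet> a (?\<phi> x))"
      by (rule dir_deriv_eqI[OF has_derivative_inner[OF smooth_on_has_derivative[OF smooth_on_dir_deriv[OF \<phi>] x]
            has_derivative_compose[OF smooth_on_has_derivative[OF \<phi> x] a']]])
    ultimately show ?thesis by simp
  qed
  show ?thesis
    unfolding ext_deriv1_def c'd cd
    using mixed_derivatives_commute[OF O x \<phi>, of u v] by simp
qed

lemma mean_curvature_trans:
  assumes c: "c \<in> A" "c' \<in> A" and x: "x \<in> cimg c (cdom c')"
  shows "mean_curvature_field g V c' (trans_map c c' x) = dtrans c c' x (mean_curvature_field g V c x)"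
proof -
  interpret c': unit_field_chart3 "cran c'" "g c'" "V c'" by (rule unit_field_chart3[OF c(2)])
  have z: "trans_map c c' x \<in> cran c'" and xc: "x \<in> cran c" using trans_map_in(2)[OF c x] x cimg_subset by auto
  show ?thesis
  proof (rule positive_definite_nondegenerate[OF c'.posdef[OF z]])
    fix w
    obtain v where w: "w = dtrans c c' x v" using dtrans_inverse'[OF c x, of w] by metis
    show "inner_at (g c' (trans_map c c' x)) (mean_curvature_field g V c' (trans_map c c' x)) w =
      inner_at (g c' (trans_map c c' x)) (dtrans c c' x (mean_curvature_field g V c x)) w"
      unfolding w mean_curvature_form_eq[OF c(2) z] metric_trans[OF c x] mean_curvature_form_eq[OF c(1) xc]
      using ext_deriv_characteristic_trans[OF c x, of "V c x" v] by (simp add: V_trans[OF c x])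
  qed
qed

lemma vector_field_mean_curvature: "vector_field_on A (topspace M) (mean_curvature_field g V)"
  unfolding vector_field_on_def
proof (intro conjI ballI)
  fix c assume c: "c \<in> A"
  interpret unit_field_chart3 "cran c" "g c" "V c" by (rule unit_field_chart3[OF c])
  show "smooth_on (cimg c (topspace M)) (mean_curvature_field g V c)"
    unfolding cimg_topspace[OF c]
    by (rule smooth_on_cong[OF open_dom _ smooth_acceleration]) (simp add: mean_curvature_acceleration[OF c])
  fix c' x assume "c' \<in> A" "x \<in> cimg c (cdom c' \<inter> topspace M)"
  then show "mean_curvature_field g V c' (trans_map c c' x) = dtrans c c' x (mean_curvature_field g V c x)"
    using mean_curvature_trans[OF c] by (simp add: mem_cimg[OF c])
qed

lemma density_trans:
  assumes c: "c \<in> A" "c' \<in> A" and x: "x \<in> cimg c (cdom c')"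
  shows "sqrt (det (g c x)) = \<bar>det (matrix (dtrans c c' x))\<bar> * sqrt (det (g c' (trans_map c c' x)))"
proof -
  let ?P = "matrix (dtrans c c' x)" and ?G = "g c' (trans_map c c' x)"
  have lin: "linear (dtrans c c' x)" by (rule smooth_on_linear[OF smooth_trans_map[OF c] x])
  have P: "dtrans c c' x v = ?P *v v" for v using lin by (simp add: matrix_works)
  have "inner_at (g c x) u v = inner_at (transpose ?P ** ?G ** ?P) u v" for u v
  proof -
    have "inner_at (transpose ?P ** ?G ** ?P) u v = u \<bullet> (transpose ?P *v (?G *v (?P *v v)))"
      by (simp add: inner_at_def matrix_vector_mul_assoc matrix_mul_assoc)
    also have "\<dots> = (?P *v u) \<bullet> (?G *v (?P *v v))"
      using dot_lmul_matrix[of "?G *v (?P *v v)" ?P u] by (simp add: transpose_matrix_vector inner_commute)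
    finally show ?thesis using metric_trans[OF c x, of u v] by (simp add: P inner_at_def)
  qed
  then have "inner_at (g c x) (axis i 1) (axis j 1) = inner_at (transpose ?P ** ?G ** ?P) (axis i 1) (axis j 1)" for i j
    by blast
  then have "g c x = transpose ?P ** ?G ** ?P"
    by (simp only: inner_at_axis vec_eq_iff) blast
  then have "det (g c x) = (det ?P)\<^sup>2 * det ?G"
    by (simp add: det_mul power2_eq_square)
  then show ?thesis by (simp add: real_sqrt_mult)
qed

lemma riemannian_volume: "volume_atlas M A (\<lambda>c y. sqrt (det (g c y)))"
proof (unfold_locales, goal_cases)
  case (1 c)
  interpret unit_field_chart3 "cran c" "g c" "V c" by (rule unit_field_chart3[OF 1])
  show ?case using smooth_density by (simp add: density_def[abs_def])
next
  case (2 c x)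
  interpret unit_field_chart3 "cran c" "g c" "V c" by (rule unit_field_chart3[OF 2(1)])
  show ?case using density_pos[OF 2(2)] by (simp add: density_def)
next
  case 3
  then show ?case by (rule density_trans)
qed

text \<open>If \<open>\<kappa> \<and> \<chi>\<close> is co-closed, then \<open>div \<tau> = - \<langle>\<tau>, \<tau>\<rangle>\<close>, so the divergence theorem forces \<open>\<tau> = 0\<close>.\<close>

theorem mean_curvature_eq_0_if_coclosed:
  assumes co: "\<And>c x w. c \<in> A \<Longrightarrow> x \<in> cran c \<Longrightarrow>
      codifferential2 g (wedge (mean_curvature_form g V) (characteristic_form g V)) c x w = 0"
    and c: "c \<in> A" and x: "x \<in> cran c"
  shows "mean_curvature_field g V c x = 0"
proof -
  let ?\<tau> = "mean_curvature_field g V"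
  define q where "q p = (let x = coord (chart_at p) p in inner_at (g (chart_at p) x) (?\<tau> (chart_at p) x) (?\<tau> (chart_at p) x))" for p
  have q: "q (cinv c x) = inner_at (g c x) (?\<tau> c x) (?\<tau> c x)" if c: "c \<in> A" and x: "x \<in> cran c" for c x
  proof -
    let ?c = "chart_at (cinv c x)"
    have "cinv c x \<in> topspace M" using cinv_in[OF x] cdom_subset[OF c] by blast
    note c' = chart_at[OF this]
    then have x': "x \<in> cimg c (cdom ?c)" using x by (simp add: mem_cimg[OF c])
    show ?thesis
      using metric_trans[OF c c'(1) x', of "?\<tau> c x" "?\<tau> c x"] mean_curvature_trans[OF c c'(1) x']
      by (simp add: q_def trans_map_def)
  qed
  interpret volume_atlas M A "\<lambda>c y. sqrt (det (g c y))" by (rule riemannian_volume)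
  interpret unit_field_chart3 "cran c" "g c" "V c" by (rule unit_field_chart3[OF c])
  have "q (cinv c x) = 0"
  proof (rule nonpositive_divergence_eq_0[OF vector_field_mean_curvature])
    fix c x assume c: "c \<in> A" and x: "x \<in> cran c"
    interpret c: unit_field_chart3 "cran c" "g c" "V c" by (rule unit_field_chart3[OF c])
    have "dir_deriv (\<lambda>y. sqrt (det (g c y)) * ?\<tau> c y $ i) x = dir_deriv (\<lambda>y. c.density y * c.acceleration y $ i) x" for i
      by (rule dir_deriv_cong[OF c.open_dom x]) (simp add: mean_curvature_acceleration[OF c] c.density_def)
    then show "(\<Sum>i\<in>UNIV. dir_deriv (\<lambda>y. sqrt (det (g c y)) * ?\<tau> c y $ i) x (axis i 1)) = - sqrt (det (g c x)) * q (cinv c x)"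
      using c.divergence_if_coclosed[where g=g and W=V and c=c, OF refl refl x co[OF c x]]
      by (simp add: q[OF c x] mean_curvature_acceleration[OF c x] c.density_def)
  next
    fix p assume p: "p \<in> topspace M"
    interpret p: unit_field_chart3 "cran (chart_at p)" "g (chart_at p)" "V (chart_at p)"
      by (rule unit_field_chart3[OF chart_at(1)[OF p]])
    show "q p \<ge> 0" using chart_at(2)[OF p] positive_definite_nonneg[OF p.posdef] by (simp add: q_def Let_def)
  next
    show "cinv c x \<in> topspace M" using cinv_in[OF x] cdom_subset[OF c] by blast
  qed
  then show ?thesis using positive_definite_eq_0[OF posdef[OF x]] by (simp add: q[OF c x])
qed

end

section \<open>Closed one-forms and inverse maps\<close>

text \<open>Poincare's lemma on a ball: the primitive is the integral along the rays from the centre, and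
  closedness turns its derivative into the total derivative \<open>d/ds (s a (z + s (x - z)))\<close>.\<close>

lemma closed_form_primitive:
  fixes a :: "'a::euclidean_space \<Rightarrow> 'a"
  assumes a: "smooth_on (ball z r) a"
    and closed: "\<And>x u v. x \<in> ball z r \<Longrightarrow> dir_deriv a x u \<bullet> v = dir_deriv a x v \<bullet> u"
  obtains t :: "'a \<Rightarrow> real" where "\<And>x. x \<in> ball z r \<Longrightarrow> (t has_derivative (\<lambda>w. a x \<bullet> w)) (at x)"
proof -
  let ?p = "\<lambda>x s. z + s *\<^sub>R (x - z)"
  let ?gr = "\<lambda>x s. s *\<^sub>R dir_deriv a (?p x s) (x - z) + a (?p x s)"
  define t where "t x = integral (cbox 0 1) (\<lambda>s. a (?p x s) \<bullet> (x - z))" for x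
  have p: "?p x s \<in> ball z r" if "x \<in> ball z r" "s \<in> cbox 0 1" for x s
  proof -
    have "dist z (?p x s) = s * dist z x" using that(2) by (simp add: dist_norm norm_minus_commute)
    also have "\<dots> \<le> 1 * dist z x" using that(2) by (intro mult_right_mono) auto
    finally show ?thesis using that(1) by simp
  qed
  have ac: "continuous_on (ball z r) a" by (rule smooth_on_imp_continuous[OF a])
  have Dc: "continuous_on (ball z r) (\<lambda>y. dir_deriv a y e)" for e
    by (rule smooth_on_imp_continuous[OF smooth_on_dir_deriv[OF a]])
  have rep: "dir_deriv a y w = (\<Sum>e\<in>Basis. (w \<bullet> e) *\<^sub>R dir_deriv a y e)" if "y \<in> ball z r" for y w
    by (rule linear_Basis_expansion[OF smooth_on_linear[OF a that]])
  have "(t has_derivative (\<lambda>w. a x \<bullet> w)) (at x)" if x: "x \<in> ball z r" for x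
  proof -
    have der: "(t has_derivative integral (cbox 0 1) (\<lambda>s. blinfun_inner_left (?gr x s))) (at x within ball z r)"
      unfolding t_def
    proof (rule leibniz_rule[where fx="\<lambda>x s. blinfun_inner_left (?gr x s)"])
      fix y and s :: real assume y: "y \<in> ball z r" and s: "s \<in> cbox 0 1"
      note lin = smooth_on_linear[OF a p[OF y s]]
      have "((\<lambda>y. a (?p y s)) has_derivative (\<lambda>w. dir_deriv a (?p y s) (s *\<^sub>R w))) (at y within ball z r)"
        by (rule has_derivative_compose[where f="\<lambda>y. ?p y s" and g=a, OF _ smooth_on_has_derivative[OF a p[OF y s]]])
           (auto intro!: derivative_eq_intros)
      moreover have "((\<lambda>y. y - z) has_derivative (\<lambda>w. w)) (at y within ball z r)"
        by (auto intro!: derivative_eq_intros)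
      ultimately have "((\<lambda>y. a (?p y s) \<bullet> (y - z)) has_derivative
          (\<lambda>w. a (?p y s) \<bullet> w + dir_deriv a (?p y s) (s *\<^sub>R w) \<bullet> (y - z))) (at y within ball z r)"
        by (rule has_derivative_inner)
      moreover have "(\<lambda>w. a (?p y s) \<bullet> w + dir_deriv a (?p y s) (s *\<^sub>R w) \<bullet> (y - z)) = blinfun_inner_left (?gr y s)"
        using closed[OF p[OF y s], of _ "y - z"]
        by (simp add: fun_eq_iff blinfun_inner_left.rep_eq linear_cmul[OF lin] inner_add_right inner_commute)
      ultimately show "((\<lambda>y. a (?p y s) \<bullet> (y - z)) has_derivative blinfun_apply (blinfun_inner_left (?gr y s))) (at y within ball z r)"
        by simp
    next
      show "(\<lambda>s. a (?p y s) \<bullet> (y - z)) integrable_on cbox 0 1" if "y \<in> ball z r" for y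
        using p[OF that] by (intro integrable_continuous continuous_intros continuous_on_compose2[OF ac]) auto
      have "continuous_on (ball z r \<times> cbox 0 1)
          (\<lambda>xs. snd xs *\<^sub>R (\<Sum>e\<in>Basis. ((fst xs - z) \<bullet> e) *\<^sub>R dir_deriv a (?p (fst xs) (snd xs)) e) + a (?p (fst xs) (snd xs)))"
        using p by (intro continuous_intros continuous_on_compose2[OF ac] continuous_on_compose2[OF Dc]) auto
      then have "continuous_on (ball z r \<times> cbox 0 1) (\<lambda>xs. ?gr (fst xs) (snd xs))"
        by (rule continuous_on_eq) (use p rep in auto)
      then show "continuous_on (ball z r \<times> cbox 0 1) (\<lambda>(x, s). blinfun_inner_left (?gr x s))"
        unfolding split_beta by (rule bounded_linear.continuous_on[OF bounded_linear_blinfun_inner_left])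
    qed (use x in auto)
    have cont: "continuous_on (cbox 0 1) (\<lambda>s. blinfun_inner_left (?gr x s))"
    proof -
      have "continuous_on (cbox 0 1) (\<lambda>s. s *\<^sub>R dir_deriv a (?p x s) (x - z) + a (?p x s))"
        using p[OF x] by (intro continuous_intros continuous_on_compose2[OF ac] continuous_on_compose2[OF Dc]) auto
      then show ?thesis by (rule bounded_linear.continuous_on[OF bounded_linear_blinfun_inner_left])
    qed
    have "blinfun_apply (integral (cbox 0 1) (\<lambda>s. blinfun_inner_left (?gr x s))) w = a x \<bullet> w" for w
    proof -
      have "((\<lambda>s. ?gr x s \<bullet> w) has_integral (1 *\<^sub>R a (?p x 1)) \<bullet> w - (0 *\<^sub>R a (?p x 0)) \<bullet> w) {0..1}"
      proof (rule fundamental_theorem_of_calculus)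
        fix s :: real assume "s \<in> {0..1}"
        then have s: "s \<in> cbox 0 1" by simp
        note lin = smooth_on_linear[OF a p[OF x s]]
        have "((\<lambda>s. a (?p x s)) has_derivative (\<lambda>h. dir_deriv a (?p x s) (h *\<^sub>R (x - z)))) (at s within {0..1})"
          by (rule has_derivative_compose[where f="\<lambda>s. ?p x s" and g=a, OF _ smooth_on_has_derivative[OF a p[OF x s]]])
             (auto intro!: derivative_eq_intros)
        note 1 = has_derivative_inner_left[OF has_derivative_scaleR[OF has_derivative_ident this], of w]
        define d where "d = dir_deriv a (?p x s) (x - z)"
        have "dir_deriv a (?p x s) (h *\<^sub>R (x - z)) = h *\<^sub>R d" for h
          unfolding d_def by (rule linear_cmul[OF lin])
        with 1 show "((\<lambda>s. (s *\<^sub>R a (?p x s)) \<bullet> w) has_vector_derivative ?gr x s \<bullet> w) (at s within {0..1})"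
          unfolding has_vector_derivative_def d_def[symmetric]
          by (simp add: inner_add_left distrib_left mult_ac)
      qed simp
      then have "integral (cbox 0 1) (\<lambda>s. ?gr x s \<bullet> w) = a x \<bullet> w"
        by (simp add: integral_unique)
      moreover have "integral (cbox 0 1) ((\<lambda>B. blinfun_apply B w) \<circ> (\<lambda>s. blinfun_inner_left (?gr x s))) =
          blinfun_apply (integral (cbox 0 1) (\<lambda>s. blinfun_inner_left (?gr x s))) w"
        by (rule integral_linear[OF integrable_continuous[OF cont] blinfun.bounded_linear_left])
      ultimately show ?thesis by (simp add: o_def blinfun_inner_left.rep_eq inner_commute)
    qed
    then have "(\<lambda>w. a x \<bullet> w) = blinfun_apply (integral (cbox 0 1) (\<lambda>s. blinfun_inner_left (?gr x s)))" by auto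
    then show ?thesis using der at_within_open[OF x open_ball] by simp
  qed
  then show ?thesis by (rule that)
qed

text \<open>The derivative of an inverse map is a smooth function of the inverse map itself, so its order of
  differentiability can be raised step by step.\<close>

lemma smooth_on_implicit:
  fixes \<Phi> :: "'a::real_normed_vector \<Rightarrow> 'b::euclidean_space"
  assumes S: "open S" and \<Phi>: "\<And>y. y \<in> S \<Longrightarrow> (\<Phi> has_derivative \<Phi>' (\<Phi> y)) (at y)" "\<Phi> ` S \<subseteq> T"
    and \<Phi>': "\<And>v. smooth_on T (\<lambda>x. \<Phi>' x v)"
  shows "smooth_on S \<Phi>"
proof -
  have "k_smooth_on k S \<Phi>" for k
  proof (induction k)
    case 0
    show ?case
      using \<Phi>(1) by (auto intro!: continuous_at_imp_continuous_on has_derivative_continuous)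
  next
    case (Suc k)
    have "k_smooth_on k S (\<lambda>y. dir_deriv \<Phi> y v)" for v
      by (rule k_smooth_on_cong[OF S _ k_smooth_on_compose[OF S \<Phi>(2) smooth_onD[OF \<Phi>'[of v]] Suc]])
         (simp add: dir_deriv_eqI[OF \<Phi>(1)])
    moreover have "\<Phi> differentiable (at y)" if "y \<in> S" for y
      using \<Phi>(1)[OF that] by (rule differentiableI)
    ultimately show ?case by simp
  qed
  then show ?thesis by (simp add: smooth_on_def)
qed

lemma smooth_inverse_function:
  fixes \<Psi> :: "real^'n \<Rightarrow> real^'n" and N :: "real^'n \<Rightarrow> real^'n^'n"
  assumes D: "open D" "z \<in> D" and \<Psi>: "\<And>y. y \<in> D \<Longrightarrow> (\<Psi> has_derivative (*v) (N y)) (at y)"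
    and N: "smooth_on D N" "\<And>y. y \<in> D \<Longrightarrow> invertible (N y)"
  obtains U V \<Phi> where "open U" "U \<subseteq> D" "z \<in> U" "open V" "\<Psi> z \<in> V" "homeomorphism U V \<Psi> \<Phi>"
    "\<And>y. y \<in> V \<Longrightarrow> (\<Phi> has_derivative (*v) (matrix_inv (N (\<Phi> y)))) (at y)" "smooth_on V \<Phi>"
proof -
  define L :: "real^'n^'n \<Rightarrow> ((real^'n) \<Rightarrow>\<^sub>L (real^'n))" where "L B = Blinfun ((*v) B)" for B
  have LB: "blinfun_apply (L B) = (*v) B" for B
    unfolding L_def by (rule bounded_linear_Blinfun_apply) (rule matrix_vector_mul_bounded_linear)
  have "linear L"
    by (rule linearI) (auto intro!: blinfun_eqI simp: LB blinfun.add_left blinfun.scaleR_left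
        matrix_vector_mult_add_rdistrib scaleR_matrix_vector_assoc)
  then have L: "bounded_linear L" by (simp add: linear_conv_bounded_linear)
  have comp: "L (matrix_inv (N z)) o\<^sub>L L (N z) = id_blinfun"
    by (rule blinfun_eqI) (simp add: LB matrix_inv_mul_vec[OF N(2)[OF D(2)]])
  obtain U V \<Phi> g' where U: "open U" "U \<subseteq> D" "z \<in> U" "open V" "\<Psi> z \<in> V" "homeomorphism U V \<Psi> \<Phi>"
    and g': "\<And>y. y \<in> V \<Longrightarrow> (\<Phi> has_derivative g' y) (at y)"
      "\<And>y. y \<in> V \<Longrightarrow> g' y = inv (blinfun_apply (L (N (\<Phi> y))))"
  proof (rule inverse_function_theorem[of D \<Psi> "\<lambda>y. L (N y)" z, OF D(1) _ _ D(2) comp])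
    show "(\<Psi> has_derivative blinfun_apply (L (N y))) (at y)" if "y \<in> D" for y
      using \<Psi>[OF that] by (simp add: LB)
    show "continuous_on D (\<lambda>y. L (N y))"
      by (rule bounded_linear.continuous_on[OF L smooth_on_imp_continuous[OF N(1)]])
  qed blast
  have \<Phi>U: "\<Phi> ` V \<subseteq> U" using U(6) by (simp add: homeomorphism_def)
  have \<Phi>': "(\<Phi> has_derivative (*v) (matrix_inv (N (\<Phi> y)))) (at y)" if y: "y \<in> V" for y
  proof -
    have "\<Phi> y \<in> D" using \<Phi>U U(2) y by blast
    note inv = matrix_inv_mul_vec[OF N(2)[OF this]]
    have "inv ((*v) (N (\<Phi> y))) = (*v) (matrix_inv (N (\<Phi> y)))"
      by (rule inv_equality) (simp_all add: inv)
    then show ?thesis using g'(1)[OF y] g'(2)[OF y] by (simp add: LB)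
  qed
  have "smooth_on V \<Phi>"
  proof (rule smooth_on_implicit[OF U(4) \<Phi>'])
    show "\<Phi> ` V \<subseteq> D" using \<Phi>U U(2) by blast
    show "smooth_on D (\<lambda>x. matrix_inv (N x) *v v)" for v
      by (rule smooth_on_matrix_vector_mult[OF D(1) smooth_on_matrix_inv[OF D(1) N] smooth_on_const])
  qed
  then show ?thesis using that[OF U \<Phi>'] by blast
qed

lemma smooth_on_Pair:
  assumes "open S" "smooth_on S f" "smooth_on S g"
  shows "smooth_on S (\<lambda>x. (f x, g x))"
proof -
  have "smooth_on S (\<lambda>x. (f x, 0) + (0, g x))"
    by (intro smooth_on_add assms(1) smooth_on_linear_comp[OF assms(1) _ assms(2), of "\<lambda>y. (y, 0)"]
        smooth_on_linear_comp[OF assms(1) _ assms(3), of "\<lambda>y. (0, y)"] bounded_linear_Pair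
        bounded_linear_ident bounded_linear_zero)
  then show ?thesis by simp
qed

text \<open>The identification of \<open>\<real>\<^sup>2 \<times> \<real>\<close> with \<open>\<real>\<^sup>3\<close>, which the inverse function theorem needs since it is about self-maps.\<close>

lemma linear_pack: "linear (\<lambda>bs. vector [fst bs $ 1, fst bs $ 2, snd bs] :: real^3)"
  by (rule linearI) (simp_all add: vec_eq_iff forall_3)

section \<open>Totally geodesic flows and integrable complements\<close>

context riemannian_flow
begin

text \<open>Vertical fields are multiples of \<open>V\<close>, so by the Leibniz rule \<open>D\<^sub>V V = 0\<close> is enough.\<close>

lemma totally_geodesic_if_minimal:
  assumes \<tau>: "\<And>c x. c \<in> A \<Longrightarrow> x \<in> cran c \<Longrightarrow> mean_curvature_field g V c x = 0"
  shows "totally_geodesic M A F g"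
  unfolding totally_geodesic_def
proof (intro allI impI ballI)
  fix S W W' c x
  assume *: "openin M S \<and> vertical_field_on A F S W \<and> vertical_field_on A F S W'"
    and c: "c \<in> A" and x: "x \<in> cimg c S"
  interpret unit_field_chart3 "cran c" "g c" "V c" by (rule unit_field_chart3[OF c])
  have xc: "x \<in> cran c" using x cimg_subset by blast
  have O: "open (cimg c S)" using * by (intro open_cimg[OF c]) simp
  have vert: "\<exists>a. Z c y = a *\<^sub>R V c y" if "vertical_field_on A F S Z" "y \<in> cimg c S" for Z y
    using that c vertical_space_eq[OF c subsetD[OF cimg_subset that(2)]] unfolding vertical_field_on_def by blast
  obtain a where a: "W c x = a *\<^sub>R V c x" using vert[of W x] * x by blast
  define b where "b y = inner_at (g c y) (W' c y) (V c y)" for y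
  have W': "W' c y = b y *\<^sub>R V c y" if y: "y \<in> cimg c S" for y
  proof -
    obtain b' where "W' c y = b' *\<^sub>R V c y" using vert[of W' y] * y by blast
    moreover have "y \<in> cran c" using y cimg_subset by blast
    ultimately show ?thesis by (simp add: b_def inner_at_simps unit)
  qed
  have smW': "smooth_on (cimg c S) (W' c)"
    using * c by (auto simp: vertical_field_on_def vector_field_on_def)
  have b: "smooth_on (cimg c S) b"
    unfolding b_def
    by (rule smooth_on_inner_at[OF O smooth_on_subset[OF smooth_metric cimg_subset] smW'
          smooth_on_subset[OF smooth_field cimg_subset]])
  have "dir_deriv (W' c) x = dir_deriv (\<lambda>y. b y *\<^sub>R V c y) x"
    by (rule dir_deriv_cong[OF O x W'])
  also have "\<dots> = (\<lambda>u. b x *\<^sub>R dir_deriv (V c) x u + dir_deriv b x u *\<^sub>R V c x)"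
    by (rule dir_deriv_eqI[OF has_derivative_scaleR[OF smooth_on_has_derivative[OF b x]
            has_dir_deriv[OF field_differentiable[OF xc]]]])
  finally have "cov_deriv (g c) (W' c) x u = b x *\<^sub>R cov_deriv (g c) (V c) x u + dir_deriv b x u *\<^sub>R V c x" for u
    by (simp add: cov_deriv_def W'[OF x] linear_cmul[OF christoffel_linear(2)[OF xc]] algebra_simps)
  moreover have "cov_deriv (g c) (V c) x (W c x) = 0"
    using \<tau>[OF c xc] by (simp add: a linear_cmul[OF linear_cov_deriv_field[OF xc]]
        mean_curvature_acceleration[OF c xc] acceleration_cov_deriv)
  ultimately show "levi_civita (g c) (W c) (W' c) x \<in> vertical_space F c x"
    by (simp add: levi_civita_cov_deriv vertical_space_eq[OF c xc]) (rule range_eqI, rule refl)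
qed

lemma minimal_if_totally_geodesic:
  assumes tg: "totally_geodesic M A F g" and c: "c \<in> A" and x: "x \<in> cran c"
  shows "mean_curvature_field g V c x = 0"
proof -
  interpret unit_field_chart3 "cran c" "g c" "V c" by (rule unit_field_chart3[OF c])
  have "acceleration x \<in> vertical_space F c x"
    using tg c x vertical_V cimg_topspace[OF c] openin_topspace unfolding totally_geodesic_def by blast
  then obtain a where a: "acceleration x = a *\<^sub>R V c x"
    unfolding vertical_space_eq[OF c x] by blast
  then have "a = 0" using inner_acceleration[OF x] unit[OF x] by (simp add: inner_at_simps)
  then show ?thesis by (simp add: mean_curvature_acceleration[OF c x] a)
qed

text \<open>If \<open>f\<close> is a local submersion with kernel \<open>\<H>\<close>, then \<open>\<chi> = df / df (V)\<close>, so \<open>d\<chi>\<close> vanishes on \<open>\<H>\<close>.\<close>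

lemma characteristic_closed_on_integrable:
  assumes int: "horizontal_integrable M A F g" and c: "c \<in> A" and x: "x \<in> cran c"
    and u: "inner_at (g c x) u (V c x) = 0" and v: "inner_at (g c x) v (V c x) = 0"
  shows "ext_deriv1 (characteristic_form g V) c x u v = 0"
proof -
  interpret unit_field_chart3 "cran c" "g c" "V c" by (rule unit_field_chart3[OF c])
  obtain F' :: "('a, 1) cocycle" where F': "foliation M A F'"
    and ker: "\<And>c x. c \<in> A \<Longrightarrow> x \<in> cran c \<Longrightarrow> vertical_space F' c x = horizontal_space F g c x"
    using int unfolding horizontal_integrable_def by blast
  have "cinv c x \<in> topspace M" using cinv_in[OF x] cdom_subset[OF c] by blast
  then have "cinv c x \<in> (\<Union>(U, f)\<in>F'. U)" using F' unfolding foliation_def by simp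
  then obtain U f where f: "(U, f) \<in> F'" "cinv c x \<in> U" by (auto split: prod.splits)
  have "\<forall>(U, f)\<in>F'. openin M U \<and> smooth_map_on A U f \<and> (\<forall>c\<in>A. \<forall>x\<in>cimg c U. surj (tangent_map f c x))"
    using F' unfolding foliation_def by (elim conjE)
  from bspec[OF this f(1)] have U: "openin M U" and sm: "smooth_on (cimg c U) (f \<circ> cinv c)"
    and surj: "\<And>y. y \<in> cimg c U \<Longrightarrow> surj (tangent_map f c y)"
    unfolding smooth_map_on_def case_prod_conv using c by simp_all
  have O: "open (cimg c U)" by (rule open_cimg[OF c U])
  have xU: "x \<in> cimg c U" using f(2) x by (simp add: mem_cimg[OF c])
  define h where "h y = (f \<circ> cinv c) y $ 1" for y
  have smh: "smooth_on (cimg c U) h" unfolding h_def by (rule smooth_on_vec_nth[OF O sm])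
  have Dh: "dir_deriv h y w = tangent_map f c y w $ 1" if "y \<in> cimg c U" for y w
    unfolding h_def tangent_map_def
    using dir_deriv_eqI[OF bounded_linear.has_derivative[OF bounded_linear_vec_nth smooth_on_has_derivative[OF sm that]]]
    by simp
  have hor: "dir_deriv h y w = 0" if y: "y \<in> cimg c U" and w: "inner_at (g c y) w (V c y) = 0" for y w
  proof -
    have yc: "y \<in> cran c" "cinv c y \<in> U" using y by (simp_all add: mem_cimg[OF c])
    have "w \<in> vertical_space F' c y"
      using w by (simp add: ker[OF c yc(1)] horizontal_space_eq[OF c yc(1)])
    then have "\<forall>(U, f)\<in>F'. cinv c y \<in> U \<longrightarrow> tangent_map f c y w = 0" by (simp add: vertical_space_def)
    from bspec[OF this f(1)] yc(2) show ?thesis by (simp add: Dh[OF y])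
  qed
  define \<beta> where "\<beta> y = dir_deriv h y (V c y)" for y
  have dec: "dir_deriv h y w = inner_at (g c y) w (V c y) * \<beta> y" if y: "y \<in> cimg c U" for y w
  proof -
    have "y \<in> cran c" using y cimg_subset by blast
    then have "dir_deriv h y (w - inner_at (g c y) w (V c y) *\<^sub>R V c y) = 0"
      by (intro hor[OF y]) (simp add: inner_at_simps unit)
    then show ?thesis
      by (simp add: \<beta>_def linear_diff[OF smooth_on_linear[OF smh y]] linear_cmul[OF smooth_on_linear[OF smh y]])
  qed
  have \<beta>0: "\<beta> y \<noteq> 0" if y: "y \<in> cimg c U" for y
  proof
    assume "\<beta> y = 0"
    then have "tangent_map f c y w $ 1 = 0" for w using dec[OF y, of w] Dh[OF y] by simp
    moreover obtain w where "tangent_map f c y w = vec 1" using surj[OF y] by (metis surjD)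
    ultimately show False by (metis vec_component zero_neq_one)
  qed
  have sm\<beta>: "smooth_on (cimg c U) (\<lambda>y. inverse (\<beta> y))"
    unfolding \<beta>_def
    by (rule smooth_on_inverse[OF O \<beta>0[unfolded \<beta>_def] smooth_on_dir_deriv_field[OF O smh smooth_on_subset[OF smooth_field cimg_subset]]])
  have D\<chi>: "dir_deriv (\<lambda>y. characteristic_form g V c y w) x w' =
      inverse (\<beta> x) * dir_deriv (\<lambda>y. dir_deriv h y w) x w' + dir_deriv (\<lambda>y. inverse (\<beta> y)) x w' * dir_deriv h x w" for w w'
  proof -
    have "dir_deriv (\<lambda>y. characteristic_form g V c y w) x = dir_deriv (\<lambda>y. inverse (\<beta> y) * dir_deriv h y w) x"
      by (rule dir_deriv_cong[OF O xU]) (use dec \<beta>0 in \<open>simp add: characteristic_form_def\<close>)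
    then show ?thesis
      using dir_deriv_eqI[OF has_derivative_mult[OF smooth_on_has_derivative[OF sm\<beta> xU]
            smooth_on_has_derivative[OF smooth_on_dir_deriv[OF smh, of w] xU]]] by simp
  qed
  show ?thesis
    unfolding ext_deriv1_def D\<chi>
    using hor[OF xU u] hor[OF xU v] mixed_derivatives_commute[OF O xU smh, of u v] by simp
qed

text \<open>On \<open>\<H>\<close> the form \<open>\<langle>D\<^sub>u V, v\<rangle>\<close> is skew because the flow is bundle-like, and symmetric because \<open>d\<chi>\<close> vanishes
  there.\<close>

lemma parallel_if_integrable_minimal:
  assumes int: "horizontal_integrable M A F g"
    and \<tau>: "\<And>c x. c \<in> A \<Longrightarrow> x \<in> cran c \<Longrightarrow> mean_curvature_field g V c x = 0"
    and c: "c \<in> A" and x: "x \<in> cran c"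
  shows "cov_deriv (g c) (V c) x u = 0"
proof -
  interpret unit_field_chart3 "cran c" "g c" "V c" by (rule unit_field_chart3[OF c])
  let ?g = "inner_at (g c x)" and ?S = "cov_deriv (g c) (V c) x"
  have SV: "?S (V c x) = 0"
    using \<tau>[OF c x] by (simp add: mean_curvature_acceleration[OF c x] acceleration_cov_deriv)
  have hor: "?g (w - ?g w (V c x) *\<^sub>R V c x) (V c x) = 0" for w
    by (simp add: inner_at_simps unit[OF x])
  have h0: "?g (?S w) w' = 0" if "?g w (V c x) = 0" "?g w' (V c x) = 0" for w w'
    using cov_deriv_sym_part[OF x bundle_like_cov_deriv[OF c x], of w w'] that
      characteristic_closed_on_integrable[OF int c x that] ext_deriv_characteristic[OF c x, of w w'] by simp
  have "?g (?S u) w = ?g 0 w" for w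
  proof -
    have "?S u = ?S (u - ?g u (V c x) *\<^sub>R V c x)"
      by (simp add: linear_diff[OF linear_cov_deriv_field[OF x]] linear_cmul[OF linear_cov_deriv_field[OF x]] SV)
    then have "?g (?S u) (w - ?g w (V c x) *\<^sub>R V c x) = 0" using h0[OF hor hor] by simp
    then show ?thesis by (simp add: inner_at_simps inner_cov_deriv_field[OF x])
  qed
  then show ?thesis by (rule positive_definite_nondegenerate[OF posdef[OF x]])
qed

lemma mean_curvature_wedge_eq_0:
  assumes "mean_curvature_field g V c x = 0"
  shows "wedge (mean_curvature_form g V) (characteristic_form g V) c x u v = 0"
  using assms by (simp add: wedge_def mean_curvature_form_def inner_at_simps)

lemma harmonic_if_0:
  assumes \<omega>: "\<And>c x u v. c \<in> A \<Longrightarrow> x \<in> cran c \<Longrightarrow> \<omega> c x u v = 0"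
  shows "harmonic2 A g \<omega>"
  unfolding harmonic2_def
proof (intro ballI conjI allI)
  fix c x u v w assume c: "c \<in> A" and x: "x \<in> cran c"
  have "dir_deriv (\<lambda>y. \<omega> c y u v) x = dir_deriv (\<lambda>_. 0) x" for u v
    by (rule dir_deriv_cong[OF chartD(2)[OF c] x \<omega>[OF c]])
  then show "ext_deriv2 \<omega> c x u v w = 0" by (simp add: ext_deriv2_def)
  have "dir_deriv (\<lambda>y. hodge_star2 g \<omega> c y v) x = dir_deriv (\<lambda>_. 0) x" for v
    by (rule dir_deriv_cong[OF chartD(2)[OF c] x]) (simp add: hodge_star2_def \<omega>[OF c])
  then show "codifferential2 g \<omega> c x w = 0"
    by (simp add: codifferential2_def hodge_star2_def[of g "ext_deriv1 _"] ext_deriv1_def)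
qed

end

section \<open>The product structure of a parallel flow\<close>

locale parallel_flow = riemannian_flow +
  assumes parallel: "\<And>c x u. c \<in> A \<Longrightarrow> x \<in> cran c \<Longrightarrow> cov_deriv (g c) (V c) x u = 0"
begin

text \<open>A primitive of \<open>\<chi>\<close> on a coordinate ball, the signed length along the leaves of the flow.\<close>

definition height :: "('a, 3) chart \<Rightarrow> real^3 \<Rightarrow> real \<Rightarrow> (real^3 \<Rightarrow> real) \<Rightarrow> bool" where
  "height c z r t \<longleftrightarrow> ball z r \<subseteq> cran c \<and>
     (\<forall>y\<in>ball z r. (t has_derivative characteristic_form g V c y) (at y))"

lemma smooth_characteristic:
  assumes c: "c \<in> A"
  shows "smooth_on (cran c) (\<lambda>y. characteristic_form g V c y w)"
proof -
  interpret unit_field_chart3 "cran c" "g c" "V c" by (rule unit_field_chart3[OF c])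
  show ?thesis
    unfolding characteristic_form_def by (rule smooth_on_inner_at[OF open_dom smooth_metric smooth_on_const smooth_field])
qed

lemma height_exists:
  assumes c: "c \<in> A" and r: "ball z r \<subseteq> cran c"
  obtains t where "height c z r t"
proof -
  interpret unit_field_chart3 "cran c" "g c" "V c" by (rule unit_field_chart3[OF c])
  define a where "a = (\<lambda>y. g c y *v V c y)"
  have sm: "smooth_on (cran c) a"
    unfolding a_def by (rule smooth_on_matrix_vector_mult[OF open_dom smooth_metric smooth_field])
  have \<chi>: "characteristic_form g V c = (\<lambda>y w. a y \<bullet> w)"
    by (simp add: characteristic_form_def inner_at_def a_def fun_eq_iff inner_commute)
  have "dir_deriv a x u \<bullet> v = dir_deriv a x v \<bullet> u" if "x \<in> ball z r" for x u v
  proof -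
    have x: "x \<in> cran c" using that r by blast
    have "dir_deriv (\<lambda>y. a y \<bullet> w) x w' = dir_deriv a x w' \<bullet> w" for w w'
      using dir_deriv_eqI[OF has_derivative_inner_left[OF smooth_on_has_derivative[OF sm x]]] by simp
    then show ?thesis
      using ext_deriv_characteristic[OF c x, of u v]
      by (simp add: ext_deriv1_def \<chi> parallel[OF c x] inner_at_simps)
  qed
  then obtain t where "\<And>x. x \<in> ball z r \<Longrightarrow> (t has_derivative (\<lambda>w. a x \<bullet> w)) (at x)"
    using closed_form_primitive[OF smooth_on_subset[OF sm r]] by blast
  then have "height c z r t" using r by (simp add: height_def \<chi>)
  then show ?thesis by (rule that)
qed

lemma characteristic_trans:
  assumes "c \<in> A" "c' \<in> A" "x \<in> cimg c (cdom c')"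
  shows "characteristic_form g V c' (trans_map c c' x) (dtrans c c' x w) = characteristic_form g V c x w"
  using metric_trans[OF assms] by (simp add: characteristic_form_def V_trans[OF assms, symmetric])

lemma height_has_derivative:
  assumes t: "height c z r t" and c: "c \<in> A" "c' \<in> A" and x: "x \<in> cimg c' (cinv c ` ball z r)"
  shows "((\<lambda>y. t (coord c (cinv c' y))) has_derivative characteristic_form g V c' x) (at x)"
proof -
  have b: "ball z r \<subseteq> cran c" using t by (simp add: height_def)
  have W: "openin M (cinv c ` ball z r)" by (rule openin_cinv_image[OF c(1) open_ball b])
  have p: "cinv c' x \<in> cdom c" "coord c (cinv c' x) \<in> ball z r"
    using x by (auto simp: mem_cimg[OF c(2)] cinv_image_eq[OF c(1) b])
  have x': "x \<in> cimg c' (cdom c)" using x p by (simp add: mem_cimg[OF c(2)])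
  have "trans_map c' c x \<in> ball z r" using p(2) by (simp add: trans_map_def)
  then have t': "(t has_derivative characteristic_form g V c (trans_map c' c x)) (at (trans_map c' c x))"
    using t by (simp add: height_def)
  show ?thesis
    using has_derivative_compose[OF trans_map_has_derivative[OF c(2,1) x'] t']
    by (simp add: trans_map_def[abs_def] o_def)
       (simp add: trans_map_def[abs_def, symmetric] characteristic_trans[OF c(2,1) x', unfolded trans_map_def o_def]
         trans_map_def o_def)
qed

text \<open>The leaves of \<open>\<H>\<close> are the level sets of the local primitives of the closed form \<open>\<chi>\<close>.\<close>

definition height_cocycle :: "('a, 1) cocycle" where
  "height_cocycle = {(cinv c ` ball z r, \<lambda>q. vec (t (coord c q))) | c z r t. c \<in> A \<and> height c z r t}"

lemma height_cocycleE:
  assumes "(U, f) \<in> height_cocycle"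
  obtains c z r t where "c \<in> A" "height c z r t" "U = cinv c ` ball z r" "f = (\<lambda>q. vec (t (coord c q)))"
  using assms by (auto simp: height_cocycle_def)

lemma bounded_linear_vec1: "bounded_linear (vec :: real \<Rightarrow> real^1)"
proof -
  have "linear (vec :: real \<Rightarrow> real^1)" by (rule linearI) (simp_all add: vec_eq_iff)
  then show ?thesis by (simp add: linear_conv_bounded_linear)
qed

lemma height_cocycle_props:
  assumes f: "(U, f) \<in> height_cocycle"
  shows "openin M U" "c \<in> A \<Longrightarrow> smooth_on (cimg c U) (f \<circ> cinv c)"
    "c \<in> A \<Longrightarrow> x \<in> cimg c U \<Longrightarrow> ((f \<circ> cinv c) has_derivative (\<lambda>w. vec (characteristic_form g V c x w))) (at x)"
    "c \<in> A \<Longrightarrow> x \<in> cimg c U \<Longrightarrow> tangent_map f c x = (\<lambda>w. vec (characteristic_form g V c x w))"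
proof -
  obtain c0 z r t where c0: "c0 \<in> A" and t: "height c0 z r t" and U: "U = cinv c0 ` ball z r"
    and ft: "f = (\<lambda>q. vec (t (coord c0 q)))" by (rule height_cocycleE[OF f])
  have b: "ball z r \<subseteq> cran c0" using t by (simp add: height_def)
  show oU: "openin M U" unfolding U by (rule openin_cinv_image[OF c0 open_ball b])
  have der: "((f \<circ> cinv c) has_derivative (\<lambda>w. vec (characteristic_form g V c x w))) (at x)"
    if c: "c \<in> A" and x: "x \<in> cimg c U" for c x
    using bounded_linear.has_derivative[OF bounded_linear_vec1 height_has_derivative[OF t c0 c x[unfolded U]]]
    by (simp add: ft o_def)
  show "c \<in> A \<Longrightarrow> x \<in> cimg c U \<Longrightarrow> ((f \<circ> cinv c) has_derivative (\<lambda>w. vec (characteristic_form g V c x w))) (at x)"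
    by (rule der)
  show "c \<in> A \<Longrightarrow> x \<in> cimg c U \<Longrightarrow> tangent_map f c x = (\<lambda>w. vec (characteristic_form g V c x w))"
    unfolding tangent_map_def by (rule dir_deriv_eqI[OF der])
  show "smooth_on (cimg c U) (f \<circ> cinv c)" if c: "c \<in> A"
  proof (rule smooth_on_primitive[OF open_cimg[OF c oU] der[OF c]])
    show "smooth_on (cimg c U) (\<lambda>x. vec (characteristic_form g V c x v) :: real^1)" for v
      by (rule smooth_on_linear_comp[OF open_cimg[OF c oU] bounded_linear_vec1
            smooth_on_subset[OF smooth_characteristic[OF c] cimg_subset]])
  qed
qed

lemma height_cocycle_covers:
  assumes "p \<in> topspace M"
  shows "\<exists>(U, f)\<in>height_cocycle. p \<in> U"
proof -
  obtain c where c: "c \<in> A" "p \<in> cdom c" by (rule topspace_covered[OF assms])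
  obtain r where r: "r > 0" "ball (coord c p) r \<subseteq> cran c"
    using chartD(2)[OF c(1)] c(2) open_contains_ball by blast
  obtain t where t: "height c (coord c p) r t" by (rule height_exists[OF c(1) r(2)])
  have "p \<in> cinv c ` ball (coord c p) r"
    by (rule image_eqI[of _ _ "coord c p"]) (use r c in \<open>simp_all add: cinv_coord\<close>)
  moreover have "(cinv c ` ball (coord c p) r, \<lambda>q. vec (t (coord c q))) \<in> height_cocycle"
    using c(1) t by (auto simp: height_cocycle_def)
  ultimately show ?thesis by (intro bexI) simp_all
qed

lemma foliation_height_cocycle: "foliation M A height_cocycle"
  unfolding foliation_def
proof (intro conjI)
  show "(\<Union>(U, f)\<in>height_cocycle. U) = topspace M"
    using height_cocycle_covers openin_subset[OF height_cocycle_props(1)] by (auto split: prod.splits) blast+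
  show "\<forall>(U, f)\<in>height_cocycle. openin M U \<and> smooth_map_on A U f \<and> (\<forall>c\<in>A. \<forall>x\<in>cimg c U. surj (tangent_map f c x))"
  proof clarify
    fix U f assume f: "(U, f) \<in> height_cocycle"
    have "surj (tangent_map f c x)" if c: "c \<in> A" and x: "x \<in> cimg c U" for c x
    proof -
      interpret unit_field_chart3 "cran c" "g c" "V c" by (rule unit_field_chart3[OF c])
      have "x \<in> cran c" using x cimg_subset by blast
      then have "tangent_map f c x ((w $ 1) *\<^sub>R V c x) = w" for w
        by (simp add: height_cocycle_props(4)[OF f c x] characteristic_form_def inner_at_simps unit vec_eq_iff forall_1)
      then show ?thesis by (rule surjI[of "tangent_map f c x" "\<lambda>w. w $ 1 *\<^sub>R V c x"])
    qed
    then show "openin M U \<and> smooth_map_on A U f \<and> (\<forall>c\<in>A. \<forall>x\<in>cimg c U. surj (tangent_map f c x))"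
      using height_cocycle_props(1,2)[OF f] by (simp add: smooth_map_on_def)
  qed
  show "\<forall>(U, f)\<in>height_cocycle. \<forall>(U', f')\<in>height_cocycle. \<forall>p\<in>U \<inter> U'.
        \<exists>W \<gamma>. openin M W \<and> p \<in> W \<and> W \<subseteq> U \<inter> U' \<and> transverse_change f f' W \<gamma>"
  proof clarify
    fix U f U' f' p
    assume f: "(U, f) \<in> height_cocycle" and f': "(U', f') \<in> height_cocycle" and p: "p \<in> U" "p \<in> U'"
    have oUU': "openin M (U \<inter> U')"
      using height_cocycle_props(1)[OF f] height_cocycle_props(1)[OF f'] by (rule openin_Int)
    then have "p \<in> topspace M" using p openin_subset by blast
    then obtain c where c: "c \<in> A" "p \<in> cdom c" by (rule topspace_covered)
    have "coord c p \<in> cimg c (U \<inter> U')" using p c(2) by (auto simp: cimg_def)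
    then obtain r where r: "r > 0" "ball (coord c p) r \<subseteq> cimg c (U \<inter> U')"
      using open_cimg[OF c(1) oUU'] openE by blast
    let ?B = "ball (coord c p) r"
    have B: "?B \<subseteq> cran c" using r(2) cimg_subset by blast
    have der0: "((\<lambda>y. (f' \<circ> cinv c) y - (f \<circ> cinv c) y) has_derivative (\<lambda>h. 0)) (at y within ?B)" if y: "y \<in> ?B" for y
    proof -
      have "y \<in> cimg c U" "y \<in> cimg c U'" using y r(2) by (auto simp: cimg_def)
      from has_derivative_diff[OF height_cocycle_props(3)[OF f' c(1) this(2)] height_cocycle_props(3)[OF f c(1) this(1)]]
      show ?thesis by (simp add: has_derivative_at_withinI)
    qed
    from has_derivative_zero_constant[OF convex_ball der0]
    obtain k where k: "\<And>y. y \<in> ?B \<Longrightarrow> (f' \<circ> cinv c) y - (f \<circ> cinv c) y = k"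
      by blast
    have kq: "f' q = f q + k" if "q \<in> cinv c ` ?B" for q
      using that k by (auto simp: algebra_simps)
    have "transverse_change f f' (cinv c ` ?B) (\<lambda>z. z + k)"
      unfolding transverse_change_def
    proof (intro conjI exI[of _ "\<lambda>z. z - k"])
      have sm: "smooth_on S (\<lambda>z. z + k)" for S and k :: "real^1"
        by (rule smooth_on_subset[OF smooth_on_add[OF open_UNIV smooth_on_id smooth_on_const] subset_UNIV])
      show "smooth_on (f ` cinv c ` ?B) (\<lambda>z. z + k)" by (rule sm)
      show "smooth_on (f' ` cinv c ` ?B) (\<lambda>z. z - k)" using sm[of _ "- k"] by simp
    qed (use kq in auto)
    moreover have "p \<in> cinv c ` ?B"
      by (rule image_eqI[of _ _ "coord c p"]) (use r c in \<open>simp_all add: cinv_coord\<close>)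
    moreover have "cinv c ` ?B \<subseteq> U \<inter> U'" using r(2) by (auto simp: mem_cimg[OF c(1)])
    ultimately show "\<exists>W \<gamma>. openin M W \<and> p \<in> W \<and> W \<subseteq> U \<inter> U' \<and> transverse_change f f' W \<gamma>"
      using openin_cinv_image[OF c(1) open_ball B] by blast
  qed
qed

lemma horizontal_integrable: "horizontal_integrable M A F g"
  unfolding horizontal_integrable_def
proof (intro exI[of _ height_cocycle] conjI foliation_height_cocycle ballI)
  fix c x assume c: "c \<in> A" and x: "x \<in> cran c"
  have "cinv c x \<in> topspace M" using cinv_in[OF x] cdom_subset[OF c] by blast
  then obtain U f where f: "(U, f) \<in> height_cocycle" "cinv c x \<in> U" using height_cocycle_covers by blast
  have *: "tangent_map f c x v = 0 \<longleftrightarrow> inner_at (g c x) v (V c x) = 0"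
    if "(U, f) \<in> height_cocycle" "cinv c x \<in> U" for U f v
    using height_cocycle_props(4)[OF that(1) c, of x] that(2) x
    by (simp add: mem_cimg[OF c] characteristic_form_def vec_eq_iff)
  have "v \<in> vertical_space height_cocycle c x \<longleftrightarrow> inner_at (g c x) v (V c x) = 0" for v
  proof
    assume "v \<in> vertical_space height_cocycle c x"
    then have "\<forall>(U, f)\<in>height_cocycle. cinv c x \<in> U \<longrightarrow> tangent_map f c x v = 0"
      by (simp add: vertical_space_def)
    from bspec[OF this f(1)] f(2) show "inner_at (g c x) v (V c x) = 0" by (simp add: *[OF f])
  next
    assume "inner_at (g c x) v (V c x) = 0"
    then show "v \<in> vertical_space height_cocycle c x"
      unfolding vertical_space_def using * by auto
  qed
  then show "vertical_space height_cocycle c x = horizontal_space F g c x"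
    by (auto simp: horizontal_space_eq[OF c x])
qed

lemma lift_linear_expand:
  "inner_at G (lift f e 0 c x) (lift f e' 0 c x) =
    (\<Sum>i\<in>UNIV. \<Sum>j\<in>UNIV. e $ i * e' $ j * inner_at G (lift f (axis i 1) 0 c x) (lift f (axis j 1) 0 c x))"
proof -
  have "lift f e 0 c x = e $ 1 *\<^sub>R lift f (axis 1 1) 0 c x + e $ 2 *\<^sub>R lift f (axis 2 1) 0 c x" for e
  proof -
    have "(vector [e $ 1, e $ 2, 0] :: real^3) = e $ 1 *\<^sub>R vector [(axis 1 1 :: real^2) $ 1, (axis 1 1 :: real^2) $ 2, 0]
        + e $ 2 *\<^sub>R vector [(axis 2 1 :: real^2) $ 1, (axis 2 1 :: real^2) $ 2, 0]"
      by (simp add: vec_eq_iff forall_3 axis_def)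
    then show ?thesis unfolding lift_def by (simp add: matrix_vector_right_distrib matrix_vector_mult_scaleR)
  qed
  from this[of e] this[of e'] show ?thesis
    by (simp add: sum_2 inner_at_simps algebra_simps)
qed

text \<open>A vector is the sum of its vertical part and of the horizontal lift of its projection.\<close>

lemma metric_lift_decomposition:
  assumes "(U, f) \<in> F" "c \<in> A" "x \<in> cimg c U"
  shows "inner_at (g c x) u v =
    inner_at (g c x) (lift f (tangent_map f c x u) 0 c x) (lift f (tangent_map f c x v) 0 c x)
    + characteristic_form g V c x u * characteristic_form g V c x v"
proof -
  interpret unit_field_chart3 "cran c" "g c" "V c" by (rule unit_field_chart3[OF assms(2)])
  have xc: "x \<in> cran c" using assms(3) cimg_subset by blast
  have dec: "lift f (tangent_map f c x w) 0 c x = w - characteristic_form g V c x w *\<^sub>R V c x" for w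
    using lift_unique[OF assms, of "w - characteristic_form g V c x w *\<^sub>R V c x"]
    by (simp add: linear_diff[OF submersion_derivative(2)[OF assms]] linear_cmul[OF submersion_derivative(2)[OF assms]]
        submersion_V[OF assms] inner_at_simps unit[OF xc] characteristic_form_def)
  show ?thesis
    unfolding dec using inner_sym[OF xc, of "V c x" v]
    by (simp add: inner_at_simps unit[OF xc] characteristic_form_def)
qed

lemma lift_inner_along_flow:
  assumes f: "(U, f) \<in> F" and c: "c \<in> A" and J: "convex J" "s \<in> J" "s0 \<in> J"
    and \<gamma>: "\<And>s. s \<in> J \<Longrightarrow> \<gamma> s \<in> cimg c U"
      "\<And>s. s \<in> J \<Longrightarrow> (\<gamma> has_derivative (\<lambda>h. h *\<^sub>R V c (\<gamma> s))) (at s within J)"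
  shows "inner_at (g c (\<gamma> s)) (lift f e 0 c (\<gamma> s)) (lift f e' 0 c (\<gamma> s)) =
    inner_at (g c (\<gamma> s0)) (lift f e 0 c (\<gamma> s0)) (lift f e' 0 c (\<gamma> s0))"
proof -
  interpret unit_field_chart3 "cran c" "g c" "V c" by (rule unit_field_chart3[OF c])
  let ?q = "\<lambda>y. inner_at (g c y) (lift f e 0 c y) (lift f e' 0 c y)"
  have q: "smooth_on (cimg c U) ?q"
    by (rule smooth_on_inner_at[OF open_cimg[OF c submersionD(1)[OF f]] smooth_on_subset[OF smooth_metric cimg_subset]
          smooth_lift[OF f c] smooth_lift[OF f c]])
  have "((\<lambda>s. ?q (\<gamma> s)) has_derivative (\<lambda>h. 0)) (at s within J)" if s: "s \<in> J" for s
    using has_derivative_compose[OF \<gamma>(2)[OF s] smooth_on_has_derivative[OF q \<gamma>(1)[OF s]]]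
      lift_inner_constant[OF f c \<gamma>(1)[OF s], of e e']
    by (simp add: linear_cmul[OF smooth_on_linear[OF q \<gamma>(1)[OF s]]])
  from has_derivative_zero_constant[OF J(1) this]
  obtain k where "\<And>s. s \<in> J \<Longrightarrow> ?q (\<gamma> s) = k" by blast
  then show ?thesis using J(2,3) by simp
qed

text \<open>The coordinates \<open>(f, t)\<close>, where \<open>f\<close> is a local submersion defining the flow and \<open>dt = \<chi>\<close>. Their
  derivative is the frame, so they are invertible by the inverse function theorem, and \<open>V = \<partial>\<^sub>t\<close>.\<close>

lemma product_coordinates:
  assumes f: "(U, f) \<in> F" and c: "c \<in> A" and z: "z \<in> cimg c U"
  obtains B J T r t and \<phi> :: "(real^2) \<times> real \<Rightarrow> real^3" where
    "open B" "connected B" "open J" "convex J" "open T" "z \<in> T" "T \<subseteq> cimg c U" "T \<subseteq> ball z r" "height c z r t"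
    "\<And>y. y \<in> T \<Longrightarrow> (f (cinv c y), t y) \<in> B \<times> J \<and> \<phi> (f (cinv c y), t y) = y"
    "\<And>bs. bs \<in> B \<times> J \<Longrightarrow> \<phi> bs \<in> T \<and> (f (cinv c (\<phi> bs)), t (\<phi> bs)) = bs"
    "smooth_on (B \<times> J) \<phi>"
    "\<And>b s. b \<in> B \<Longrightarrow> s \<in> J \<Longrightarrow> ((\<lambda>s. \<phi> (b, s)) has_derivative (\<lambda>h. h *\<^sub>R V c (\<phi> (b, s)))) (at s within J)"
proof -
  interpret unit_field_chart3 "cran c" "g c" "V c" by (rule unit_field_chart3[OF c])
  obtain r where r: "r > 0" "ball z r \<subseteq> cimg c U"
    using z open_cimg[OF c submersionD(1)[OF f]] openE by blast
  have rc: "ball z r \<subseteq> cran c" using r(2) cimg_subset by blast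
  obtain t where t: "height c z r t" by (rule height_exists[OF c rc])
  let ?N = "frame f c"
  define pack :: "(real^2) \<times> real \<Rightarrow> real^3" where "pack = (\<lambda>bs. vector [fst bs $ 1, fst bs $ 2, snd bs])"
  have pack_bl: "bounded_linear pack"
    unfolding pack_def using linear_pack by (simp add: linear_conv_bounded_linear)
  have pack_inj: "pack bs = pack bs' \<longleftrightarrow> bs = bs'" for bs bs'
    by (simp add: pack_def vec_eq_iff forall_3 forall_2 prod_eq_iff)
  define \<psi> where "\<psi> y = (f (cinv c y), t y)" for y
  define \<Psi> where "\<Psi> = pack \<circ> \<psi>"
  have \<psi>': "(\<psi> has_derivative (\<lambda>w. (tangent_map f c y w, characteristic_form g V c y w))) (at y)"
    if y: "y \<in> ball z r" for y
  proof -
    have "(t has_derivative characteristic_form g V c y) (at y)" using t y by (simp add: height_def)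
    from has_derivative_Pair[OF submersion_derivative(1)[OF f c subsetD[OF r(2) y]] this]
    show ?thesis by (simp add: \<psi>_def[abs_def] o_def)
  qed
  have \<Psi>': "(\<Psi> has_derivative (*v) (?N y)) (at y)" if y: "y \<in> ball z r" for y
    unfolding \<Psi>_def o_def
    by (rule has_derivative_eq_rhs[OF bounded_linear.has_derivative[OF pack_bl \<psi>'[OF y]]])
       (simp add: fun_eq_iff frame_vec[OF f c subsetD[OF r(2) y]] pack_def characteristic_form_def)
  have smN: "smooth_on (ball z r) ?N" by (rule smooth_on_subset[OF smooth_frame[OF f c] r(2)])
  have invN: "invertible (?N y)" if "y \<in> ball z r" for y
    by (rule frame_invertible[OF f c subsetD[OF r(2) that]])
  obtain U1 V1 \<Phi> where U1: "open U1" "U1 \<subseteq> ball z r" "z \<in> U1" and V1: "open V1" "\<Psi> z \<in> V1"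
    and hom: "homeomorphism U1 V1 \<Psi> \<Phi>"
    and \<Phi>': "\<And>y. y \<in> V1 \<Longrightarrow> (\<Phi> has_derivative (*v) (matrix_inv (?N (\<Phi> y)))) (at y)" and sm\<Phi>: "smooth_on V1 \<Phi>"
    using smooth_inverse_function[OF open_ball _ \<Psi>' smN invN] r(1) by (metis centre_in_ball)
  have "open (pack -` V1)"
    using V1(1) continuous_on_open_vimage[OF open_UNIV, of pack] linear_continuous_on[OF pack_bl, of UNIV] by auto
  moreover have "\<psi> z \<in> pack -` V1" using V1(2) by (simp add: \<Psi>_def)
  ultimately obtain B0 J0 where BJ0: "open B0" "open J0" "\<psi> z \<in> B0 \<times> J0" "B0 \<times> J0 \<subseteq> pack -` V1"
    by (rule open_prod_elim)
  obtain rb where rb: "rb > 0" "ball (fst (\<psi> z)) rb \<subseteq> B0" using BJ0(1,3) openE[OF BJ0(1)] by (metis mem_Times_iff)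
  obtain rj where rj: "rj > 0" "ball (snd (\<psi> z)) rj \<subseteq> J0" using BJ0(2,3) openE[OF BJ0(2)] by (metis mem_Times_iff)
  define B where "B = ball (fst (\<psi> z)) rb"
  define J where "J = ball (snd (\<psi> z)) rj"
  have BJ: "open B" "connected B" "open J" "convex J" by (simp_all add: B_def J_def)
  have packV: "pack bs \<in> V1" if "bs \<in> B \<times> J" for bs
    using that rb rj BJ0(4) by (auto simp: B_def J_def)
  define T where "T = U1 \<inter> \<psi> -` (B \<times> J)"
  have "continuous_on U1 \<psi>"
    using U1(2) \<psi>' by (meson continuous_at_imp_continuous_on has_derivative_continuous subsetD)
  from continuous_open_preimage[OF this U1(1) open_Times[OF BJ(1,3)]] have oT: "open T" by (simp add: T_def)
  have "\<psi> z \<in> B \<times> J" using rb rj by (simp add: B_def J_def mem_Times_iff)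
  then have zT: "z \<in> T" using U1(3) by (simp add: T_def)
  have Tb: "T \<subseteq> ball z r" using U1(2) by (auto simp: T_def)
  define \<phi> where "\<phi> = (\<lambda>bs. \<Phi> (pack bs))"
  have \<phi>\<psi>: "(f (cinv c y), t y) \<in> B \<times> J \<and> \<phi> (f (cinv c y), t y) = y" if "y \<in> T" for y
    using hom that by (auto simp: T_def \<phi>_def \<Psi>_def \<psi>_def homeomorphism_def)
  have \<psi>\<phi>: "\<phi> bs \<in> T \<and> (f (cinv c (\<phi> bs)), t (\<phi> bs)) = bs" if bs: "bs \<in> B \<times> J" for bs
  proof -
    have U: "\<phi> bs \<in> U1" "pack (\<psi> (\<phi> bs)) = pack bs"
      using hom packV[OF bs] by (auto simp: homeomorphism_def \<phi>_def \<Psi>_def)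
    then have "\<psi> (\<phi> bs) = bs" by (simp only: pack_inj)
    then show ?thesis using U(1) bs by (simp add: T_def \<psi>_def)
  qed
  have sm\<phi>: "smooth_on (B \<times> J) \<phi>"
    unfolding \<phi>_def
  proof (rule smooth_on_compose[OF open_Times[OF BJ(1,3)] _ sm\<Phi>])
    show "pack ` (B \<times> J) \<subseteq> V1" by (rule image_subsetI[OF packV])
    show "smooth_on (B \<times> J) pack" by (simp only: smooth_on_def k_smooth_on_bounded_linear[OF pack_bl] simp_thms)
  qed
  have "((\<lambda>s. \<phi> (b, s)) has_derivative (\<lambda>h. h *\<^sub>R V c (\<phi> (b, s)))) (at s within J)" if b: "b \<in> B" and s: "s \<in> J" for b s
  proof -
    have bs: "(b, s) \<in> B \<times> J" using b s by simp
    define y where "y = \<phi> (b, s)"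
    have yU: "y \<in> cimg c U" using \<psi>\<phi>[OF bs] Tb r(2) by (auto simp: y_def)
    then have yc: "y \<in> cran c" using cimg_subset by blast
    have "((\<lambda>s. pack (b, s)) has_derivative (\<lambda>h. pack (0, h))) (at s within J)"
      by (rule bounded_linear.has_derivative[OF pack_bl]) (auto intro!: derivative_eq_intros)
    from has_derivative_compose[OF this \<Phi>'[OF packV[OF bs]]]
    have "((\<lambda>s. \<phi> (b, s)) has_derivative (\<lambda>h. matrix_inv (?N y) *v pack (0, h))) (at s within J)"
      by (simp add: y_def \<phi>_def)
    moreover have "matrix_inv (?N y) *v pack (0, h) = h *\<^sub>R V c y" for h
    proof (rule matrix_inv_unique_vec[OF frame_invertible[OF f c yU]])
      show "?N y *v (h *\<^sub>R V c y) = pack (0, h)"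
        by (simp add: matrix_vector_mult_scaleR frame_vec[OF f c yU] submersion_V[OF f c yU] unit[OF yc]
            pack_def vec_eq_iff forall_3)
    qed
    ultimately show ?thesis by (simp add: y_def)
  qed
  then show ?thesis
    using that[OF BJ oT zT order_trans[OF Tb r(2)] Tb t \<phi>\<psi> \<psi>\<phi> sm\<phi>] by blast
qed

text \<open>In these coordinates the horizontal lifts of the coordinate fields of the quotient are the other
  coordinate fields. Their inner products do not depend on \<open>t\<close>, because the flow is bundle-like.\<close>

theorem locally_product: "locally_product_of_plaques M A F g"
  unfolding locally_product_of_plaques_def
proof
  fix p assume p: "p \<in> topspace M"
  obtain c0 where c0: "c0 \<in> A" "p \<in> cdom c0" by (rule topspace_covered[OF p])
  obtain U f where f: "(U, f) \<in> F" "p \<in> U" by (rule submersion_at[OF p])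
  define z where "z = coord c0 p"
  have "z \<in> cimg c0 U" using f(2) c0(2) by (auto simp: z_def cimg_def)
  then obtain B J T r t and \<phi> :: "(real^2) \<times> real \<Rightarrow> real^3" where
    BJ: "open B" "connected B" "open J" "convex J" and T: "open T" "z \<in> T" "T \<subseteq> cimg c0 U" "T \<subseteq> ball z r"
    and t: "height c0 z r t"
    and \<phi>\<psi>: "\<And>y. y \<in> T \<Longrightarrow> (f (cinv c0 y), t y) \<in> B \<times> J \<and> \<phi> (f (cinv c0 y), t y) = y"
    and \<psi>\<phi>: "\<And>bs. bs \<in> B \<times> J \<Longrightarrow> \<phi> bs \<in> T \<and> (f (cinv c0 (\<phi> bs)), t (\<phi> bs)) = bs"
    and sm\<phi>: "smooth_on (B \<times> J) \<phi>"
    and \<phi>': "\<And>b s. b \<in> B \<Longrightarrow> s \<in> J \<Longrightarrow> ((\<lambda>s. \<phi> (b, s)) has_derivative (\<lambda>h. h *\<^sub>R V c0 (\<phi> (b, s)))) (at s within J)"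
    by (rule product_coordinates[OF f(1) c0(1)]) blast
  have Tc: "T \<subseteq> cran c0" using T(3) cimg_subset by blast
  define W where "W = cinv c0 ` T"
  have Weq: "W = {q \<in> cdom c0. coord c0 q \<in> T}" unfolding W_def by (rule cinv_image_eq[OF c0(1) Tc])
  define \<psi> where "\<psi> q = (f q, t (coord c0 q))" for q
  define \<psi>' where "\<psi>' = (\<lambda>bs. cinv c0 (\<phi> bs))"
  have oW: "openin M W" unfolding W_def by (rule openin_cinv_image[OF c0(1) T(1) Tc])
  have WU: "W \<subseteq> U" "W \<subseteq> cdom c0" "W \<subseteq> cinv c0 ` ball z r"
    using T Tc by (auto simp: W_def mem_cimg[OF c0(1)] cinv_in)
  have pW: "p \<in> W" using c0(2) T(2) by (simp add: Weq z_def)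
  have \<psi>W: "\<psi> q \<in> B \<times> J" "\<psi>' (\<psi> q) = q" if "q \<in> W" for q
    using that \<phi>\<psi>[of "coord c0 q"] by (auto simp: Weq \<psi>_def \<psi>'_def cinv_coord[OF c0(1)])
  have \<psi>'BJ: "\<psi>' bs \<in> W" "\<psi> (\<psi>' bs) = bs" if "bs \<in> B \<times> J" for bs
    using \<psi>\<phi>[OF that] Tc by (auto simp: \<psi>'_def W_def \<psi>_def coord_cinv)
  have homeo: "homeomorphic_maps (subtopology M W) (top_of_set (B \<times> J)) \<psi> \<psi>'"
    unfolding homeomorphic_maps_def
  proof (intro conjI ballI)
    have "continuous_map (subtopology M W) euclidean (coord c0)"
      using continuous_map_from_subtopology_mono[OF continuous_map_coord[OF c0(1)] WU(2)] .
    then have 1: "continuous_map (subtopology M W) (top_of_set T) (coord c0)"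
      using Weq by (auto simp: continuous_map_in_subtopology)
    have "continuous_on T (f \<circ> cinv c0)"
      by (rule smooth_on_imp_continuous[OF smooth_on_subset[OF submersionD(2)[OF f(1) c0(1)] T(3)]])
    moreover have "continuous_on T t"
      using t T(4) unfolding height_def by (meson continuous_at_imp_continuous_on has_derivative_continuous subsetD)
    ultimately have "continuous_on T (\<lambda>y. (f (cinv c0 y), t y))" by (auto simp: o_def intro: continuous_on_Pair)
    then have 2: "continuous_map (top_of_set T) (top_of_set (B \<times> J)) (\<lambda>y. (f (cinv c0 y), t y))"
      using \<phi>\<psi> by (auto simp: continuous_map_in_subtopology)
    show "continuous_map (subtopology M W) (top_of_set (B \<times> J)) \<psi>"
      by (rule continuous_map_eq[OF continuous_map_compose[OF 1 2]])
         (use WU(2) in \<open>auto simp: \<psi>_def cinv_coord[OF c0(1)]\<close>)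
    have 3: "continuous_map (top_of_set (B \<times> J)) (top_of_set (cran c0)) \<phi>"
      using smooth_on_imp_continuous[OF sm\<phi>] \<psi>\<phi> Tc by (auto simp: continuous_map_in_subtopology)
    have "continuous_map (top_of_set (B \<times> J)) M \<psi>'"
      using continuous_map_compose[OF 3 continuous_map_cinv[OF c0(1)]] by (simp add: \<psi>'_def o_def)
    then show "continuous_map (top_of_set (B \<times> J)) (subtopology M W) \<psi>'"
      using \<psi>'BJ(1) by (auto simp: continuous_map_in_subtopology)
  qed (use \<psi>W(2) \<psi>'BJ(2) in auto)
  then have homeo_map: "homeomorphic_map (subtopology M W) (top_of_set (B \<times> J)) \<psi>"
    by (metis homeomorphic_map_maps)
  have d\<psi>: "((\<psi> \<circ> cinv c) has_derivative (\<lambda>w. (tangent_map f c x w, characteristic_form g V c x w))) (at x)"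
    if c: "c \<in> A" and x: "x \<in> cimg c W" for c x
  proof -
    have "x \<in> cimg c U" "x \<in> cimg c (cinv c0 ` ball z r)" using x WU by (auto simp: cimg_def)
    from has_derivative_Pair[OF submersion_derivative(1)[OF f(1) c this(1)] height_has_derivative[OF t c0(1) c this(2)]]
    show ?thesis by (simp add: \<psi>_def[abs_def] o_def)
  qed
  have t\<psi>: "tangent_map \<psi> c x = (\<lambda>w. (tangent_map f c x w, characteristic_form g V c x w))"
    if "c \<in> A" "x \<in> cimg c W" for c x
    unfolding tangent_map_def[of \<psi>] by (rule dir_deriv_eqI[OF d\<psi>[OF that]])
  have sm\<psi>: "smooth_map_on A W \<psi>"
    unfolding smooth_map_on_def
  proof
    fix c assume c: "c \<in> A"
    have oc: "open (cimg c W)" by (rule open_cimg[OF c oW])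
    show "smooth_on (cimg c W) (\<psi> \<circ> cinv c)"
    proof (rule smooth_on_primitive[OF oc d\<psi>[OF c]])
      fix v
      have "cimg c W \<subseteq> cimg c U" using WU(1) by (auto simp: cimg_def)
      then have "smooth_on (cimg c W) (\<lambda>x. tangent_map f c x v)"
        unfolding tangent_map_def by (rule smooth_on_subset[OF smooth_on_dir_deriv[OF submersionD(2)[OF f(1) c]]])
      then show "smooth_on (cimg c W) (\<lambda>x. (tangent_map f c x v, characteristic_form g V c x v))"
        by (rule smooth_on_Pair[OF oc _ smooth_on_subset[OF smooth_characteristic[OF c] cimg_subset]])
    qed
  qed
  have inv\<psi>: "inv_into W \<psi> bs = \<psi>' bs" if "bs \<in> B \<times> J" for bs
    using \<psi>W(2) \<psi>'BJ[OF that] by (intro inv_into_f_eq) (auto intro: inj_on_inverseI)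
  have sminv: "smooth_on (\<psi> ` (W \<inter> cdom c)) (coord c \<circ> inv_into W \<psi>)" if c: "c \<in> A" for c
  proof -
    let ?Q = "\<psi> ` (W \<inter> cdom c)"
    have "openin (subtopology M W) (W \<inter> cdom c)" by (rule openin_subtopology_Int2[OF chartD(1)[OF c]])
    then have "openin (top_of_set (B \<times> J)) ?Q"
      using homeomorphic_imp_open_map[OF homeo_map] unfolding open_map_def by blast
    then have oQ: "open ?Q" using open_Times[OF BJ(1,3)] openin_open_trans by blast
    have Q: "?Q \<subseteq> B \<times> J" using \<psi>W(1) by blast
    have "\<phi> ` ?Q \<subseteq> cimg c0 (cdom c)"
    proof (rule image_subsetI)
      fix bs assume bs: "bs \<in> ?Q"
      then have "\<phi> bs \<in> cran c0" using \<psi>\<phi> Q Tc by blast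
      moreover have "\<psi>' bs \<in> cdom c" using bs \<psi>W(2) by auto
      ultimately show "\<phi> bs \<in> cimg c0 (cdom c)" by (simp add: mem_cimg[OF c0(1)] \<psi>'_def)
    qed
    then have "smooth_on ?Q (\<lambda>bs. trans_map c0 c (\<phi> bs))"
      by (rule smooth_on_compose[OF oQ _ smooth_trans_map[OF c0(1) c] smooth_on_subset[OF sm\<phi> Q]])
    then show ?thesis
      by (rule smooth_on_cong[OF oQ, rotated]) (simp add: inv\<psi>[OF subsetD[OF Q]] trans_map_def \<psi>'_def)
  qed
  define s0 where "s0 = t z"
  have s0: "s0 \<in> J" using \<phi>\<psi>[OF T(2)] by (simp add: s0_def)
  let ?q = "\<lambda>e e' c y. inner_at (g c y) (lift f e 0 c y) (lift f e' 0 c y)"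
  define h :: "real^2 \<Rightarrow> real^2^2" where "h b = (\<chi> i j. ?q (axis i 1) (axis j 1) c0 (\<phi> (b, s0)))" for b
  have h: "inner_at (h b) e e' = ?q e e' c0 (\<phi> (b, s0))" for b e e'
    unfolding lift_linear_expand[of _ f e c0 _ e']
    by (simp add: inner_at_def inner_vec_def matrix_vector_mult_def h_def sum_2 algebra_simps)
  have metric_prod: "inner_at (g c x) u v =
      inner_at (h (fst (\<psi> (cinv c x)))) (fst (tangent_map \<psi> c x u)) (fst (tangent_map \<psi> c x v))
      + 1 * snd (tangent_map \<psi> c x u) * snd (tangent_map \<psi> c x v)" if c: "c \<in> A" and x: "x \<in> cimg c W" for c x u v
  proof -
    have x': "x \<in> cimg c (cdom c0)" "x \<in> cimg c U" "x \<in> cimg c (cdom c0 \<inter> U)" using x WU by (auto simp: cimg_def)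
    define y where "y = trans_map c c0 x"
    have q: "cinv c x \<in> W" "coord c0 (cinv c x) = y"
      using x by (simp_all add: mem_cimg[OF c] y_def trans_map_def)
    have yT: "y \<in> T" using q by (simp add: Weq)
    obtain b s where bs: "\<psi> (cinv c x) = (b, s)" "b \<in> B" "s \<in> J" using \<psi>W(1)[OF q(1)] by auto
    have y: "y = \<phi> (b, s)"
      using \<phi>\<psi>[OF yT] bs(1) q WU(2) cinv_coord[OF c0(1), of "cinv c x"] by (auto simp: \<psi>_def)
    have "?q e e' c x = ?q e e' c0 y" for e e'
      using lift_trans[OF f(1) c c0(1) x'(3)] metric_trans[OF c c0(1) x'(1)] by (simp add: y_def)
    also have "?q e e' c0 y = inner_at (h b) e e'" for e e'
      unfolding h y
    proof (rule lift_inner_along_flow[OF f(1) c0(1) BJ(4) bs(3) s0 _ \<phi>'[OF bs(2)]])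
      show "\<phi> (b, s) \<in> cimg c0 U" if "s \<in> J" for s using \<psi>\<phi>[of "(b, s)"] bs(2) that T(3) by auto
    qed
    finally show ?thesis
      using metric_lift_decomposition[OF f(1) c x'(2), of u v] by (simp add: t\<psi>[OF c x] bs(1))
  qed
  have vert: "vertical_space F c x = {v. fst (tangent_map \<psi> c x v) = 0}" if c: "c \<in> A" and x: "x \<in> cimg c W" for c x
  proof -
    have xU: "x \<in> cimg c U" and xc: "x \<in> cran c" using x WU cimg_subset by (auto simp: cimg_def)
    show ?thesis
      unfolding t\<psi>[OF c x] vertical_space_eq[OF c xc]
    proof (intro equalityI subsetI)
      fix v assume "v \<in> {v. fst (tangent_map f c x v, characteristic_form g V c x v) = 0}"
      then have "tangent_map f c x v = 0" by simp
      from submersion_kernel[OF f(1) c xU this] show "v \<in> range (\<lambda>r. r *\<^sub>R V c x)" by (rule range_eqI)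
    qed (auto simp: linear_cmul[OF submersion_derivative(2)[OF f(1) c xU]] submersion_V[OF f(1) c xU])
  qed
  have horiz: "horizontal_space F g c x = {v. snd (tangent_map \<psi> c x v) = 0}" if c: "c \<in> A" and x: "x \<in> cimg c W" for c x
  proof -
    have "x \<in> cran c" using x cimg_subset by blast
    then show ?thesis by (simp add: t\<psi>[OF c x] horizontal_space_eq[OF c] characteristic_form_def)
  qed
  show "\<exists>W (\<psi> :: 'a \<Rightarrow> (real^2) \<times> real) B J (h :: real^2 \<Rightarrow> real^2^2) (k :: real \<Rightarrow> real).
        openin M W \<and> p \<in> W \<and>
        open B \<and> connected B \<and> open J \<and> connected J \<and>
        homeomorphic_map (subtopology M W) (top_of_set (B \<times> J)) \<psi> \<and>
        smooth_map_on A W \<psi> \<and>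
        (\<forall>c\<in>A. smooth_on (\<psi> ` (W \<inter> cdom c)) (coord c \<circ> inv_into W \<psi>)) \<and>
        (\<forall>c\<in>A. \<forall>x\<in>cimg c W.
           vertical_space F c x = {v. fst (tangent_map \<psi> c x v) = 0} \<and>
           horizontal_space F g c x = {v. snd (tangent_map \<psi> c x v) = 0} \<and>
           (\<forall>u v. inner_at (g c x) u v =
              inner_at (h (fst (\<psi> (cinv c x)))) (fst (tangent_map \<psi> c x u)) (fst (tangent_map \<psi> c x v))
              + k (snd (\<psi> (cinv c x))) * snd (tangent_map \<psi> c x u) * snd (tangent_map \<psi> c x v)))"
  proof (rule exI[of _ W], rule exI[of _ \<psi>], rule exI[of _ B], rule exI[of _ J], rule exI[of _ h],
      rule exI[of _ "\<lambda>_. 1"], intro conjI ballI allI)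
  qed (fact oW pW BJ(1-3) convex_connected[OF BJ(4)] homeo_map sm\<psi> | rule sminv vert horiz metric_prod, assumption+)+
qed

end

theorem corollary1p5:
  fixes M :: "'a topology" and A :: "('a, 3) chart set"
    and F :: "('a, 2) cocycle" and g :: "('a, 3) metric" and V :: "('a, 3) vfield"
  defines "\<omega> \<equiv> wedge (mean_curvature_form g V) (characteristic_form g V)"
  assumes "closed_manifold M A" and "oriented_atlas A"
    and "riemannian_foliation M A F" and "transversely_oriented M F"
    and "dominguez_metric M A F g V"
    and "unit_tangent_field M A F g V"
  shows "((\<forall>c\<in>A. \<forall>x\<in>coord c ` cdom c. ricci (g c) (V c) (V c) x = 0) \<and> harmonic2 A g \<omega>
            \<longrightarrow> horizontal_integrable M A F g \<and> totally_geodesic M A F g \<and>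
                (\<forall>c\<in>A. \<forall>x\<in>coord c ` cdom c. \<forall>u v. \<omega> c x u v = 0) \<and>
                locally_product_of_plaques M A F g) \<and>
         (horizontal_integrable M A F g \<and> totally_geodesic M A F g
            \<longrightarrow> (\<forall>c\<in>A. \<forall>x\<in>coord c ` cdom c. ricci (g c) (V c) (V c) x = 0) \<and>
                (\<forall>c\<in>A. \<forall>x\<in>coord c ` cdom c. \<forall>u v. \<omega> c x u v = 0) \<and>
                harmonic2 A g \<omega>)"
proof -
  interpret riemannian_flow M A F g V
    using assms(2,4,6,7)
    by unfold_locales (simp_all add: closed_manifold_def riemannian_foliation_def dominguez_metric_def)
  have \<omega>0: "\<omega> c x u v = 0" if "mean_curvature_field g V c x = 0" for c x u v
    unfolding \<omega>_def by (rule mean_curvature_wedge_eq_0[OF that])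
  show ?thesis
  proof (rule conjI; rule impI; elim conjE)
    assume ric: "\<forall>c\<in>A. \<forall>x\<in>cran c. ricci (g c) (V c) (V c) x = 0" and har: "harmonic2 A g \<omega>"
    have \<tau>: "mean_curvature_field g V c x = 0" if "c \<in> A" "x \<in> cran c" for c x
      by (rule mean_curvature_eq_0_if_coclosed[OF _ that])
         (use har in \<open>unfold harmonic2_def \<omega>_def, blast\<close>)
    interpret parallel_flow M A F g V
    proof unfold_locales
      fix c x u assume c: "c \<in> A" and x: "x \<in> cran c"
      interpret unit_field_chart3 "cran c" "g c" "V c" by (rule unit_field_chart3[OF c])
      show "cov_deriv (g c) (V c) x u = 0"
      proof (rule cov_deriv_eq_0_if_ricci_0[OF x bundle_like_cov_deriv[OF c]])
        show "acceleration y = 0" if "y \<in> cran c" for y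
          using \<tau>[OF c that] by (simp add: mean_curvature_acceleration[OF c that])
        show "ricci (g c) (V c) (V c) x = 0" using ric c x by blast
      qed
    qed
    show "horizontal_integrable M A F g \<and> totally_geodesic M A F g \<and>
        (\<forall>c\<in>A. \<forall>x\<in>cran c. \<forall>u v. \<omega> c x u v = 0) \<and> locally_product_of_plaques M A F g"
      using horizontal_integrable totally_geodesic_if_minimal[OF \<tau>] \<omega>0[OF \<tau>] locally_product by blast
  next
    assume int: "horizontal_integrable M A F g" and tg: "totally_geodesic M A F g"
    note \<tau> = minimal_if_totally_geodesic[OF tg]
    have "ricci (g c) (V c) (V c) x = 0" if c: "c \<in> A" and x: "x \<in> cran c" for c x
    proof -
      interpret unit_field_chart3 "cran c" "g c" "V c" by (rule unit_field_chart3[OF c])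
      show ?thesis by (rule ricci_eq_0_if_parallel[OF x parallel_if_integrable_minimal[OF int \<tau> c]])
    qed
    then show "(\<forall>c\<in>A. \<forall>x\<in>cran c. ricci (g c) (V c) (V c) x = 0) \<and>
        (\<forall>c\<in>A. \<forall>x\<in>cran c. \<forall>u v. \<omega> c x u v = 0) \<and> harmonic2 A g \<omega>"
      using \<omega>0[OF \<tau>] harmonic_if_0[of \<omega>, OF \<omega>0[OF \<tau>]] by blast
  qed
qed

end
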